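(* Let $\{\mathbf H_\omega\}$ be a bounded ergodic Hankel operator which is positive semi-definite almost surely, with IDS measure $\nu$ and associated measures $\Sigma_\omega$. Then $$\nu(\mathbb R_+)=D(\operatorname{supp}\Sigma_\omega),$$ where $D(\operatorname{supp}\Sigma_\omega)=\frac1\tau\mathbf E\{\#(\operatorname{supp}\Sigma_\omega\cap[0,\tau))\}$, and both sides may be finite or infinite.
   Context: Let $(\Omega,\mathcal F,\mathbf P)$ be a probability space with expectation $\mathbf E$, and let $\{T_a\}$ be an ergodic group of measure-preserving automorphisms of $\Omega$, indexed either by $a\in\mathbb R$ (continuous case) or by $a\in\mathbb Z$ (discrete case, $T_a=T^a$). Fix $\tau>0$; $U_a$ is the shift $(U_af)(\xi)=f(\xi+a)$ on $L^2(\mathbb R)$. A Hankel operator on $L^2(\mathbb R_+)$ with kernel function $h$ is $(Hf)(t)=\int_0^\infty h(t+s)f(s)\,ds$; with $(\mathcal Ef)(\xi)=e^{\xi/2}f(e^\xi)$ set $\mathbf H=\mathcal EH\mathcal E^*$, the integral operator on $L^2(\mathbb R)$ with kernel $e^{(x+y)/2}h(e^x+e^y)$. A bounded self-adjoint ergodic Hankel operator is a weakly measurable family $\{\mathbf H_\omega\}$ of such operators with real-valued kernel functions $h_\omega$, satisfying $\mathbf H_{T_a\omega}U_{\tau a}=U_{\tau a}\mathbf H_\omega$ for all admissible $a$, and almost surely $|h_\omega(t)|\le C_h/t$ for all $t>0$ with $C_h$ independent of $\omega$. If $\mathbf H_\omega$ is positive semi-definite a.s., there is a unique family of positive Borel measures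 $\Sigma_\omega$ on $\mathbb R$ with $h_\omega(t)=\int e^{-te^{-\xi}}e^{-\xi}d\Sigma_\omega(\xi)$, satisfying $\Sigma_{T_a\omega}(\Delta)=\Sigma_\omega(\Delta+\tau a)$ and $\sup_x\Sigma_\omega((x-1,x+1))\le C_\Sigma$ ($C_\Sigma$ independent of $\omega$); then $\mathbf H_\omega(x,y)=\int\beta(x-\xi)\beta(y-\xi)d\Sigma_\omega(\xi)$ with $\beta(\xi)=e^{-e^\xi}e^{\xi/2}$. IDS measure: for Borel $\Delta\subset\mathbb R$ separated from $0$, $\chi_\Delta(\mathbf H_\omega)$ has a continuous integral kernel and $\nu(\Delta)=\mathbf E\{\chi_\Delta(\mathbf H_\omega)(0,0)\}$ (continuous case), $\nu(\Delta)=\mathbf E\{\frac1\tau\int_0^\tau\chi_\Delta(\mathbf H_\omega)(x,x)\,dx\}$ (discrete case); $\nu(\{0\})=0$, and $\mathbb R_+=(0,\infty)$. *)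

theory Defs
  imports "HOL-Probability.Probability"
begin

definition sq_int :: "(real \<Rightarrow> real) \<Rightarrow> bool" where
  "sq_int f \<longleftrightarrow> f \<in> borel_measurable lborel \<and> integrable lborel (\<lambda>x. (f x)\<^sup>2)"

definition l2_inner :: "(real \<Rightarrow> real) \<Rightarrow> (real \<Rightarrow> real) \<Rightarrow> real" where
  "l2_inner f g = (LINT x|lborel. f x * g x)"

definition kop :: "(real \<Rightarrow> real \<Rightarrow> real) \<Rightarrow> (real \<Rightarrow> real) \<Rightarrow> real \<Rightarrow> real" where
  "kop K f = (\<lambda>x. LINT y|lborel. K x y * f y)"

text \<open>Kernel of the operator E H E^* for the Hankel operator with kernel function h.\<close>
definition hankel_kernel :: "(real \<Rightarrow> real) \<Rightarrow> real \<Rightarrow> real \<Rightarrow> real" where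
  "hankel_kernel h x y = exp ((x + y) / 2) * h (exp x + exp y)"

definition hbeta :: "real \<Rightarrow> real" where
  "hbeta \<xi> = exp (- exp \<xi>) * exp (\<xi> / 2)"

text \<open>For a bounded self-adjoint operator H and f in L2, the spectral measure mu_f is the
  (unique, compactly supported) finite Borel measure with moments
  int lambda^n d mu_f = <H^n f, f>.  Then <chi_Delta(H) f, f> = mu_f(Delta).\<close>
definition spec_meas :: "(real \<Rightarrow> real \<Rightarrow> real) \<Rightarrow> (real \<Rightarrow> real) \<Rightarrow> real measure \<Rightarrow> bool" where
  "spec_meas K f \<mu> \<longleftrightarrow> finite_measure \<mu> \<and> sets \<mu> = sets borel \<and>
     (\<forall>n::nat. integrable \<mu> (\<lambda>s. s ^ n) \<and>
        (LINT s|\<mu>. s ^ n) = l2_inner ((kop K ^^ n) f) f)"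

definition specproj_form :: "(real \<Rightarrow> real \<Rightarrow> real) \<Rightarrow> real set \<Rightarrow> (real \<Rightarrow> real) \<Rightarrow> real" where
  "specproj_form K \<Delta> f = measure (SOME \<mu>. spec_meas K f \<mu>) \<Delta>"

text \<open>The continuous (symmetric) integral kernel of chi_Delta(H), determined by its
  quadratic form on continuous compactly supported functions.\<close>
definition spec_kernel :: "(real \<Rightarrow> real \<Rightarrow> real) \<Rightarrow> real set \<Rightarrow> real \<Rightarrow> real \<Rightarrow> real" where
  "spec_kernel K \<Delta> = (SOME P. continuous_on UNIV (\<lambda>(x, y). P x y) \<and> (\<forall>x y. P x y = P y x) \<and>
      (\<forall>f. continuous_on UNIV f \<and> (\<exists>R. \<forall>x. \<bar>x\<bar> > R \<longrightarrow> f x = 0) \<longrightarrow>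
         (LINT x|lborel. LINT y|lborel. P x y * f x * f y) = specproj_form K \<Delta> f))"

text \<open>G is the index group (either all of R: continuous case, or Z: discrete case).\<close>
definition ids :: "'a measure \<Rightarrow> real \<Rightarrow> real set \<Rightarrow> ('a \<Rightarrow> real \<Rightarrow> real \<Rightarrow> real) \<Rightarrow> real set \<Rightarrow> ennreal" where
  "ids M \<tau> G Hk \<Delta> =
     (if G = UNIV then (\<integral>\<^sup>+ \<omega>. ennreal (spec_kernel (Hk \<omega>) \<Delta> 0 0) \<partial>M)
      else (\<integral>\<^sup>+ \<omega>. ennreal (1 / \<tau>) * (\<integral>\<^sup>+ x\<in>{0..\<tau>}. ennreal (spec_kernel (Hk \<omega>) \<Delta> x x) \<partial>lborel) \<partial>M))"

text \<open>nu(R_+) for the measure nu on R minus 0: by continuity from below,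
  nu((0,oo)) = sup over eps>0 of nu([eps,oo)).\<close>
definition ids_pos :: "'a measure \<Rightarrow> real \<Rightarrow> real set \<Rightarrow> ('a \<Rightarrow> real \<Rightarrow> real \<Rightarrow> real) \<Rightarrow> ennreal" where
  "ids_pos M \<tau> G Hk = (SUP \<epsilon>\<in>{0<..}. ids M \<tau> G Hk {\<epsilon>..})"

definition measure_support :: "real measure \<Rightarrow> real set" where
  "measure_support \<mu> = {x. \<forall>e>0. emeasure \<mu> (ball x e) > 0}"

definition ecard :: "'b set \<Rightarrow> ennreal" where
  "ecard S = (if finite S then of_nat (card S) else \<infinity>)"

definition supp_density :: "'a measure \<Rightarrow> real \<Rightarrow> ('a \<Rightarrow> real measure) \<Rightarrow> ennreal" where
  "supp_density M \<tau> \<Sigma> = ennreal (1 / \<tau>) * (\<integral>\<^sup>+ \<omega>. ecard (measure_support (\<Sigma> \<omega>) \<inter> {0..<\<tau>}) \<partial>M)"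

definition ergodic_hankel ::
  "'a measure \<Rightarrow> real set \<Rightarrow> (real \<Rightarrow> 'a \<Rightarrow> 'a) \<Rightarrow> real \<Rightarrow> ('a \<Rightarrow> real \<Rightarrow> real) \<Rightarrow> bool" where
  "ergodic_hankel M G T \<tau> h \<longleftrightarrow>
     prob_space M \<and> (G = UNIV \<or> G = range real_of_int) \<and> \<tau> > 0 \<and>
     \<comment> \<open>measure-preserving group action\<close>
     (\<forall>a\<in>G. T a \<in> measurable M M \<and> distr M M (T a) = M) \<and>
     (\<forall>\<omega>\<in>space M. T 0 \<omega> = \<omega>) \<and>
     (\<forall>a\<in>G. \<forall>b\<in>G. \<forall>\<omega>\<in>space M. T (a + b) \<omega> = T a (T b \<omega>)) \<and>
     \<comment> \<open>ergodicity\<close>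
     (\<forall>A\<in>sets M. (\<forall>a\<in>G. T a -` A \<inter> space M = A) \<longrightarrow>
        measure M A = 0 \<or> measure M A = 1) \<and>
     \<comment> \<open>kernel functions are Borel\<close>
     (\<forall>\<omega>\<in>space M. h \<omega> \<in> borel_measurable borel) \<and>
     \<comment> \<open>weak measurability\<close>
     (\<forall>f g. sq_int f \<and> sq_int g \<longrightarrow>
        (\<lambda>\<omega>. l2_inner (kop (hankel_kernel (h \<omega>)) f) g) \<in> borel_measurable M) \<and>
     \<comment> \<open>covariance  H_{T_a omega} U_{tau a} = U_{tau a} H_omega\<close>
     (\<forall>a\<in>G. \<forall>\<omega>\<in>space M. \<forall>f. sq_int f \<longrightarrow>
        (AE x in lborel. kop (hankel_kernel (h (T a \<omega>))) (\<lambda>\<xi>. f (\<xi> + \<tau> * a)) x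
                         = kop (hankel_kernel (h \<omega>)) f (x + \<tau> * a))) \<and>
     \<comment> \<open>uniform bound |h(t)| <= C_h / t\<close>
     (\<exists>C. AE \<omega> in M. \<forall>t>0. \<bar>h \<omega> t\<bar> \<le> C / t)"

end

theory Submission
  imports Defs
begin

text \<open>Normalise the operator to a contraction \<open>T = A A\<^sup>*\<close> with \<open>A: L\<^sup>2(\<Sigma>) \<rightarrow> L\<^sup>2(\<real>)\<close>.
  Since \<open>\<chi>\<^bsub>(0,\<infinity>)\<^esub>(s) = \<Sum>n. (n + 1) s\<^sup>2 (1 - s)\<^sup>n\<close> on \<open>[0,1]\<close>, the diagonal of the kernel of the spectral
  projection is \<open>\<Sum>n. (n + 1) \<langle>(1 - T)\<^sup>n T\<^sub>x, T\<^sub>x\<rangle>\<close> with \<open>T\<^sub>x\<close> a row of the kernel of \<open>T\<close>. Stationarity, in the form of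
  mass transport between \<open>dx\<close> and \<open>d\<Sigma>\<close>, turns its mean over \<open>[0,\<tau>)\<close> into the mean of the integral of
  \<open>\<Sum>n. \<langle>(1 - T)\<^sup>n \<beta>\<^sub>\<xi>, \<beta>\<^sub>\<xi>\<rangle>\<close> with respect to \<open>\<Sigma>\<close> over \<open>[0,\<tau>)\<close>, where \<open>\<beta>\<^sub>\<xi> = \<beta>(\<cdot> - \<xi>)\<close>. As \<open>A\<close> is injective (a
  uniqueness statement for Laplace transforms), this sum is \<open>1 / \<Sigma>{\<xi>}\<close> on the support of \<open>\<Sigma>\<close>, so the
  integral counts the points of the support; it is infinite as soon as these accumulate. The
  spectral measures come from Hausdorff's moment theorem, and \<open>\<chi>\<^bsub>[\<epsilon>,\<infinity>)\<^esub>(T)\<close> from bounded pointwise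
  approximation by polynomials.\<close>

section \<open>The Hausdorff moment problem\<close>

text \<open>Evaluation at a point is not a vector of L^2, so the diagonal of \<chi>(T) is not a
  matrix element of \<chi>(T). The rows make up for it: the diagonal is formally <T^(-2) T_x, T_x>,
  which explains the factor s^2 in the series, as 1/s^2 is the sum of (n + 1)(1 - s)^n. Exchanging
  dx with d\<Sigma> is cyclicity of the trace for A and its adjoint: <T^j T_x, T_x> becomes <T^(j+1)
  \<beta>_\<xi>, \<beta>_\<xi>>, and the additional power of T turns 1/s^2 into 1/s, also the sum of
  (1 - s)^n. Injectivity of A makes the range of its adjoint dense, so the last sum is the squared
  norm of evaluation at \<xi> on L^2(\<Sigma>), that is 1/\<Sigma>{\<xi>}. Two obstacles shape the
  rest. The data are given through almost everywhere identities and choices by \<open>SOME\<close>,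
  so pointwise values come from testing continuous kernels on small bumps, and spectral measures
  enter through their moments. And everything must be measurable in \<omega>, hence the polynomials
  that are the same for all \<omega> and the moments written in terms of the kernel alone. As both
  sides may be infinite, series of nonnegative terms stand in for negative powers of T.\<close>

lemma sum_binomial_Suc:
  fixes f :: "nat \<Rightarrow> 'a::comm_semiring_1"
  shows "(\<Sum>i\<le>Suc m. of_nat (Suc m choose i) * f i) =
    (\<Sum>i\<le>m. of_nat (m choose i) * f (Suc i)) + (\<Sum>i\<le>m. of_nat (m choose i) * f i)"
proof -
  have "(\<Sum>i\<le>m. of_nat (m choose i) * f i) = (\<Sum>i\<le>Suc m. of_nat (m choose i) * f i)"
    by (simp add: binomial_eq_0)
  also have "\<dots> = f 0 + (\<Sum>i\<le>m. of_nat (m choose Suc i) * f (Suc i))"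
    by (subst sum.atMost_Suc_shift) simp
  finally have "(\<Sum>i\<le>m. of_nat (m choose i) * f i) = \<dots>" .
  moreover have "(\<Sum>i\<le>Suc m. of_nat (Suc m choose i) * f i) =
    f 0 + (\<Sum>i\<le>m. of_nat (Suc m choose Suc i) * f (Suc i))"
    by (subst sum.atMost_Suc_shift) simp
  ultimately show ?thesis
    by (simp add: sum.distrib distrib_left ac_simps del: sum.atMost_Suc)
qed

text \<open>The product is the ratio of the falling factorials of i and n. It replaces (i / n)^j
  because the binomial coefficients absorb it exactly, so that the discrete measures have exact
  moments of this modified kind.\<close>

lemma binomial_times_falling_ratio:
  assumes "j \<le> i" "i \<le> n"
  shows "real (n choose i) * (\<Prod>l<j. real (i - l) / real (n - l)) = real ((n - j) choose (i - j))"
  using assms(1)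
proof (induction j)
  case (Suc j)
  have eq: "n - j = Suc (n - Suc j)" "i - j = Suc (i - Suc j)"
    using Suc.prems assms by auto
  have "real (i - j) * real ((n - j) choose (i - j)) = real (n - j) * real ((n - Suc j) choose (i - Suc j))"
    unfolding eq of_nat_mult[symmetric] Suc_times_binomial by simp
  moreover have "real (n - j) > 0" using eq by simp
  ultimately show ?case
    using Suc by (simp add: field_simps)
qed simp

text \<open>Products of j numbers from [0,1] differ by at most the sum of the differences of the
  factors, and each of these is at most j / n. If l exceeds i, then i - l is 0 by truncation and i /
  n itself is small enough.\<close>

lemma falling_ratio_approx:
  assumes "i \<le> n" "j \<le> n" "0 < n"
  shows "\<bar>(real i / real n) ^ j - (\<Prod>l<j. real (i - l) / real (n - l))\<bar> \<le> real j * real j / real n"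
proof -
  have "norm ((\<Prod>l<j. real i / real n) - (\<Prod>l<j. real (i - l) / real (n - l)))
      \<le> (\<Sum>l<j. norm (real i / real n - real (i - l) / real (n - l)))"
    using assms by (intro norm_prod_diff) (auto simp: divide_le_eq_1)
  also have "\<dots> \<le> (\<Sum>l<j. real j / real n)"
  proof (intro sum_mono)
    fix l assume l: "l \<in> {..<j}"
    show "norm (real i / real n - real (i - l) / real (n - l)) \<le> real j / real n"
    proof (cases "l \<le> i")
      case True
      have n: "real n > 0" "real n - real l > 0" using assms l by auto
      have "real i / real n - real (i - l) / real (n - l) = real l * (real n - real i) / (real n * (real n - real l))"
        using n True l assms by (simp add: of_nat_diff field_simps)
      also have "\<bar>\<dots>\<bar> \<le> real l / real n"
      proof -
        have "real l * (real n - real i) \<le> real l * (real n - real l)"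
          using True by (intro mult_left_mono) auto
        moreover have "0 \<le> real l * (real n - real i)" using assms by simp
        ultimately show ?thesis
          using n assms by (simp add: divide_simps)
      qed
      also have "\<dots> \<le> real j / real n" using l n by (simp add: divide_right_mono)
      finally show ?thesis by simp
    next
      case False
      then show ?thesis using l assms by (simp add: divide_right_mono)
    qed
  qed
  finally show ?thesis by simp
qed

text \<open>The number \<open>e k j\<close> is to become the integral of \<open>s ^ k * (1 - s) ^ j\<close>; the measure is a
  weak limit of the discrete measures with mass \<open>(n choose i) * e i (n - i)\<close> at \<open>i / n\<close>.\<close>

context
  fixes e :: "nat \<Rightarrow> nat \<Rightarrow> real"
  assumes e_nonneg: "\<And>k j. 0 \<le> e k j"
    and e_rec: "\<And>k j. e k j = e (Suc k) j + e k (Suc j)"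
begin

text \<open>Under the integral this inserts 1 = (s + (1 - s))^m into s^k (1 - s)^j; here Pascal's
  rule and \<open>e_rec\<close> do the same without a measure.\<close>

lemma e_expand: "(\<Sum>i\<le>m. real (m choose i) * e (k + i) (j + m - i)) = e k j"
proof (induction m arbitrary: k j)
  case (Suc m)
  have "(\<Sum>i\<le>Suc m. real (Suc m choose i) * e (k + i) (j + Suc m - i)) =
     (\<Sum>i\<le>m. real (m choose i) * e (k + Suc i) (j + Suc m - Suc i)) +
     (\<Sum>i\<le>m. real (m choose i) * e (k + i) (j + Suc m - i))"
    by (rule sum_binomial_Suc[where f="\<lambda>i. e (k + i) (j + Suc m - i)"])
  also have "\<dots> = e (Suc k) j + e k (Suc j)"
    using Suc[of "Suc k" j] Suc[of k "Suc j"] by simp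
  finally show ?case using e_rec[of k j] by simp
qed simp

lemma e_le: "e k 0 \<le> e 0 0"
proof (induction k)
  case (Suc k)
  then show ?case using e_rec[of k 0] e_nonneg[of k "Suc 0"] by linarith
qed simp

definition bern_weight :: "nat \<Rightarrow> nat \<Rightarrow> real" where
  "bern_weight n i = real (n choose i) * e i (n - i)"

lemma bern_weight_nonneg: "0 \<le> bern_weight n i"
  by (simp add: bern_weight_def e_nonneg)

lemma sum_bern_weight: "(\<Sum>i\<le>n. bern_weight n i) = e 0 0"
  using e_expand[of n 0 0] by (simp add: bern_weight_def)

text \<open>Terms with i < j vanish because the product contains the factor l = i. In the others the
  falling ratio turns \<open>n choose i\<close> into \<open>(n - j) choose (i - j)\<close>, and
  \<open>e_expand\<close> sums what is left.\<close>

lemma sum_bern_weight_falling: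
  assumes "j \<le> n"
  shows "(\<Sum>i\<le>n. bern_weight n i * (\<Prod>l<j. real (i - l) / real (n - l))) = e j 0"
proof -
  have "(\<Sum>i\<le>n. bern_weight n i * (\<Prod>l<j. real (i - l) / real (n - l)))
     = (\<Sum>i\<in>{j..n}. bern_weight n i * (\<Prod>l<j. real (i - l) / real (n - l)))"
    by (rule sum.mono_neutral_right) auto
  also have "\<dots> = (\<Sum>i\<in>{j..n}. real ((n - j) choose (i - j)) * e i (n - i))"
    unfolding bern_weight_def
    by (intro sum.cong refl, subst binomial_times_falling_ratio[symmetric]) (auto simp: ac_simps)
  also have "\<dots> = (\<Sum>i\<le>n - j. real ((n - j) choose i) * e (j + i) (0 + (n - j) - i))"
    by (rule sum.reindex_bij_witness[where i="\<lambda>i. i + j" and j="\<lambda>i. i - j"]) (use assms in auto)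
  also have "\<dots> = e j 0" by (rule e_expand)
  finally show ?thesis .
qed

lemma bern_moment_approx:
  assumes "j \<le> n" "0 < n"
  shows "\<bar>(\<Sum>i\<le>n. bern_weight n i * (real i / real n) ^ j) - e j 0\<bar> \<le> e 0 0 * (real j * real j) / real n"
proof -
  have "(\<Sum>i\<le>n. bern_weight n i * (real i / real n) ^ j) - e j 0
    = (\<Sum>i\<le>n. bern_weight n i * ((real i / real n) ^ j - (\<Prod>l<j. real (i - l) / real (n - l))))"
    unfolding sum_bern_weight_falling[OF assms(1), symmetric]
    by (simp add: right_diff_distrib sum_subtractf)
  also have "\<bar>\<dots>\<bar> \<le> (\<Sum>i\<le>n. bern_weight n i * (real j * real j / real n))"
  proof (rule order_trans[OF sum_abs], rule sum_mono)
    fix i assume "i \<in> {..n}"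
    then show "\<bar>bern_weight n i * ((real i / real n) ^ j - (\<Prod>l<j. real (i - l) / real (n - l)))\<bar>
        \<le> bern_weight n i * (real j * real j / real n)"
      unfolding abs_mult abs_of_nonneg[OF bern_weight_nonneg]
      using falling_ratio_approx assms by (intro mult_left_mono bern_weight_nonneg) auto
  qed
  also have "\<dots> = e 0 0 * (real j * real j) / real n"
    by (metis sum_distrib_right sum_bern_weight times_divide_eq_right)
  finally show ?thesis .
qed

lemma bern_moment_tendsto:
  "(\<lambda>n. \<Sum>i\<le>n. bern_weight n i * (real i / real n) ^ j) \<longlonglongrightarrow> e j 0"
proof -
  have "(\<lambda>n. (\<Sum>i\<le>n. bern_weight n i * (real i / real n) ^ j) - e j 0) \<longlonglongrightarrow> 0"
  proof (rule Lim_null_comparison)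
    show "\<forall>\<^sub>F n in sequentially. norm ((\<Sum>i\<le>n. bern_weight n i * (real i / real n) ^ j) - e j 0)
       \<le> e 0 0 * (real j * real j) / real n"
      using eventually_ge_at_top[of "max 1 j"]
      by eventually_elim (use bern_moment_approx in auto)
    show "(\<lambda>n. e 0 0 * (real j * real j) / real n) \<longlonglongrightarrow> 0"
      by (rule lim_const_over_n)
  qed
  then show ?thesis by (simp add: LIM_zero_iff)
qed

text \<open>Dividing by \<open>e 0 0\<close> makes the discrete measures probabilities on [0,1];
  they are tight, so a subsequence converges weakly, and \<open>bern_moment_tendsto\<close>
  identifies the moments of the limit.\<close>

lemma hausdorff_moment_pos:
  assumes pos: "0 < e 0 0"
  shows "\<exists>\<mu>. finite_measure \<mu> \<and> sets \<mu> = sets borel \<and> (AE s in \<mu>. 0 \<le> s \<and> s \<le> 1) \<and>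
    (\<forall>k. (LINT s|\<mu>. s ^ k) = e k 0)"
proof -
  define c where "c = e 0 0"
  define q where "q n i = (if i \<le> n then bern_weight n i / c else 0)" for n i
  define p where "p n = embed_pmf (q n)" for n
  define \<nu> where "\<nu> n = distr (measure_pmf (p n)) borel (\<lambda>i. real i / real n)" for n
  have c: "0 < c" by (simp add: c_def pos)
  have pmf_p: "pmf (p n) i = q n i" for n i
    unfolding p_def
  proof (rule pmf_embed_pmf)
    show "0 \<le> q n x" for x using c by (simp add: q_def bern_weight_nonneg)
    have "(\<integral>\<^sup>+ x. ennreal (q n x) \<partial>count_space UNIV) = (\<Sum>x\<le>n. ennreal (q n x))"
      by (rule nn_integral_count_space') (auto simp: q_def)
    also have "\<dots> = ennreal (\<Sum>x\<le>n. q n x)"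
      by (rule sum_ennreal) (use c in \<open>simp add: q_def bern_weight_nonneg\<close>)
    also have "(\<Sum>x\<le>n. q n x) = 1"
      using c by (simp add: q_def sum_divide_distrib[symmetric] sum_bern_weight c_def)
    finally show "(\<integral>\<^sup>+ x. ennreal (q n x) \<partial>count_space UNIV) = 1" by simp
  qed
  have set_p: "set_pmf (p n) \<subseteq> {..n}" for n
    by (auto simp: set_pmf_iff pmf_p q_def split: if_splits)
  have int_\<nu>: "(LINT s|\<nu> n. f s) = (\<Sum>i\<le>n. bern_weight n i * f (real i / real n)) / c"
    if [measurable]: "f \<in> borel_measurable borel" for f :: "real \<Rightarrow> real" and n
  proof -
    have "(LINT s|\<nu> n. f s) = (LINT i|measure_pmf (p n). f (real i / real n))"
      unfolding \<nu>_def by (subst integral_distr) auto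
    also have "\<dots> = (\<Sum>i\<le>n. f (real i / real n) * pmf (p n) i)"
      by (rule integral_measure_pmf_real) (use set_p in auto)
    also have "\<dots> = (\<Sum>i\<le>n. bern_weight n i * f (real i / real n)) / c"
      by (simp add: pmf_p q_def sum_divide_distrib mult.commute)
    finally show ?thesis .
  qed
  have rd: "real_distribution (\<nu> n)" for n
  proof -
    interpret prob_space "\<nu> n" unfolding \<nu>_def
      by (rule prob_space.prob_space_distr[OF prob_space_measure_pmf]) auto
    show ?thesis by unfold_locales (auto simp: \<nu>_def)
  qed
  have tight: "tight \<nu>"
    unfolding tight_def
  proof (intro conjI allI impI rd)
    fix \<epsilon> :: real assume "0 < \<epsilon>"
    have "measure (\<nu> n) {-1<..2} = 1" for n
    proof -
      have "AE i in measure_pmf (p n). real i / real n \<in> {-1<..2}"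
      proof (rule AE_pmfI)
        fix i assume "i \<in> set_pmf (p n)"
        then have "i \<le> n" using set_p by auto
        then have "real i / real n \<le> 1" by (cases "n = 0") simp_all
        moreover have "-1 < real i / real n" by (rule less_le_trans[of _ 0]) auto
        ultimately show "real i / real n \<in> {-1<..2}" by simp
      qed
      then show ?thesis unfolding \<nu>_def
        by (subst measure_distr) (auto simp: measure_pmf.prob_eq_1)
    qed
    then show "\<exists>a b. a < b \<and> (\<forall>n. 1 - \<epsilon> < measure (\<nu> n) {a<..b})"
      using \<open>0 < \<epsilon>\<close> by (intro exI[of _ "-1"] exI[of _ 2]) auto
  qed
  obtain r N where r: "strict_mono r" and N: "real_distribution N" and
    conv: "weak_conv_m (\<nu> \<circ> id \<circ> r) N"
    using tight_imp_convergent_subsubsequence[OF tight strict_mono_id] by blast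
  interpret N: real_distribution N by fact
  have conv_int: "(\<lambda>n. LINT s|\<nu> (r n). f s) \<longlonglongrightarrow> (LINT s|N. f s)"
    if "\<And>x. isCont f x" "\<And>x. norm (f x) \<le> D" for f :: "real \<Rightarrow> real" and D
    using weak_conv_imp_integral_bdd_continuous_conv[of "\<nu> \<circ> id \<circ> r" N f D] that rd N conv by (simp add: o_def)
  \<comment> \<open>Weak convergence only handles bounded continuous functions. Clamping to [0,1]
    makes powers bounded and changes nothing at the points i / n.\<close>
  define cl :: "real \<Rightarrow> real" where "cl s = max 0 (min 1 s)" for s
  have cl_cont: "isCont cl x" for x unfolding cl_def by (intro continuous_intros)
  have cl_meas[measurable]: "cl \<in> borel_measurable borel" unfolding cl_def by measurable
  have cl01: "0 \<le> cl s" "cl s \<le> 1" for s by (auto simp: cl_def)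
  have cl_frac: "cl (real i / real n) = real i / real n" if "i \<le> n" for i n
  proof -
    have "real i / real n \<le> 1" using that by (cases "n = 0") simp_all
    then show ?thesis by (simp add: cl_def)
  qed
  have supp: "AE s in N. cl s = s"
  proof -
    \<comment> \<open>A bounded continuous function that vanishes exactly on [0,1]: its integrals
      against the discrete measures are 0, hence so is the limit, which confines the limit measure
      to [0,1].\<close>
    define g where "g s = min 1 \<bar>s - cl s\<bar>" for s
    have [measurable]: "g \<in> borel_measurable borel" unfolding g_def by measurable
    have "(\<lambda>n. LINT s|\<nu> (r n). g s) \<longlonglongrightarrow> (LINT s|N. g s)"
    proof (rule conv_int[of _ 1])
      show "isCont g x" for x unfolding g_def by (intro continuous_intros cl_cont)
    qed (auto simp: g_def)
    moreover have "(LINT s|\<nu> n. g s) = 0" for n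
      by (subst int_\<nu>) (auto simp: g_def cl_frac)
    ultimately have z: "(LINT s|N. g s) = 0"
      by (simp add: LIMSEQ_const_iff)
    have "integrable N g"
      by (rule N.integrable_const_bound[where B=1]) (auto simp: g_def)
    then have "AE s in N. g s = 0"
      using z by (subst (asm) integral_nonneg_eq_0_iff_AE) (auto simp: g_def)
    then show ?thesis
      by eventually_elim (auto simp: g_def min_def split: if_splits)
  qed
  have mom: "(LINT s|N. s ^ k) = e k 0 / c" for k
  proof -
    have "(\<lambda>n. LINT s|\<nu> (r n). cl s ^ k) \<longlonglongrightarrow> (LINT s|N. cl s ^ k)"
    proof (rule conv_int[of _ 1])
      show "isCont (\<lambda>s. cl s ^ k) x" for x by (intro continuous_intros cl_cont)
      show "norm (cl s ^ k) \<le> 1" for s by (simp add: power_le_one cl01)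
    qed
    moreover have "(LINT s|\<nu> n. cl s ^ k) = (\<Sum>i\<le>n. bern_weight n i * (real i / real n) ^ k) / c" for n
      by (subst int_\<nu>) (auto simp: cl_frac intro!: sum.cong)
    moreover have "(\<lambda>n. (\<Sum>i\<le>r n. bern_weight (r n) i * (real i / real (r n)) ^ k) / c) \<longlonglongrightarrow> e k 0 / c"
      using LIMSEQ_subseq_LIMSEQ[OF bern_moment_tendsto[of k] r] c
      by (intro tendsto_divide) (auto simp: o_def)
    ultimately have "(LINT s|N. cl s ^ k) = e k 0 / c"
      by (simp add: LIMSEQ_unique)
    moreover have "(LINT s|N. cl s ^ k) = (LINT s|N. s ^ k)"
      by (rule integral_cong_AE) (use supp in \<open>auto elim: eventually_mono\<close>)
    ultimately show ?thesis by simp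
  qed
  let ?\<mu> = "density N (\<lambda>_. ennreal c)"
  have "finite_measure ?\<mu>"
    by (rule finite_measureI) (simp add: emeasure_density N.emeasure_space_1[simplified] ennreal_mult_eq_top_iff)
  moreover have "AE s in ?\<mu>. 0 \<le> s \<and> s \<le> 1"
  proof -
    have "AE s in N. 0 \<le> s \<and> s \<le> 1"
      using supp
    proof eventually_elim
      case (elim s)
      then show ?case using cl01[of s] by simp
    qed
    then show ?thesis by (subst AE_density) (auto elim: eventually_mono)
  qed
  moreover have "(LINT s|?\<mu>. s ^ k) = e k 0" for k
    using c by (subst integral_density) (auto simp: mom)
  ultimately show ?thesis by (intro exI[of _ ?\<mu>]) auto
qed

theorem hausdorff_moment:
  "\<exists>\<mu>. finite_measure \<mu> \<and> sets \<mu> = sets borel \<and> (AE s in \<mu>. 0 \<le> s \<and> s \<le> 1) \<and>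
    (\<forall>k. (LINT s|\<mu>. s ^ k) = e k 0)"
proof (cases "e 0 0 = 0")
  case True
  then have "e k 0 = 0" for k
    using e_le[of k] e_nonneg[of k 0] by linarith
  then show ?thesis
    by (intro exI[of _ "null_measure borel"])
      (auto intro!: finite_measureI simp: AE_iff_null null_sets_def)
qed (use e_nonneg[of 0 0] hausdorff_moment_pos in force)

end

section \<open>Bounded pointwise approximation by polynomials and its consequences for
  moments\<close>

lemma polynomial_sequence_bounded_limit:
  fixes g :: "nat \<Rightarrow> real \<Rightarrow> real"
  assumes cont: "\<And>n. continuous_on {0..1} (g n)"
    and bound: "\<And>n s. s \<in> {0..1} \<Longrightarrow> \<bar>g n s\<bar> \<le> D"
    and lim: "\<And>s. s \<in> {0..1} \<Longrightarrow> (\<lambda>n. g n s) \<longlonglongrightarrow> G s"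
  shows "\<exists>a d. (\<forall>n. \<forall>s\<in>{0..1}. \<bar>\<Sum>i\<le>d n. a n i * s ^ i\<bar> \<le> D + 1) \<and>
    (\<forall>s\<in>{0..1}. (\<lambda>n. \<Sum>i\<le>d n. a n i * s ^ i) \<longlonglongrightarrow> G s)"
proof -
  have "\<exists>a d. \<forall>s\<in>{0..1}. \<bar>g n s - (\<Sum>i\<le>d. a i * s ^ i)\<bar> < 1 / real (Suc n)" for n
  proof -
    obtain p where p: "real_polynomial_function p" "\<And>s. s \<in> {0..1} \<Longrightarrow> \<bar>g n s - p s\<bar> < 1 / real (Suc n)"
      by (rule Stone_Weierstrass_real_polynomial_function[of "{0..1}" "g n" "1 / real (Suc n)"]) (use cont in auto)
    then show ?thesis
      using real_polynomial_function_imp_sum[OF p(1)] by metis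
  qed
  then obtain a d where ad: "\<And>n s. s \<in> {0..1} \<Longrightarrow> \<bar>g n s - (\<Sum>i\<le>d n. a n i * s ^ i)\<bar> < 1 / real (Suc n)"
    by metis
  have "\<bar>\<Sum>i\<le>d n. a n i * s ^ i\<bar> \<le> D + 1" if "s \<in> {0..1}" for n s
  proof -
    have "1 / real (Suc n) \<le> 1" by simp
    then show ?thesis using ad[OF that, of n] bound[OF that, of n] by linarith
  qed
  moreover have "(\<lambda>n. \<Sum>i\<le>d n. a n i * s ^ i) \<longlonglongrightarrow> G s" if s: "s \<in> {0..1}" for s
  proof -
    have "(\<lambda>n. g n s - (\<Sum>i\<le>d n. a n i * s ^ i)) \<longlonglongrightarrow> 0"
      by (rule Lim_null_comparison[OF _ LIMSEQ_inverse_real_of_nat])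
        (use ad[OF s] in \<open>auto simp: inverse_eq_divide intro!: always_eventually less_imp_le\<close>)
    from tendsto_diff[OF lim[OF s] this] show ?thesis by simp
  qed
  ultimately show ?thesis by blast
qed

text \<open>The discontinuous cut-off is the pointwise limit of continuous ramps that are 1 from c
  onwards and 0 below c - 1/n; these are then replaced by polynomials, uniformly on [0,1].\<close>

lemma polynomial_sequence_threshold:
  fixes \<phi> :: "real \<Rightarrow> real"
  assumes cont: "continuous_on {0..1} \<phi>"
  shows "\<exists>a d D. (\<forall>n. \<forall>s\<in>{0..1}. \<bar>\<Sum>i\<le>d n. a n i * s ^ i\<bar> \<le> D) \<and>
    (\<forall>s\<in>{0..1}. (\<lambda>n. \<Sum>i\<le>d n. a n i * s ^ i) \<longlonglongrightarrow> (if c \<le> s then \<phi> s else 0))"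
proof -
  obtain D where D: "\<And>s. s \<in> {0..1} \<Longrightarrow> \<bar>\<phi> s\<bar> \<le> D"
    using compact_imp_bounded[OF compact_continuous_image[OF cont compact_Icc]]
    by (fastforce simp: bounded_iff)
  define g where "g n s = \<phi> s * max 0 (1 - real n * max 0 (c - s))" for n :: nat and s
  have "\<exists>a d. (\<forall>n. \<forall>s\<in>{0..1}. \<bar>\<Sum>i\<le>d n. a n i * s ^ i\<bar> \<le> D + 1) \<and>
    (\<forall>s\<in>{0..1}. (\<lambda>n. \<Sum>i\<le>d n. a n i * s ^ i) \<longlonglongrightarrow> (if c \<le> s then \<phi> s else 0))"
  proof (rule polynomial_sequence_bounded_limit)
    show "continuous_on {0..1} (g n)" for n
      unfolding g_def by (intro continuous_intros cont)
    show "\<bar>g n s\<bar> \<le> D" if s: "s \<in> {0..1}" for n s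
    proof -
      have "\<bar>max 0 (1 - real n * max 0 (c - s))\<bar> \<le> 1" by simp
      then have "\<bar>\<phi> s\<bar> * \<bar>max 0 (1 - real n * max 0 (c - s))\<bar> \<le> D * 1"
        using D[OF s] by (intro mult_mono) auto
      then show ?thesis by (simp add: g_def abs_mult)
    qed
    show "(\<lambda>n. g n s) \<longlonglongrightarrow> (if c \<le> s then \<phi> s else 0)" for s
    proof (cases "c \<le> s")
      case False
      obtain N :: nat where N: "1 / (c - s) < real N" using reals_Archimedean2 by blast
      have "\<forall>\<^sub>F n in sequentially. g n s = 0"
        using eventually_ge_at_top[of N]
      proof eventually_elim
        case (elim n)
        then have "1 / (c - s) < real n" using N by linarith
        then have "1 < real n * (c - s)" using False by (simp add: field_simps)
        then show ?case using False by (simp add: g_def)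
      qed
      then show ?thesis using False by (simp add: tendsto_eventually)
    qed (simp add: g_def)
  qed
  then show ?thesis by blast
qed

text \<open>\<open>spec_meas\<close> prescribes moments and says nothing about the support. By
  Markov's inequality the set where the modulus is at least c > 1 has measure at most D / c^(2n) for
  every n, hence 0.\<close>

lemma AE_abs_le_1_of_power_moments:
  fixes f :: "'b \<Rightarrow> real"
  assumes int: "\<And>n::nat. integrable M (\<lambda>s. (f s) ^ (2 * n))"
    and bound: "\<And>n::nat. (LINT s|M. (f s) ^ (2 * n)) \<le> D"
    and [measurable]: "f \<in> borel_measurable M"
    and fin: "finite_measure M"
  shows "AE s in M. \<bar>f s\<bar> \<le> 1"
proof -
  interpret finite_measure M by fact
  have null: "measure M {s\<in>space M. 1 + 1 / real (Suc m) \<le> \<bar>f s\<bar>} = 0" for m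
  proof -
    define c where "c = 1 + 1 / real (Suc m)"
    define A where "A = {s\<in>space M. c \<le> \<bar>f s\<bar>}"
    have c: "1 < c" by (simp add: c_def)
    have [measurable]: "A \<in> sets M" unfolding A_def by measurable
    have "measure M A \<le> D / (c\<^sup>2) ^ n" for n :: nat
    proof -
      have "measure M {s\<in>space M. (c\<^sup>2) ^ n \<le> (f s) ^ (2 * n)} \<le> (LINT s|M. (f s) ^ (2 * n)) / (c\<^sup>2) ^ n"
        by (rule integral_Markov_inequality_measure[where A="{}"]) (use int c in \<open>auto simp: power_mult\<close>)
      also have "\<dots> \<le> D / (c\<^sup>2) ^ n"
        using bound c by (intro divide_right_mono) auto
      finally have "measure M {s\<in>space M. (c\<^sup>2) ^ n \<le> (f s) ^ (2 * n)} \<le> D / (c\<^sup>2) ^ n" .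
      moreover have "measure M A \<le> measure M {s\<in>space M. (c\<^sup>2) ^ n \<le> (f s) ^ (2 * n)}"
      proof (rule finite_measure_mono)
        show "A \<subseteq> {s\<in>space M. (c\<^sup>2) ^ n \<le> (f s) ^ (2 * n)}"
        proof
          fix s assume s: "s \<in> A"
          then have "c\<^sup>2 \<le> (f s)\<^sup>2" using c by (simp add: A_def abs_le_square_iff[symmetric])
          then show "s \<in> {s\<in>space M. (c\<^sup>2) ^ n \<le> (f s) ^ (2 * n)}"
            using s by (simp add: A_def power_mult power_mono)
        qed
      qed measurable
      ultimately show ?thesis by linarith
    qed
    moreover have "(\<lambda>n. D / (c\<^sup>2) ^ n) \<longlonglongrightarrow> 0"
      using c by (intro LIMSEQ_divide_realpow_zero) (simp add: one_less_power)
    ultimately have "measure M A \<le> 0"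
      by (intro LIMSEQ_le_const) auto
    then show ?thesis
      using measure_nonneg[of M A] unfolding A_def c_def by linarith
  qed
  have "AE s in M. \<forall>m. \<not> 1 + 1 / real (Suc m) \<le> \<bar>f s\<bar>"
    unfolding AE_all_countable
  proof
    fix m
    show "AE s in M. \<not> 1 + 1 / real (Suc m) \<le> \<bar>f s\<bar>"
      by (rule AE_I[of _ _ "{s\<in>space M. 1 + 1 / real (Suc m) \<le> \<bar>f s\<bar>}"])
        (use null[of m] in \<open>auto simp: emeasure_eq_measure\<close>)
  qed
  then show ?thesis
  proof eventually_elim
    case (elim s)
    show ?case
    proof (rule ccontr)
      assume "\<not> \<bar>f s\<bar> \<le> 1"
      then obtain m where "1 / real (Suc m) < \<bar>f s\<bar> - 1"
        using reals_Archimedean[of "\<bar>f s\<bar> - 1"] by (auto simp: inverse_eq_divide)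
      then show False using elim by (metis add.commute less_diff_eq less_imp_le)
    qed
  qed
qed

text \<open>The shift j multiplies the limit function by a power: the truncated inverse square is
  used with j = 0 for the kernel itself, and with j = 2, where it becomes the indicator of a
  ray.\<close>

lemma integral_polynomial_sequence_tendsto:
  fixes f :: "'b \<Rightarrow> real" and G :: "real \<Rightarrow> real" and a :: "nat \<Rightarrow> nat \<Rightarrow> real"
  assumes fin: "finite_measure M" and [measurable]: "f \<in> borel_measurable M"
    and AE: "AE s in M. 0 \<le> f s \<and> f s \<le> 1"
    and bound: "\<And>n s. s \<in> {0..1} \<Longrightarrow> \<bar>\<Sum>i\<le>d n. a n i * s ^ i\<bar> \<le> D"
    and lim: "\<And>s. s \<in> {0..1} \<Longrightarrow> (\<lambda>n. \<Sum>i\<le>d n. a n i * s ^ i) \<longlonglongrightarrow> G s"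
    and [measurable]: "G \<in> borel_measurable borel"
  shows "(\<lambda>n. \<Sum>i\<le>d n. a n i * (LINT s|M. f s ^ (i + j))) \<longlonglongrightarrow> (LINT s|M. G (f s) * f s ^ j)"
    and "integrable M (\<lambda>s. G (f s) * f s ^ j)"
proof -
  interpret finite_measure M by fact
  have int: "integrable M (\<lambda>s. f s ^ k)" for k
  proof (rule integrable_const_bound[where B=1])
    show "AE s in M. norm (f s ^ k) \<le> 1"
      using AE by eventually_elim (simp add: power_le_one)
  qed measurable
  have eq: "(\<Sum>i\<le>d n. a n i * (LINT s|M. f s ^ (i + j))) = (LINT s|M. (\<Sum>i\<le>d n. a n i * f s ^ i) * f s ^ j)" for n
    by (simp add: sum_distrib_right power_add[symmetric] mult.assoc int)
  have bnd: "AE s in M. norm ((\<Sum>i\<le>d n. a n i * f s ^ i) * f s ^ j) \<le> D" for n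
    using AE
  proof eventually_elim
    case (elim s)
    then have b: "\<bar>\<Sum>i\<le>d n. a n i * f s ^ i\<bar> \<le> D" by (intro bound) auto
    then have "0 \<le> D" by linarith
    then have "\<bar>\<Sum>i\<le>d n. a n i * f s ^ i\<bar> * \<bar>f s ^ j\<bar> \<le> D * 1"
      using elim b by (intro mult_mono) (auto simp: power_le_one abs_if)
    then show ?case by (simp add: abs_mult)
  qed
  have lm: "AE s in M. (\<lambda>n. (\<Sum>i\<le>d n. a n i * f s ^ i) * f s ^ j) \<longlonglongrightarrow> G (f s) * f s ^ j"
    using AE by eventually_elim (auto intro!: tendsto_intros lim)
  show "(\<lambda>n. \<Sum>i\<le>d n. a n i * (LINT s|M. f s ^ (i + j))) \<longlonglongrightarrow> (LINT s|M. G (f s) * f s ^ j)"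
    unfolding eq by (rule integral_dominated_convergence[where w="\<lambda>_. D"]) (use bnd lm in auto)
  show "integrable M (\<lambda>s. G (f s) * f s ^ j)"
    by (rule integrable_dominated_convergence[where w="\<lambda>_. D" and s="\<lambda>n s. (\<Sum>i\<le>d n. a n i * f s ^ i) * f s ^ j"])
      (use bnd lm in auto)
qed

text \<open>The order of the quantifiers is the point: the coefficients depend on c alone. The mass
  of a ray is thus one fixed limit of linear combinations of moments, which passes measurability in
  a parameter from the moments to the measure.\<close>

lemma threshold_measure_limit:
  "\<exists>a d. \<forall>(M :: 'b measure) (f :: 'b \<Rightarrow> real). finite_measure M \<longrightarrow> f \<in> borel_measurable M \<longrightarrow>
     (AE s in M. 0 \<le> f s \<and> f s \<le> 1) \<longrightarrow>
     (\<lambda>n. \<Sum>i\<le>d n. a n i * (LINT s|M. f s ^ i)) \<longlonglongrightarrow> measure M {s\<in>space M. c \<le> f s}"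
proof -
  obtain a d D where ad: "\<And>n s. s \<in> {0..1} \<Longrightarrow> \<bar>\<Sum>i\<le>d n. a n i * s ^ i\<bar> \<le> D"
    "\<And>s. s \<in> {0..1} \<Longrightarrow> (\<lambda>n. \<Sum>i\<le>d n. a n i * s ^ i) \<longlonglongrightarrow> (if c \<le> s then 1 else 0 :: real)"
    using polynomial_sequence_threshold[of "\<lambda>_. 1" c] by (auto simp: Ball_def)
  have "(\<lambda>n. \<Sum>i\<le>d n. a n i * (LINT s|M. f s ^ i)) \<longlonglongrightarrow> measure M {s\<in>space M. c \<le> f s}"
    if M: "finite_measure M" and [measurable]: "f \<in> borel_measurable M"
      and "AE s in M. 0 \<le> f s \<and> f s \<le> 1" for M :: "'b measure" and f
  proof -
    interpret finite_measure M by fact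
    have "(\<lambda>n. \<Sum>i\<le>d n. a n i * (LINT s|M. f s ^ (i + 0))) \<longlonglongrightarrow>
        (LINT s|M. (if c \<le> f s then 1 else 0) * f s ^ 0)"
      using that ad by (intro integral_polynomial_sequence_tendsto(1)[where D=D]) auto
    also have "(LINT s|M. (if c \<le> f s then 1 else 0) * f s ^ 0) = (LINT s|M. indicator {s\<in>space M. c \<le> f s} s)"
      by (intro Bochner_Integration.integral_cong) (auto simp: indicator_def)
    also have "\<dots> = measure M {s\<in>space M. c \<le> f s}"
      by simp
    finally show ?thesis by simp
  qed
  then show ?thesis by blast
qed

section \<open>Rays as a generator of the Borel sets, and a discriminant inequality\<close>

lemma Int_stable_atLeast: "Int_stable (range (\<lambda>x::real. {x..}))"
proof (rule Int_stableI_image)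
  fix a b :: real
  have "{a..} \<inter> {b..} = {max a b..}" by auto
  then show "\<exists>c\<in>UNIV. {a..} \<inter> {b..} = {c..}" by blast
qed

lemma sets_borel_atLeast: "sets (borel :: real measure) = sigma_sets UNIV (range (\<lambda>x::real. {x..}))"
  unfolding borel_Ici by (rule sets_measure_of) auto

lemma finite_measure_eqI_atLeast:
  fixes M N :: "real measure"
  assumes "sets M = sets borel" "sets N = sets borel" "finite_measure M"
    and "\<And>c. emeasure M {c..} = emeasure N {c..}"
  shows "M = N"
proof (rule measure_eqI_generator_eq[OF Int_stable_atLeast, where A="\<lambda>i. {- real i..}"])
  interpret finite_measure M by fact
  show "emeasure M {- real i..} \<noteq> \<infinity>" for i by simp
  show "(\<Union>i. {- real i..}) = UNIV"
  proof (intro UNIV_eq_I[symmetric])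
    fix x :: real
    obtain n :: nat where "- x < real n" using reals_Archimedean2 by blast
    then show "x \<in> (\<Union>i. {- real i..})" by (intro UN_I[of n]) auto
  qed
qed (use assms sets_borel_atLeast in auto)

lemma discriminant_bound:
  fixes a b c :: real
  assumes "\<And>t. 0 \<le> a + 2 * t * b + t\<^sup>2 * c"
  shows "b\<^sup>2 \<le> a * c"
proof (cases "c = 0")
  case True
  have "b = 0"
  proof (rule ccontr)
    assume "b \<noteq> 0"
    then have "a + 2 * (- (a + 1) / (2 * b)) * b + (- (a + 1) / (2 * b))\<^sup>2 * c = -1"
      using True by (simp add: field_simps)
    then show False using assms[of "- (a + 1) / (2 * b)"] by linarith
  qed
  then show ?thesis using True by simp
next
  case False
  have "0 \<le> c"
  proof (rule ccontr)
    assume c: "\<not> 0 \<le> c"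
    define d where "d = \<bar>c\<bar>"
    \<comment> \<open>Large enough that t * \<open>\<bar>c\<bar>\<close> exceeds
      \<open>\<bar>a\<bar> + 2 * \<bar>b\<bar>\<close>, so that a negative leading coefficient would
      make the quadratic negative at t.\<close>
    define t where "t = 1 + (\<bar>a\<bar> + 2 * \<bar>b\<bar>) / d"
    have d: "0 < d" using False by (simp add: d_def)
    have "0 \<le> (\<bar>a\<bar> + 2 * \<bar>b\<bar>) / d" using d by (intro divide_nonneg_nonneg) auto
    then have t: "1 \<le> t" unfolding t_def by linarith
    have "t * d = d + (\<bar>a\<bar> + 2 * \<bar>b\<bar>)" using d by (simp add: t_def field_simps)
    then have "\<bar>a\<bar> + 2 * \<bar>b\<bar> < t * \<bar>c\<bar>" using d unfolding d_def by linarith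
    then have "t * (\<bar>a\<bar> + 2 * \<bar>b\<bar>) < t * (t * \<bar>c\<bar>)" using t by (intro mult_strict_left_mono) auto
    moreover have "a \<le> t * \<bar>a\<bar>" using t by (smt (verit) mult_le_cancel_right1)
    moreover have "2 * t * b \<le> t * (2 * \<bar>b\<bar>)" using t by (simp add: mult_left_mono)
    ultimately have "a + 2 * t * b + t\<^sup>2 * c < 0"
      using c by (simp add: power2_eq_square algebra_simps)
    then show False using assms[of t] by simp
  qed
  then have c: "0 < c" using False by simp
  have "0 \<le> a - b\<^sup>2 / c"
    using assms[of "- b / c"] False by (simp add: power2_eq_square field_simps)
  then show ?thesis using c by (simp add: field_simps)
qed

section \<open>Positive contractions\<close>

text \<open>The operator inequality 0 \<le> T \<le> 1 for a symmetric T, on a real vector space with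
  a semidefinite form. All later statements concern numbers such as
  \<open>ip ((T ^^ n) f) f\<close>, so the setting fits functions that are not identified almost
  everywhere.\<close>

locale contraction_form =
  fixes ip :: "'v::real_vector \<Rightarrow> 'v \<Rightarrow> real" and T :: "'v \<Rightarrow> 'v"
  assumes ip_add: "ip (f + g) h = ip f h + ip g h"
    and ip_scale: "ip (c *\<^sub>R f) h = c * ip f h"
    and ip_sym: "ip f g = ip g f"
    and ip_pos: "0 \<le> ip f f"
    and T_linear: "linear T"
    and T_sym: "ip (T f) g = ip f (T g)"
    and T_pos: "0 \<le> ip (T f) f"
    and T_le: "ip (T f) f \<le> ip f f"
begin

lemma ip_add2: "ip h (f + g) = ip h f + ip h g"
  by (simp only: ip_sym[of h] ip_add)

lemma ip_scale2: "ip h (c *\<^sub>R f) = c * ip h f"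
  by (simp only: ip_sym[of h] ip_scale)

lemma ip_minus: "ip (- f) h = - ip f h"
  using ip_scale[of "-1" f h] by simp

lemma ip_diff: "ip (f - g) h = ip f h - ip g h"
  using ip_add[of f "- g" h] by (simp add: ip_minus)

lemma ip_diff2: "ip h (f - g) = ip h f - ip h g"
  by (simp only: ip_sym[of h] ip_diff)

lemma ip_zero: "ip 0 h = 0"
  using ip_scale[of 0 0 h] by simp

lemma ip_sum: "ip (sum f I) h = (\<Sum>i\<in>I. ip (f i) h)"
  by (induction I rule: infinite_finite_induct) (simp_all add: ip_zero ip_add)

lemma ip_sum2: "ip h (sum f I) = (\<Sum>i\<in>I. ip h (f i))"
  by (simp only: ip_sym[of h] ip_sum)

definition R :: "'v \<Rightarrow> 'v" where "R f = f - T f"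

lemma T_add: "T (f + g) = T f + T g"
  and T_scale: "T (c *\<^sub>R f) = c *\<^sub>R T f"
  and T_diff: "T (f - g) = T f - T g"
  by (rule linear_add[OF T_linear] linear_scale[OF T_linear] linear_diff[OF T_linear])+

lemma T_sum: "T (sum f I) = (\<Sum>i\<in>I. T (f i))"
  using linear_sum[OF T_linear, of f I] by (simp add: o_def)

lemma TR: "T (R f) = R (T f)"
  by (simp add: R_def T_diff)

lemma R_sym: "ip (R f) g = ip f (R g)"
  by (simp add: R_def ip_diff ip_diff2 T_sym)

lemma R_pos: "0 \<le> ip (R f) f"
  using T_le[of f] by (simp add: R_def ip_diff)

lemma Tn_sym: "ip ((T ^^ n) f) g = ip f ((T ^^ n) g)"
  by (induction n arbitrary: f g) (simp_all add: T_sym funpow_swap1)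

lemma Rn_sym: "ip ((R ^^ n) f) g = ip f ((R ^^ n) g)"
  by (induction n arbitrary: f g) (simp_all add: R_sym funpow_swap1)

lemma ip_Rn_Rn: "ip ((R ^^ n) f) ((R ^^ i) f) = ip ((R ^^ (n + i)) f) f"
  by (simp add: Rn_sym[symmetric] funpow_add add.commute[of n i])

lemma T_Rn: "T ((R ^^ n) f) = (R ^^ n) (T f)"
  by (induction n) (simp_all add: TR)

lemma R_Tn: "R ((T ^^ n) f) = (T ^^ n) (R f)"
  by (induction n) (simp_all add: TR[symmetric])

lemma Tn_add: "(T ^^ n) (f + g) = (T ^^ n) f + (T ^^ n) g"
  by (induction n) (simp_all add: T_add)

lemma Tn_scale: "(T ^^ n) (c *\<^sub>R f) = c *\<^sub>R (T ^^ n) f"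
  by (induction n) (simp_all add: T_scale)

text \<open>The future integral of s^k (1 - s)^j against the spectral measure of f, available before
  that measure exists and the input for its construction.\<close>

definition mom :: "'v \<Rightarrow> nat \<Rightarrow> nat \<Rightarrow> real" where
  "mom f k j = ip ((T ^^ k) ((R ^^ j) f)) f"

lemma mom_rec: "mom f k j = mom f (Suc k) j + mom f k (Suc j)"
proof -
  have "(R ^^ j) f = T ((R ^^ j) f) + (R ^^ Suc j) f"
    by (simp add: R_def[of "(R ^^ j) f"])
  then have "(T ^^ k) ((R ^^ j) f) = (T ^^ k) (T ((R ^^ j) f)) + (T ^^ k) ((R ^^ Suc j) f)"
    by (metis Tn_add)
  then show ?thesis
    unfolding mom_def by (metis ip_add funpow_Suc_right comp_apply)
qed

lemma mom_SucSuc_T: "mom f (Suc (Suc k)) j = mom (T f) k j"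
proof -
  have "(T ^^ Suc (Suc k)) ((R ^^ j) f) = T ((T ^^ k) ((R ^^ j) (T f)))"
    by (simp add: funpow_swap1 T_Rn)
  then show ?thesis
    unfolding mom_def by (simp only: T_sym)
qed

lemma mom_SucSuc_R: "mom f k (Suc (Suc j)) = mom (R f) k j"
proof -
  have "(T ^^ k) ((R ^^ Suc (Suc j)) f) = R ((T ^^ k) ((R ^^ j) (R f)))"
    by (simp add: R_Tn funpow_swap1)
  then show ?thesis
    unfolding mom_def by (simp only: R_sym)
qed

text \<open>T and R commute and are symmetric, so a pair of factors T, or a pair of factors R, can
  be shared out between the two arguments of the form. This reduces both exponents to 0 or
  1.\<close>

lemma mom_nonneg: "0 \<le> mom f k j"
proof -
  have "\<forall>f. 0 \<le> mom f k j" if "k + j = n" for n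
    using that
  proof (induction n arbitrary: k j rule: less_induct)
    case (less n)
    consider k' where "k = Suc (Suc k')" | j' where "j = Suc (Suc j')" | "k \<le> 1" "j \<le> 1"
      by (metis One_nat_def not0_implies_Suc not_less_eq_eq le0)
    then show ?case
    proof cases
      case 1
      then have "\<forall>f. 0 \<le> mom f k' j" using less by (intro less.IH[of "k' + j"]) auto
      then show ?thesis using 1 by (simp add: mom_SucSuc_T)
    next
      case 2
      then have "\<forall>f. 0 \<le> mom f k j'" using less by (intro less.IH[of "k + j'"]) auto
      then show ?thesis using 2 by (simp add: mom_SucSuc_R)
    next
      case 3
      then consider "k = 0" "j = 0" | "k = 1" "j = 0" | "k = 0" "j = 1" | "k = 1" "j = 1"
        by linarith
      then show ?thesis
      proof cases
        case 4
        \<comment> \<open>Since T + R = 1, the mixed case follows from T R = T R (T + R) = T R T + R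
          T R, a sum of two positive operators.\<close>
        have "mom f 1 1 = mom (R f) 1 0 + mom (T f) 0 1" for f
          using mom_rec[of f 1 1] by (simp add: mom_SucSuc_R mom_SucSuc_T)
        then show ?thesis using 4 by (simp add: mom_def T_pos R_pos)
      qed (simp_all add: mom_def ip_pos T_pos R_pos)
    qed
  qed
  then show ?thesis by blast
qed

lemma mom_decreasing: "mom f k (Suc j) \<le> mom f k j" "mom f (Suc k) j \<le> mom f k j"
  using mom_rec[of f k j] mom_nonneg[of f "Suc k" j] mom_nonneg[of f k "Suc j"] by linarith+

lemma mom_antimono: "i \<le> j \<Longrightarrow> mom f k j \<le> mom f k i"
  by (rule lift_Suc_antimono_le[of "mom f k", OF mom_decreasing(1)])

lemma mom_le: "mom f k j \<le> ip f f"
proof -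
  have "mom f k j \<le> mom f k 0"
    by (rule mom_antimono) simp
  also have "mom f k 0 \<le> mom f 0 0"
    by (rule lift_Suc_antimono_le[of "\<lambda>k. mom f k 0", OF mom_decreasing(2)]) simp
  finally show ?thesis by (simp add: mom_def)
qed

lemma spectral_measure:
  obtains \<mu> where "finite_measure \<mu>" "sets \<mu> = sets borel" "AE s in \<mu>. 0 \<le> s \<and> s \<le> 1"
    "\<And>k. (LINT s|\<mu>. s ^ k) = ip ((T ^^ k) f) f" "\<And>k. integrable \<mu> (\<lambda>s. s ^ k)"
proof -
  obtain \<mu> where fin: "finite_measure \<mu>" and [measurable_cong]: "sets \<mu> = sets borel" and
    AE: "AE s in \<mu>. 0 \<le> s \<and> s \<le> 1" and m: "\<And>k. (LINT s|\<mu>. s ^ k) = ip ((T ^^ k) f) f"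
    using hausdorff_moment[of "mom f", OF mom_nonneg mom_rec] unfolding mom_def funpow_0 by blast
  interpret finite_measure \<mu> by fact
  have "integrable \<mu> (\<lambda>s. s ^ k)" for k
  proof (rule integrable_const_bound[where B=1])
    show "AE s in \<mu>. norm (s ^ k) \<le> 1"
      using AE by eventually_elim (simp add: power_le_one)
  qed measurable
  then show thesis using that fin AE m \<open>sets \<mu> = sets borel\<close> by blast
qed

lemma mixed_moment:
  fixes h :: "'b \<Rightarrow> real"
  assumes int0: "\<And>k. integrable \<mu> (\<lambda>s. h s ^ k)"
    and m0: "\<And>k. (LINT s|\<mu>. h s ^ k) = ip ((T ^^ k) f) f"
  shows "integrable \<mu> (\<lambda>s. h s ^ k * (1 - h s) ^ j) \<and> (LINT s|\<mu>. h s ^ k * (1 - h s) ^ j) = mom f k j"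
proof (induction j arbitrary: k)
  case 0
  then show ?case using assms by (simp add: mom_def)
next
  case (Suc j)
  have eq: "(\<lambda>s. h s ^ k * (1 - h s) ^ Suc j) = (\<lambda>s. h s ^ k * (1 - h s) ^ j - h s ^ Suc k * (1 - h s) ^ j)"
    by (auto simp: algebra_simps)
  have "mom f k (Suc j) = mom f k j - mom f (Suc k) j"
    using mom_rec[of f k j] by linarith
  then show ?case
    unfolding eq using Suc.IH[of k] Suc.IH[of "Suc k"]
    by (simp only: Bochner_Integration.integral_diff Bochner_Integration.integrable_diff simp_thms)
qed

lemma form_Cauchy_Schwarz:
  fixes b :: "'v \<Rightarrow> 'v \<Rightarrow> real"
  assumes "\<And>f g h. b (f + g) h = b f h + b g h" "\<And>c f h. b (c *\<^sub>R f) h = c * b f h"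
    and sym: "\<And>f g. b f g = b g f" and "\<And>f. 0 \<le> b f f"
  shows "(b f g)\<^sup>2 \<le> b f f * b g g"
proof (rule discriminant_bound)
  fix t :: real
  have "0 \<le> b (f + t *\<^sub>R g) (f + t *\<^sub>R g)" by fact
  also have "\<dots> = b f f + 2 * t * b f g + t\<^sup>2 * b g g"
    using assms(1,2) sym[of f "f + t *\<^sub>R g"] sym[of g "f + t *\<^sub>R g"] sym[of f g]
    by (simp add: power2_eq_square algebra_simps)
  finally show "0 \<le> b f f + 2 * t * b f g + t\<^sup>2 * b g g" .
qed

lemma Cauchy_Schwarz: "(ip f g)\<^sup>2 \<le> ip f f * ip g g"
  by (rule form_Cauchy_Schwarz[of ip, OF ip_add ip_scale ip_sym ip_pos])

definition pform :: "(nat \<Rightarrow> real) \<Rightarrow> nat \<Rightarrow> 'v \<Rightarrow> 'v \<Rightarrow> real" where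
  "pform a d f g = (\<Sum>i\<le>d. a i * ip ((T ^^ i) f) g)"

lemma pform_add: "pform a d (f + g) h = pform a d f h + pform a d g h"
  by (simp add: pform_def Tn_add ip_add algebra_simps sum.distrib)

lemma pform_scale: "pform a d (c *\<^sub>R f) h = c * pform a d f h"
  by (simp add: pform_def Tn_scale ip_scale sum_distrib_left ac_simps)

lemma pform_sym: "pform a d f g = pform a d g f"
proof -
  have "ip ((T ^^ i) f) g = ip ((T ^^ i) g) f" for i
    by (rule trans[OF Tn_sym ip_sym])
  then show ?thesis by (simp add: pform_def)
qed

lemma pform_diff: "pform a d (f - g) h = pform a d f h - pform a d g h"
  using pform_add[of a d f "-1 *\<^sub>R g" h] pform_scale[of a d "-1" g h] by simp

lemma pform_diag_bound:
  assumes "\<And>s. s \<in> {0..1} \<Longrightarrow> \<bar>\<Sum>i\<le>d. a i * s ^ i\<bar> \<le> D"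
  shows "\<bar>pform a d f f\<bar> \<le> D * ip f f"
proof -
  obtain \<mu> where fin: "finite_measure \<mu>" and [measurable_cong]: "sets \<mu> = sets borel" and
    AE: "AE s in \<mu>. 0 \<le> s \<and> s \<le> 1" and m: "\<And>k. (LINT s|\<mu>. s ^ k) = ip ((T ^^ k) f) f"
    and int: "\<And>k. integrable \<mu> (\<lambda>s. s ^ k)"
    using spectral_measure[of f] by blast
  interpret finite_measure \<mu> by fact
  have "pform a d f f = (LINT s|\<mu>. (\<Sum>i\<le>d. a i * s ^ i))"
    by (simp add: pform_def m[symmetric] int)
  also have "\<bar>\<dots>\<bar> \<le> (LINT s|\<mu>. \<bar>\<Sum>i\<le>d. a i * s ^ i\<bar>)"
    by (rule integral_abs_bound)
  also have "\<dots> \<le> (LINT s|\<mu>. D)"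
  proof (rule integral_mono_AE)
    show "AE s in \<mu>. \<bar>\<Sum>i\<le>d. a i * s ^ i\<bar> \<le> D"
      using AE by eventually_elim (simp add: assms)
  qed (auto simp: int)
  also have "\<dots> = D * ip f f"
    using m[of 0] by simp
  finally show ?thesis .
qed

text \<open>The form of a polynomial in T need not be positive, so the diagonal bound is passed on
  by polarisation: applied to f and -t g it yields a quadratic in t that is nonnegative for all t,
  and the discriminant gives the product of the norms.\<close>

lemma pform_bound:
  assumes D: "\<And>s. s \<in> {0..1} \<Longrightarrow> \<bar>\<Sum>i\<le>d. a i * s ^ i\<bar> \<le> D"
  shows "\<bar>pform a d f g\<bar> \<le> D * sqrt (ip f f) * sqrt (ip g g)"
proof -
  have D0: "0 \<le> D" by (rule order_trans[OF abs_ge_zero D[of 0]]) simp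
  have "(pform a d f g)\<^sup>2 \<le> (D * ip f f) * (D * ip g g)"
  proof (rule discriminant_bound)
    fix t :: real
    define g' where "g' = (- t) *\<^sub>R g"
    have expand: "b (f + g') (f + g') - b (f - g') (f - g') = 4 * b f g'"
      if "\<And>f g h. b (f + g) h = b f h + b g h" "\<And>f g h. b (f - g) h = b f h - b g h" "\<And>f g. b f g = b g f"
      for b :: "'v \<Rightarrow> 'v \<Rightarrow> real"
    proof -
      have "b h (f + g') = b h f + b h g'" "b h (f - g') = b h f - b h g'" for h
        by (simp_all only: that(3)[of h "f + g'"] that(3)[of h "f - g'"] that(3)[of h f] that(3)[of h g'] that(1,2))
      then show ?thesis by (simp only: that(1,2)) (simp add: that(3)[of g' f])
    qed
    have "4 * pform a d f g' = pform a d (f + g') (f + g') - pform a d (f - g') (f - g')"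
      by (rule expand[of "pform a d", OF pform_add pform_diff pform_sym, symmetric])
    also have "\<dots> \<le> D * ip (f + g') (f + g') + D * ip (f - g') (f - g')"
      using pform_diag_bound[OF D, of "f + g'"] pform_diag_bound[OF D, of "f - g'"] by linarith
    also have "\<dots> = 2 * D * ip f f + 2 * D * ip g' g'"
      by (simp only: ip_add ip_add2 ip_diff ip_diff2) (simp add: algebra_simps)
    finally have "4 * pform a d f g' \<le> \<dots>" .
    moreover have "pform a d f g' = - t * pform a d f g"
      unfolding g'_def using pform_sym[of a d f "(- t) *\<^sub>R g"] pform_scale[of a d "- t" g f] pform_sym[of a d g f]
      by simp
    moreover have "ip g' g' = t\<^sup>2 * ip g g"
      unfolding g'_def by (simp only: ip_scale ip_scale2) (simp add: power2_eq_square)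
    ultimately show "0 \<le> D * ip f f + 2 * t * pform a d f g + t\<^sup>2 * (D * ip g g)"
      by (simp add: algebra_simps)
  qed
  also have "\<dots> = (D * sqrt (ip f f) * sqrt (ip g g))\<^sup>2"
    by (simp add: power_mult_distrib ip_pos power2_eq_square[of D])
  finally have "\<bar>pform a d f g\<bar> \<le> \<bar>D * sqrt (ip f f) * sqrt (ip g g)\<bar>"
    by (simp only: abs_le_square_iff)
  also have "\<dots> = D * sqrt (ip f f) * sqrt (ip g g)"
    by (intro abs_of_nonneg mult_nonneg_nonneg D0 real_sqrt_ge_zero ip_pos)
  finally show ?thesis .
qed

text \<open>Partial sums of the Neumann series of the inverse of T = 1 - R.\<close>

definition S :: "nat \<Rightarrow> 'v \<Rightarrow> 'v" where "S n f = (\<Sum>i<n. (R ^^ i) f)"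

lemma T_S: "T (S n f) = f - (R ^^ n) f"
proof (induction n)
  case (Suc n)
  have "T ((R ^^ n) f) = (R ^^ n) f - (R ^^ Suc n) f" by (simp add: R_def[of "(R ^^ n) f"])
  then show ?case using Suc by (simp add: S_def T_add)
qed (simp add: S_def linear_0[OF T_linear])

lemma ip_S: "ip (S n f) f = (\<Sum>i<n. mom f 0 i)"
  by (simp add: S_def ip_sum mom_def)

lemma Rn_add: "(R ^^ n) (f + g) = (R ^^ n) f + (R ^^ n) g"
  by (induction n) (simp_all add: R_def T_add)

lemma Rn_scale: "(R ^^ n) (c *\<^sub>R f) = c *\<^sub>R (R ^^ n) f"
  by (induction n) (simp_all add: R_def T_scale scaleR_diff_right)

lemma S_Cauchy_Schwarz: "(ip (S n f) g)\<^sup>2 \<le> ip (S n f) f * ip (S n g) g"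
proof (rule form_Cauchy_Schwarz[of "\<lambda>f g. ip (S n f) g"])
  show "ip (S n f) g = ip (S n g) f" for f g
  proof -
    have "ip ((R ^^ i) f) g = ip ((R ^^ i) g) f" for i
      by (rule trans[OF Rn_sym ip_sym])
    then show ?thesis by (simp add: S_def ip_sum)
  qed
  show "ip (S n (f + g)) h = ip (S n f) h + ip (S n g) h" for f g h
    by (simp add: S_def ip_sum Rn_add ip_add sum.distrib)
  show "ip (S n (c *\<^sub>R f)) h = c * ip (S n f) h" for c f h
    by (simp add: S_def ip_sum Rn_scale ip_scale sum_distrib_left)
  show "0 \<le> ip (S n f) f" for f
    by (simp add: ip_S sum_nonneg mom_nonneg)
qed

text \<open>Together the next two facts give \<open>\<Sum>n. mom f 0 n\<close> as the supremum of
  \<open>(ip f u)\<^sup>2 / ip (T u) u\<close>: formally both are \<open>ip (T\<^sup>-\<^sup>1 f) f\<close>.\<close>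

lemma sum_mom_le:
  assumes m: "0 \<le> m" "\<And>v. m * (ip v f)\<^sup>2 \<le> ip (T v) v"
  shows "m * (\<Sum>i<n. mom f 0 i) \<le> 1"
proof -
  define A where "A = (\<Sum>i<n. mom f 0 i)"
  have A0: "0 \<le> A" unfolding A_def by (intro sum_nonneg mom_nonneg)
  \<comment> \<open>The hypothesis is tested on v = \<open>S n f\<close>, for which
    \<open>ip v f\<close> is the sum A itself and the form \<open>ip (T v) v\<close> is at most A.
    Thus m A^2 \<le> A.\<close>
  have "m * A\<^sup>2 \<le> ip (T (S n f)) (S n f)"
    using m(2)[of "S n f"] unfolding ip_S A_def .
  also have "\<dots> = A - ip ((R ^^ n) f) (S n f)"
  proof -
    have "ip f (S n f) = A" by (subst ip_sym) (simp add: ip_S A_def)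
    then show ?thesis by (simp only: T_S ip_diff)
  qed
  also have "\<dots> \<le> A"
  proof -
    have "0 \<le> ip ((R ^^ n) f) ((R ^^ i) f)" for i
      using mom_nonneg[of f 0 "n + i"] by (simp add: ip_Rn_Rn mom_def)
    then have "0 \<le> ip ((R ^^ n) f) (S n f)"
      unfolding S_def ip_sum2 by (intro sum_nonneg)
    then show ?thesis by simp
  qed
  finally have "m * A * A \<le> 1 * A" by (simp add: power2_eq_square ac_simps)
  then have "m * A \<le> 1"
    using A0 mult_right_le_imp_le[of "m * A" A 1] by (cases "A = 0") auto
  then show ?thesis by (simp add: A_def)
qed

lemma ip_sq_le_sum_mom:
  assumes lim: "(\<lambda>n. mom f 0 n) \<longlonglongrightarrow> 0" and A: "\<And>n. (\<Sum>i<n. mom f 0 i) \<le> A"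
  shows "(ip f u)\<^sup>2 \<le> A * ip (T u) u"
proof -
  have A0: "0 \<le> A" using A[of 0] by simp
  have "(ip f u - ip ((R ^^ n) f) u)\<^sup>2 \<le> A * ip (T u) u" for n
  proof -
    \<comment> \<open>As T times \<open>S n\<close> is 1 - R^n, the left side is a value of the
      positive form of \<open>S n\<close> at f and \<open>T u\<close>. Cauchy-Schwarz for that form
      leaves a sum of moments of f and at most \<open>ip (T u) u\<close>; the term with R^n
      disappears in the limit.\<close>
    have "ip f u - ip ((R ^^ n) f) u = ip (S n f) (T u)"
      by (simp add: T_sym[symmetric] T_S ip_diff)
    moreover have "(ip (S n f) (T u))\<^sup>2 \<le> ip (S n f) f * ip (S n (T u)) (T u)"
      by (rule S_Cauchy_Schwarz)
    moreover have "ip (S n (T u)) (T u) = ip (T u) u - mom u 1 n"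
    proof -
      have "S n (T u) = T (S n u)" by (simp add: S_def T_sum T_Rn)
      then have "ip (S n (T u)) (T u) = ip u (T u) - ip ((R ^^ n) u) (T u)"
        by (simp add: T_S ip_diff)
      moreover have "ip ((R ^^ n) u) (T u) = mom u 1 n"
        by (simp add: mom_def T_sym)
      ultimately show ?thesis by (simp add: T_sym)
    qed
    moreover have "ip (S n f) f * (ip (T u) u - mom u 1 n) \<le> A * ip (T u) u"
    proof (rule mult_mono)
      show "ip (S n f) f \<le> A" using A by (simp add: ip_S)
      show "0 \<le> ip (T u) u - mom u 1 n"
        using mom_antimono[of 0 n u 1] by (simp add: mom_def)
    qed (use mom_nonneg A0 in auto)
    ultimately show ?thesis by simp
  qed
  moreover have "(\<lambda>n. (ip f u - ip ((R ^^ n) f) u)\<^sup>2) \<longlonglongrightarrow> (ip f u - 0)\<^sup>2"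
  proof (intro tendsto_intros)
    have "(\<lambda>n. sqrt (mom f 0 (2 * n) * ip u u)) \<longlonglongrightarrow> sqrt (0 * ip u u)"
      using LIMSEQ_subseq_LIMSEQ[OF lim, of "\<lambda>n. 2 * n"]
      by (intro tendsto_intros) (auto simp: strict_mono_def o_def)
    then have l: "(\<lambda>n. sqrt (mom f 0 (2 * n) * ip u u)) \<longlonglongrightarrow> 0" by simp
    show "(\<lambda>n. ip ((R ^^ n) f) u) \<longlonglongrightarrow> 0"
    proof (rule Lim_null_comparison[OF _ l], rule always_eventually, rule allI)
      fix n
      have "ip ((R ^^ n) f) ((R ^^ n) f) = mom f 0 (2 * n)"
        by (simp add: ip_Rn_Rn mom_def mult_2)
      then have "(ip ((R ^^ n) f) u)\<^sup>2 \<le> mom f 0 (2 * n) * ip u u"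
        using Cauchy_Schwarz[of "(R ^^ n) f" u] by simp
      then show "norm (ip ((R ^^ n) f) u) \<le> sqrt (mom f 0 (2 * n) * ip u u)"
        by (simp add: real_le_rsqrt)
    qed
  qed
  ultimately have "(ip f u - 0)\<^sup>2 \<le> A * ip (T u) u"
    by (intro LIMSEQ_le_const2) auto
  then show ?thesis by simp
qed

lemma mom_1_eq: "mom f 1 n = mom f 0 n - mom f 0 (Suc n)"
proof -
  have "mom f 0 n = mom f 1 n + mom f 0 (Suc n)"
    using mom_rec[of f 0 n] unfolding One_nat_def .
  then show ?thesis by linarith
qed

text \<open>Since T R^j = R^j - R^(j+1), the numbers \<open>mom f 1 j\<close> sum telescopically to
  at most \<open>ip f f\<close>. They also decrease, so the last of n + 1 of them is at most the
  average.\<close>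

lemma mom_1_le: "mom f 1 n \<le> ip f f / real (Suc n)"
proof -
  have "real (Suc n) * mom f 1 n = (\<Sum>j\<le>n. mom f 1 n)" by simp
  also have "\<dots> \<le> (\<Sum>j\<le>n. mom f 1 j)" by (intro sum_mono mom_antimono) auto
  also have "\<dots> = (\<Sum>j\<le>n. mom f 0 j - mom f 0 (Suc j))"
    by (simp only: mom_1_eq)
  also have "\<dots> = mom f 0 0 - mom f 0 (Suc n)" by (rule sum_telescope)
  also have "\<dots> \<le> ip f f" using mom_nonneg[of f 0 "Suc n"] by (simp add: mom_def)
  finally show ?thesis by (simp only: pos_le_divide_eq of_nat_0_less_iff zero_less_Suc mult.commute)
qed

lemma mom_1_double: "mom f 1 (2 * n) = ip (T ((R ^^ n) f)) ((R ^^ n) f)"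
proof -
  have "mom f 1 (2 * n) = ip ((R ^^ n) (T ((R ^^ n) f))) f"
    by (simp add: mom_def mult_2 funpow_add T_Rn)
  then show ?thesis by (simp add: Rn_sym)
qed

text \<open>The vectors \<open>V y\<close> are orthogonal to the kernel of \<open>T\<close> whenever \<open>y\<close> lies in the support
  of \<open>m\<close>: \<open>ip (R\<^sup>n (V x)) (V y)\<close> is equicontinuous in \<open>y\<close> and tends to \<open>0\<close> in the mean square.\<close>

lemma mom_null_on_support:
  fixes m :: "real measure"
  assumes cont: "((\<lambda>y. ip (V y - V x) (V y - V x)) \<longlongrightarrow> 0) (at x)"
    and le: "\<And>f. (\<integral>\<^sup>+ y. ennreal ((ip f (V y))\<^sup>2) \<partial>m) \<le> ennreal (ip (T f) f)"
    and sets: "sets m = sets borel"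
    and supp: "\<And>e. 0 < e \<Longrightarrow> emeasure m (ball x e) > 0"
  shows "(\<lambda>n. mom (V x) 0 n) \<longlonglongrightarrow> 0"
proof -
  have "decseq (mom (V x) 0)" by (intro decseq_SucI mom_decreasing(1))
  then obtain L where L: "mom (V x) 0 \<longlonglongrightarrow> L" "\<And>n. L \<le> mom (V x) 0 n"
    using decseq_convergent[of "mom (V x) 0" 0] mom_nonneg by blast
  have "L \<le> 0"
  proof (rule ccontr)
    assume "\<not> L \<le> 0"
    then have L0: "0 < L" by simp
    define c where "c = ip (V x) (V x)"
    \<comment> \<open>Chosen with c * \<eta> \<le> (L / 2)^2, so that moving from x to a nearby y
      costs at most half of L; the 1 in the denominator keeps \<eta> positive when c = 0.\<close>
    define \<eta> where "\<eta> = L\<^sup>2 / (4 * (c + 1))"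
    have c: "0 \<le> c" by (simp add: c_def ip_pos)
    then have \<eta>: "0 < \<eta>" using L0 by (simp add: \<eta>_def)
    obtain \<delta> where \<delta>: "0 < \<delta>" "\<And>y. y \<noteq> x \<Longrightarrow> \<bar>y - x\<bar> < \<delta> \<Longrightarrow> ip (V y - V x) (V y - V x) < \<eta>"
      using LIM_D[OF cont \<eta>] ip_pos by (auto simp: abs_of_nonneg)
    have close: "ip (V y - V x) (V y - V x) < \<eta>" if "dist x y < \<delta>" for y
      using \<delta>(2)[of y] that \<eta> by (cases "y = x") (auto simp: ip_zero dist_real_def abs_minus_commute)
    define B where "B = emeasure m (ball x \<delta>)"
    have bound: "ennreal (L\<^sup>2 / 4) * B \<le> ennreal (c / real (Suc (2 * n)))" for n
    proof -
      \<comment> \<open>With f = R^n (V x), the integrand \<open>(ip f (V y))\<^sup>2\<close> is at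
        least L^2 / 4 on the whole ball, while its integral is at most
        \<open>mom (V x) 1 (2 * n)\<close>, which decays like 1/n.\<close>
      define f where "f = (R ^^ n) (V x)"
      have ff: "ip f f \<le> c"
        using mom_le[of "V x" 0 "n + n"] by (simp add: f_def ip_Rn_Rn mom_def c_def)
      have lower: "L\<^sup>2 / 4 \<le> (ip f (V y))\<^sup>2" if "dist x y < \<delta>" for y
      proof -
        have "(ip f (V y - V x))\<^sup>2 \<le> ip f f * ip (V y - V x) (V y - V x)"
          by (rule Cauchy_Schwarz)
        also have "\<dots> \<le> c * \<eta>"
          by (intro mult_mono ff less_imp_le[OF close] that c ip_pos)
        also have "\<dots> \<le> (L / 2)\<^sup>2"
          using c by (simp add: \<eta>_def power_divide field_simps)
        finally have "\<bar>ip f (V y - V x)\<bar> \<le> L / 2"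
          using L0 by (simp add: abs_le_square_iff[symmetric])
        moreover have "L \<le> ip f (V x)"
          using L(2)[of n] by (simp add: f_def mom_def)
        moreover have "ip f (V y) = ip f (V x) + ip f (V y - V x)"
          by (simp add: ip_diff2)
        ultimately have "L / 2 \<le> ip f (V y)" by linarith
        then have "(L / 2)\<^sup>2 \<le> (ip f (V y))\<^sup>2" using L0 by (intro power_mono) auto
        then show ?thesis by (simp add: power_divide)
      qed
      have "ennreal (L\<^sup>2 / 4) * B = (\<integral>\<^sup>+ y. ennreal (L\<^sup>2 / 4) * indicator (ball x \<delta>) y \<partial>m)"
        unfolding B_def by (rule nn_integral_cmult_indicator[symmetric]) (simp add: sets)
      also have "\<dots> \<le> (\<integral>\<^sup>+ y. ennreal ((ip f (V y))\<^sup>2) \<partial>m)"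
        by (intro nn_integral_mono) (use lower in \<open>auto simp: indicator_def intro!: ennreal_leI\<close>)
      also have "\<dots> \<le> ennreal (ip (T f) f)" by (rule le)
      also have "ip (T f) f = mom (V x) 1 (2 * n)" by (simp only: mom_1_double f_def)
      also have "ennreal \<dots> \<le> ennreal (c / real (Suc (2 * n)))"
        unfolding c_def by (intro ennreal_leI mom_1_le)
      finally show ?thesis .
    qed
    have "(\<lambda>n. ennreal (c / real (Suc (2 * n)))) \<longlonglongrightarrow> ennreal 0"
    proof (rule tendsto_ennrealI)
      have "(\<lambda>n. c / real (Suc n)) \<longlonglongrightarrow> 0"
        by (rule LIMSEQ_Suc[OF lim_const_over_n])
      from LIMSEQ_subseq_LIMSEQ[OF this, of "\<lambda>n. 2 * n"]
      show "(\<lambda>n. c / real (Suc (2 * n))) \<longlonglongrightarrow> 0"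
        by (simp add: strict_mono_def o_def)
    qed
    then have "ennreal (L\<^sup>2 / 4) * B \<le> ennreal 0"
      by (rule LIMSEQ_le_const) (use bound in auto)
    then have "B = 0" using L0 by (auto simp: mult_eq_0_iff)
    then show False using supp[OF \<delta>(1)] by (simp add: B_def)
  qed
  moreover have "0 \<le> L"
    by (rule LIMSEQ_le_const[OF L(1)]) (use mom_nonneg in auto)
  ultimately show ?thesis using L(1) by simp
qed

end

text \<open>Each half line carries twice an exponential density of rate 1/2. The value 4 is the
  origin of the normalising factor 1/4 in all later kernel bounds.\<close>

lemma nn_integral_exp_abs: "(\<integral>\<^sup>+ y. ennreal (exp (- (\<bar>x - y\<bar> / 2))) \<partial>lborel) = 4"
proof -
  let ?d = "\<lambda>y. ennreal (exponential_density (1/2) y)"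
  have 1: "(\<integral>\<^sup>+ y. ?d y \<partial>lborel) = 1"
    using prob_space.emeasure_space_1[OF prob_space_exponential_density[of "1/2"]]
    by (simp add: emeasure_density)
  have 2: "(\<integral>\<^sup>+ y. ?d (- y) \<partial>lborel) = 1"
    using nn_integral_real_affine[of ?d "-1" 0] 1 by simp
  have "(\<integral>\<^sup>+ y. ennreal (exp (- (\<bar>x - y\<bar> / 2))) \<partial>lborel) = (\<integral>\<^sup>+ y. ennreal (exp (- (\<bar>y\<bar> / 2))) \<partial>lborel)"
    using nn_integral_real_affine[of "\<lambda>y. ennreal (exp (- (\<bar>x - y\<bar> / 2)))" 1 x] by simp
  also have "\<dots> = (\<integral>\<^sup>+ y. 2 * ?d y + 2 * ?d (- y) \<partial>lborel)"
  proof (rule nn_integral_cong_AE)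
    have "AE y in lborel. y \<noteq> (0::real)" by (rule AE_lborel_singleton)
    then show "AE y in lborel. ennreal (exp (- (\<bar>y\<bar> / 2))) = 2 * ?d y + 2 * ?d (- y)"
    proof eventually_elim
      case (elim y)
      have "2 * ennreal (a / 2) = ennreal a" if "0 \<le> a" for a
        using ennreal_mult[of 2 "a / 2"] that by simp
      then show ?case
        using elim by (auto simp: exponential_density_def abs_if)
    qed
  qed
  also have "\<dots> = 2 * (\<integral>\<^sup>+ y. ?d y \<partial>lborel) + 2 * (\<integral>\<^sup>+ y. ?d (- y) \<partial>lborel)"
    by (subst nn_integral_add) (auto simp: nn_integral_cmult)
  finally show ?thesis using 1 2 by simp
qed

lemma integrable_exp_abs: "integrable lborel (\<lambda>y :: real. exp (- (\<bar>x - y\<bar> / 2)) :: real)"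
  by (rule integrableI_bounded) (auto simp: nn_integral_exp_abs)

lemma integral_exp_abs: "(LINT y|lborel. exp (- (\<bar>x - y\<bar> / 2))) = (4 :: real)"
proof -
  have "ennreal (LINT y|lborel. exp (- (\<bar>x - y\<bar> / 2))) = ennreal 4"
    using nn_integral_eq_integral[OF integrable_exp_abs[of x]] by (simp add: nn_integral_exp_abs)
  then show ?thesis by (subst (asm) ennreal_inj) simp_all
qed

section \<open>Square integrable functions\<close>

lemma sq_int_measurable: "sq_int f \<Longrightarrow> f \<in> borel_measurable borel"
  by (simp add: sq_int_def)

lemma sq_int_mult:
  assumes "sq_int f" "sq_int g"
  shows "integrable lborel (\<lambda>x. f x * g x)"
proof (rule Bochner_Integration.integrable_bound)
  note [measurable] = assms[THEN sq_int_measurable]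
  show "integrable lborel (\<lambda>x. (f x)\<^sup>2 + (g x)\<^sup>2)"
    using assms by (auto simp: sq_int_def)
  show "(\<lambda>x. f x * g x) \<in> borel_measurable lborel" by measurable
  have "\<bar>a * b\<bar> \<le> a\<^sup>2 + b\<^sup>2" for a b :: real
  proof -
    have "2 * (a * b) \<le> a\<^sup>2 + b\<^sup>2" "- (2 * (a * b)) \<le> a\<^sup>2 + b\<^sup>2"
      using sum_squares_bound[of a b] sum_squares_bound[of a "-b"] by simp_all
    moreover have "0 \<le> a\<^sup>2 + b\<^sup>2" by simp
    ultimately show ?thesis by (intro abs_leI) linarith+
  qed
  then show "AE x in lborel. norm (f x * g x) \<le> norm ((f x)\<^sup>2 + (g x)\<^sup>2)"
    by simp
qed

lemma sq_int_add: "sq_int f \<Longrightarrow> sq_int g \<Longrightarrow> sq_int (\<lambda>x. f x + g x)"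
  using sq_int_mult[of f g] by (auto simp: sq_int_def power2_sum mult.assoc)

lemma sq_int_cmult: "sq_int f \<Longrightarrow> sq_int (\<lambda>x. c * f x)"
  by (auto simp: sq_int_def power_mult_distrib)

lemma sq_int_abs: "sq_int f \<Longrightarrow> sq_int (\<lambda>x. \<bar>f x\<bar>)"
  by (auto simp: sq_int_def)

lemma sq_int_exp_bound:
  assumes "f \<in> borel_measurable borel" "\<And>y. \<bar>f y\<bar> \<le> D * exp (- (\<bar>x - y\<bar> / 2))"
  shows "sq_int f" "(LINT y|lborel. (f y)\<^sup>2) \<le> 4 * D\<^sup>2"
proof -
  have le: "(f y)\<^sup>2 \<le> D\<^sup>2 * exp (- (\<bar>x - y\<bar> / 2))" for y
  proof -
    have "(f y)\<^sup>2 \<le> (D * exp (- (\<bar>x - y\<bar> / 2)))\<^sup>2"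
      using assms(2)[of y] abs_le_square_iff[of "f y" "D * exp (- (\<bar>x - y\<bar> / 2))"] by linarith
    also have "\<dots> = D\<^sup>2 * exp (- \<bar>x - y\<bar>)"
      by (simp add: power_mult_distrib exp_double[symmetric])
    also have "\<dots> \<le> D\<^sup>2 * exp (- (\<bar>x - y\<bar> / 2))"
      by (intro mult_left_mono) auto
    finally show ?thesis .
  qed
  have int: "integrable lborel (\<lambda>y. (f y)\<^sup>2)"
    by (rule Bochner_Integration.integrable_bound[where f="\<lambda>y. D\<^sup>2 * exp (- (\<bar>x - y\<bar> / 2))"])
      (use assms(1) le integrable_exp_abs in auto)
  then show "sq_int f" using assms(1) by (simp add: sq_int_def)
  have "(LINT y|lborel. (f y)\<^sup>2) \<le> (LINT y|lborel. D\<^sup>2 * exp (- (\<bar>x - y\<bar> / 2)))"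
    by (rule integral_mono[OF int]) (use le integrable_exp_abs in auto)
  also have "\<dots> = 4 * D\<^sup>2" by (simp add: integral_exp_abs)
  finally show "(LINT y|lborel. (f y)\<^sup>2) \<le> 4 * D\<^sup>2" .
qed

text \<open>Functions are not identified when equal almost everywhere, so \<open>ip\<close> below is only semidefinite.\<close>

typedef l2 = "{f. sq_int f}" morphisms fn mkl2
  by (rule exI[of _ "\<lambda>_. 0"]) (simp add: sq_int_def)

lemma sq_int_fn: "sq_int (fn f)"
  using fn[of f] by simp

lemma fn_mkl2: "sq_int f \<Longrightarrow> fn (mkl2 f) = f"
  by (simp add: mkl2_inverse)

lemma fn_measurable [measurable]: "fn f \<in> borel_measurable borel"
  by (rule sq_int_measurable[OF sq_int_fn])

lemma l2_eqI: "(\<And>x. fn f x = fn g x) \<Longrightarrow> f = g"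
  using fn_inject by (metis ext)

instantiation l2 :: real_vector
begin

definition "0 = mkl2 (\<lambda>_. 0)"
definition "f + g = mkl2 (\<lambda>x. fn f x + fn g x)"
definition "c *\<^sub>R f = mkl2 (\<lambda>x. c * fn f x)"
definition "- f = mkl2 (\<lambda>x. (- 1) * fn f x)"
definition "f - g = mkl2 (\<lambda>x. fn f x + (- 1) * fn g x)"

lemma fn_zero [simp]: "fn 0 x = 0"
  unfolding zero_l2_def by (subst fn_mkl2) (auto simp: sq_int_def)

lemma fn_plus [simp]: "fn (f + g) x = fn f x + fn g x"
  unfolding plus_l2_def by (subst fn_mkl2) (auto intro!: sq_int_add sq_int_fn)

lemma fn_scaleR [simp]: "fn (c *\<^sub>R f) x = c * fn f x"
  unfolding scaleR_l2_def by (subst fn_mkl2) (auto intro!: sq_int_cmult sq_int_fn)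

lemma fn_uminus [simp]: "fn (- f) x = - fn f x"
  unfolding uminus_l2_def by (subst fn_mkl2[OF sq_int_cmult[OF sq_int_fn]]) simp

lemma fn_minus [simp]: "fn (f - g) x = fn f x - fn g x"
  unfolding minus_l2_def
  by (subst fn_mkl2[OF sq_int_add[OF sq_int_fn sq_int_cmult[OF sq_int_fn]]]) simp

instance
  by standard (auto intro!: l2_eqI simp: algebra_simps)

end

definition ip :: "l2 \<Rightarrow> l2 \<Rightarrow> real" where
  "ip f g = l2_inner (fn f) (fn g)"

lemma ip_integrable: "integrable lborel (\<lambda>x. fn f x * fn g x)"
  by (rule sq_int_mult[OF sq_int_fn sq_int_fn])

lemma ip_self: "ip f f = (LINT x|lborel. (fn f x)\<^sup>2)"
  by (simp add: ip_def l2_inner_def power2_eq_square)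

lemma fn_sq_integrable: "integrable lborel (\<lambda>x. (fn f x)\<^sup>2)"
  using sq_int_fn[of f] by (simp add: sq_int_def)

lemma l2_ip_simps:
  "ip (f + g) h = ip f h + ip g h" "ip (c *\<^sub>R f) h = c * ip f h" "ip f g = ip g f" "0 \<le> ip f f"
  by (simp_all add: ip_def l2_inner_def distrib_right ip_integrable mult.assoc mult.commute[of "fn f _" "fn g _"])

text \<open>Dominated convergence along a sequence X. A convergent sequence stays within some M of
  x, so recentring the exponential bound from X n to x costs at most the factor exp (M / 2),
  uniformly in n.\<close>

lemma exp_family_continuous:
  fixes v :: "real \<Rightarrow> real \<Rightarrow> real"
  assumes meas: "\<And>x. v x \<in> borel_measurable borel"
    and bound: "\<And>x y. \<bar>v x y\<bar> \<le> D * exp (- (\<bar>x - y\<bar> / 2))"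
    and cont: "\<And>y. isCont (\<lambda>x. v x y) x"
  shows "((\<lambda>z. ip (mkl2 (v z) - mkl2 (v x)) (mkl2 (v z) - mkl2 (v x))) \<longlongrightarrow> 0) (at x)"
  unfolding tendsto_at_iff_sequentially
proof (intro allI impI)
  fix X :: "nat \<Rightarrow> real" assume "\<forall>i. X i \<in> UNIV - {x}" and X: "X \<longlonglongrightarrow> x"
  note [measurable] = meas
  have sq: "sq_int (v z)" for z by (rule sq_int_exp_bound(1)[OF meas bound])
  have eq: "ip (mkl2 (v z) - mkl2 (v x)) (mkl2 (v z) - mkl2 (v x)) = (LINT y|lborel. (v z y - v x y)\<^sup>2)" for z
    by (simp add: ip_self fn_mkl2[OF sq])
  obtain M where M: "\<And>n. \<bar>X n - x\<bar> \<le> M"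
    using convergent_imp_Bseq[OF convergentI[OF tendsto_diff[OF X tendsto_const[of x]]]]
    by (auto simp: Bseq_def)
  define E where "E = \<bar>D\<bar> * (exp (M / 2) + 1)"
  have dom: "\<bar>v (X n) y - v x y\<bar> \<le> E * exp (- (\<bar>x - y\<bar> / 2))" for n y
  proof -
    have "\<bar>x - y\<bar> \<le> \<bar>X n - y\<bar> + M" using M[of n] by linarith
    then have "exp (- (\<bar>X n - y\<bar> / 2)) \<le> exp (M / 2) * exp (- (\<bar>x - y\<bar> / 2))"
      by (simp add: exp_add[symmetric])
    then have "\<bar>D\<bar> * exp (- (\<bar>X n - y\<bar> / 2)) \<le> \<bar>D\<bar> * (exp (M / 2) * exp (- (\<bar>x - y\<bar> / 2)))"
      by (intro mult_left_mono) auto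
    moreover have "\<bar>v z y\<bar> \<le> \<bar>D\<bar> * exp (- (\<bar>z - y\<bar> / 2))" for z
      by (rule order_trans[OF bound]) (simp add: mult_right_mono)
    ultimately have "\<bar>v (X n) y\<bar> + \<bar>v x y\<bar> \<le> \<bar>D\<bar> * (exp (M / 2) * exp (- (\<bar>x - y\<bar> / 2))) + \<bar>D\<bar> * exp (- (\<bar>x - y\<bar> / 2))"
      by (meson add_mono order_trans)
    then show ?thesis unfolding E_def distrib_left distrib_right mult.assoc mult_1 by linarith
  qed
  have "(\<lambda>n. LINT y|lborel. (v (X n) y - v x y)\<^sup>2) \<longlonglongrightarrow> integral\<^sup>L lborel (\<lambda>y :: real. 0)"
  proof (rule integral_dominated_convergence[where w="\<lambda>y. E\<^sup>2 * exp (- (\<bar>x - y\<bar> / 2))"])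
    show "AE y in lborel. (\<lambda>n. (v (X n) y - v x y)\<^sup>2) \<longlonglongrightarrow> 0"
    proof (rule AE_I2)
      fix y
      have "(\<lambda>n. v (X n) y) \<longlonglongrightarrow> v x y"
        using isCont_tendsto_compose[OF cont X] .
      then have "(\<lambda>n. (v (X n) y - v x y)\<^sup>2) \<longlonglongrightarrow> (v x y - v x y)\<^sup>2"
        by (intro tendsto_intros)
      then show "(\<lambda>n. (v (X n) y - v x y)\<^sup>2) \<longlonglongrightarrow> 0" by simp
    qed
    show "AE y in lborel. norm ((v (X n) y - v x y)\<^sup>2) \<le> E\<^sup>2 * exp (- (\<bar>x - y\<bar> / 2))" for n
    proof (rule AE_I2)
      fix y
      have "(v (X n) y - v x y)\<^sup>2 \<le> (E * exp (- (\<bar>x - y\<bar> / 2)))\<^sup>2"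
        using dom[of n y] abs_le_square_iff[of "v (X n) y - v x y" "E * exp (- (\<bar>x - y\<bar> / 2))"] by linarith
      also have "\<dots> = E\<^sup>2 * exp (- \<bar>x - y\<bar>)"
        by (simp add: power_mult_distrib exp_double[symmetric])
      also have "\<dots> \<le> E\<^sup>2 * exp (- (\<bar>x - y\<bar> / 2))"
        by (intro mult_left_mono) auto
      finally show "norm ((v (X n) y - v x y)\<^sup>2) \<le> E\<^sup>2 * exp (- (\<bar>x - y\<bar> / 2))" by simp
    qed
  qed (auto intro: integrable_exp_abs)
  then show "((\<lambda>z. ip (mkl2 (v z) - mkl2 (v x)) (mkl2 (v z) - mkl2 (v x))) \<circ> X) \<longlonglongrightarrow> 0"
    by (simp add: eq o_def)
qed

section \<open>Nonnegative definite kernels of norm at most one\<close>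

text \<open>The factor 1/4 makes every row integrate to at most 1, so that Schur's test bounds the
  operator by 1. Nonnegativity of the entries permits Tonelli's theorem and later gives a
  nonnegative transport function.\<close>

locale contraction_kernel =
  fixes k :: "real \<Rightarrow> real \<Rightarrow> real"
  assumes k_meas: "case_prod k \<in> borel_measurable (borel \<Otimes>\<^sub>M borel)"
    and k_sym: "k x y = k y x"
    and k_nonneg: "0 \<le> k x y"
    and k_bound: "k x y \<le> 1 / 4 * exp (- (\<bar>x - y\<bar> / 2))"
    and k_psd: "sq_int f \<Longrightarrow> 0 \<le> l2_inner (kop k f) f"
begin

lemma k_meas' [measurable (raw)]:
  assumes "f \<in> borel_measurable M" "g \<in> borel_measurable M"
  shows "(\<lambda>w. k (f w) (g w)) \<in> borel_measurable M"
  using measurable_compose[OF measurable_Pair[OF assms] k_meas] by simp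

lemma k_abs: "\<bar>k x y\<bar> \<le> 1 / 4 * exp (- (\<bar>x - y\<bar> / 2))"
  using k_nonneg k_bound by simp

lemma sq_int_k: "sq_int (k x)"
  by (rule sq_int_exp_bound(1)[OF _ k_abs]) measurable

lemma nn_k: "(\<integral>\<^sup>+ y. ennreal (k x y) \<partial>lborel) \<le> 1"
proof -
  have "(\<integral>\<^sup>+ y. ennreal (k x y) \<partial>lborel) \<le> (\<integral>\<^sup>+ y. ennreal (1 / 4) * ennreal (exp (- (\<bar>x - y\<bar> / 2))) \<partial>lborel)"
    using k_bound by (intro nn_integral_mono) (simp add: ennreal_mult[symmetric] ennreal_leI)
  also have "\<dots> = ennreal (1 / 4) * 4"
    by (subst nn_integral_cmult) (auto simp: nn_integral_exp_abs)
  also have "\<dots> = ennreal (1 / 4 * 4)"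
    by (subst ennreal_mult) auto
  finally show ?thesis by simp
qed

lemma kop_integrable: "sq_int f \<Longrightarrow> integrable lborel (\<lambda>y. k x y * f y)"
  by (rule sq_int_mult[OF sq_int_k])

lemma kop_measurable [measurable]:
  assumes [measurable]: "f \<in> borel_measurable borel"
  shows "kop k f \<in> borel_measurable borel"
proof -
  have "(\<lambda>x. LINT y|lborel. k x y * f y) \<in> borel_measurable borel"
    by measurable
  then show ?thesis by (simp add: kop_def)
qed

text \<open>Schur's test: the kernel is split into two square roots, Cauchy-Schwarz uses up one row
  integral, and the exchange of integrals uses up the other. The statement is about nonnegative
  integrals because square integrability of the image is deduced from it.\<close>

lemma kop_sq_bound:
  assumes "sq_int f"
  shows "(\<integral>\<^sup>+ x. ennreal ((kop k f x)\<^sup>2) \<partial>lborel) \<le> (\<integral>\<^sup>+ x. ennreal ((f x)\<^sup>2) \<partial>lborel)"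
proof -
  note [measurable] = sq_int_measurable[OF assms]
  have "ennreal ((kop k f x)\<^sup>2) \<le> (\<integral>\<^sup>+ y. ennreal (k x y * (f y)\<^sup>2) \<partial>lborel)" for x
  proof -
    have "\<bar>kop k f x\<bar> \<le> (LINT y|lborel. \<bar>k x y * f y\<bar>)"
      unfolding kop_def by (rule integral_abs_bound)
    then have "ennreal \<bar>kop k f x\<bar> \<le> (\<integral>\<^sup>+ y. ennreal \<bar>k x y * f y\<bar> \<partial>lborel)"
      by (subst nn_integral_eq_integral) (auto intro!: kop_integrable assms ennreal_leI integrable_abs)
    also have "\<dots> = (\<integral>\<^sup>+ y. ennreal (sqrt (k x y)) * ennreal (sqrt (k x y) * \<bar>f y\<bar>) \<partial>lborel)"
      using k_nonneg by (intro nn_integral_cong) (simp add: ennreal_mult[symmetric] abs_mult mult.assoc[symmetric])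
    finally have "(ennreal \<bar>kop k f x\<bar>)\<^sup>2 \<le> (\<integral>\<^sup>+ y. ennreal (sqrt (k x y)) * ennreal (sqrt (k x y) * \<bar>f y\<bar>) \<partial>lborel)\<^sup>2"
      by (intro power_mono) auto
    also have "\<dots> \<le> (\<integral>\<^sup>+ y. (ennreal (sqrt (k x y)))\<^sup>2 \<partial>lborel) * (\<integral>\<^sup>+ y. (ennreal (sqrt (k x y) * \<bar>f y\<bar>))\<^sup>2 \<partial>lborel)"
      by (rule Cauchy_Schwarz_nn_integral) measurable
    also have "\<dots> = (\<integral>\<^sup>+ y. ennreal (k x y) \<partial>lborel) * (\<integral>\<^sup>+ y. ennreal (k x y * (f y)\<^sup>2) \<partial>lborel)"
      using k_nonneg by (simp add: ennreal_power power_mult_distrib)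
    also have "\<dots> \<le> 1 * (\<integral>\<^sup>+ y. ennreal (k x y * (f y)\<^sup>2) \<partial>lborel)"
      by (intro mult_right_mono nn_k) auto
    finally show ?thesis by (simp add: ennreal_power)
  qed
  then have "(\<integral>\<^sup>+ x. ennreal ((kop k f x)\<^sup>2) \<partial>lborel) \<le> (\<integral>\<^sup>+ x. (\<integral>\<^sup>+ y. ennreal (k x y * (f y)\<^sup>2) \<partial>lborel) \<partial>lborel)"
    by (intro nn_integral_mono)
  also have "\<dots> = (\<integral>\<^sup>+ y. (\<integral>\<^sup>+ x. ennreal (k x y * (f y)\<^sup>2) \<partial>lborel) \<partial>lborel)"
    by (rule lborel_pair.Fubini') measurable
  also have "\<dots> = (\<integral>\<^sup>+ y. (\<integral>\<^sup>+ x. ennreal (k y x) \<partial>lborel) * ennreal ((f y)\<^sup>2) \<partial>lborel)"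
    using k_nonneg by (subst nn_integral_multc[symmetric]) (auto intro!: nn_integral_cong simp: ennreal_mult k_sym)
  also have "\<dots> \<le> (\<integral>\<^sup>+ y. 1 * ennreal ((f y)\<^sup>2) \<partial>lborel)"
    by (intro nn_integral_mono mult_right_mono nn_k) auto
  finally show ?thesis by simp
qed

lemma sq_int_kop:
  assumes "sq_int f"
  shows "sq_int (kop k f)"
proof -
  note [measurable] = sq_int_measurable[OF assms]
  have "(\<integral>\<^sup>+ x. ennreal ((f x)\<^sup>2) \<partial>lborel) < \<infinity>"
    using assms unfolding sq_int_def by (auto simp: nn_integral_eq_integral)
  then have "integrable lborel (\<lambda>x. (kop k f x)\<^sup>2)"
    using kop_sq_bound[OF assms] by (intro integrableI_bounded) auto
  then show ?thesis by (simp add: sq_int_def)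
qed

definition T :: "l2 \<Rightarrow> l2" where "T f = mkl2 (kop k (fn f))"

lemma fn_T: "fn (T f) = kop k (fn f)"
  unfolding T_def by (rule fn_mkl2[OF sq_int_kop[OF sq_int_fn]])

definition V :: "real \<Rightarrow> l2" where "V x = mkl2 (k x)"

lemma fn_V: "fn (V x) = k x"
  unfolding V_def by (rule fn_mkl2[OF sq_int_k])

lemma fn_T_eq_ip: "fn (T f) x = ip (V x) f"
  by (simp add: fn_T kop_def ip_def l2_inner_def fn_V)

lemma T_symmetric: "ip (T f) g = ip f (T g)"
proof -
  have "integrable (lborel \<Otimes>\<^sub>M lborel) (\<lambda>(x, y). k x y * fn f y * fn g x)"
  proof (rule lborel_pair.Fubini_integrable)
    show "AE x in lborel. integrable lborel (\<lambda>y. case (x, y) of (x, y) \<Rightarrow> k x y * fn f y * fn g x)"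
      by (auto intro: kop_integrable sq_int_fn)
    have "integrable lborel (\<lambda>x. kop k (\<lambda>y. \<bar>fn f y\<bar>) x * \<bar>fn g x\<bar>)"
      by (intro sq_int_mult sq_int_kop sq_int_abs sq_int_fn)
    then show "integrable lborel (\<lambda>x. LINT y|lborel. norm (case (x, y) of (x, y) \<Rightarrow> k x y * fn f y * fn g x))"
      using k_nonneg by (simp add: kop_def abs_mult)
  qed measurable
  from lborel_pair.Fubini_integral[of "\<lambda>x y. k x y * fn f y * fn g x", OF this]
  have "(LINT x|lborel. (LINT y|lborel. k x y * fn f y) * fn g x) = (LINT y|lborel. fn f y * (LINT x|lborel. k y x * fn g x))"
    by (simp add: k_sym[of _ "_ :: real"] mult.assoc mult.left_commute flip: integral_mult_right_zero integral_mult_left_zero)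
  then show ?thesis
    by (simp add: ip_def l2_inner_def fn_T kop_def)
qed

sublocale contraction_form ip T
proof (rule contraction_form.intro)
  show "ip (f + g) h = ip f h + ip g h" "ip (c *\<^sub>R f) h = c * ip f h" "ip f g = ip g f" "0 \<le> ip f f" for f g h c
    by (fact l2_ip_simps)+
  have *: "integrable lborel (\<lambda>y. k x y * fn f y)" for x f
    by (rule kop_integrable[OF sq_int_fn])
  show "linear T"
  proof (rule linearI)
    show "T (f + g) = T f + T g" for f g
      using * by (intro l2_eqI) (simp add: fn_T kop_def distrib_left)
    show "T (c *\<^sub>R f) = c *\<^sub>R T f" for c f
      by (intro l2_eqI) (simp add: fn_T kop_def mult.left_commute)
  qed
  show "ip (T f) g = ip f (T g)" for f g by (rule T_symmetric)
  show "0 \<le> ip (T f) f" for f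
    using k_psd[OF sq_int_fn] by (simp add: ip_def fn_T)
  show "ip (T f) f \<le> ip f f" for f
  proof -
    have "ennreal (ip (T f) (T f)) \<le> ennreal (ip f f)"
      using kop_sq_bound[OF sq_int_fn, of f]
      by (simp add: ip_self nn_integral_eq_integral fn_sq_integrable flip: fn_T)
    then have 1: "ip (T f) (T f) \<le> ip f f"
      by (simp add: l2_ip_simps)
    \<comment> \<open>The norm bound becomes a form bound through 2ab \<le> a^2 + b^2 applied
      pointwise.\<close>
    have "ip (T f) f \<le> (LINT x|lborel. ((fn (T f) x)\<^sup>2 + (fn f x)\<^sup>2) / 2)"
      unfolding ip_def l2_inner_def
    proof (rule integral_mono[OF ip_integrable])
      show "fn (T f) x * fn f x \<le> ((fn (T f) x)\<^sup>2 + (fn f x)\<^sup>2) / 2" for x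
        using sum_squares_bound[of "fn (T f) x" "fn f x"] by simp
    qed (auto intro!: fn_sq_integrable)
    also have "\<dots> = (ip (T f) (T f) + ip f f) / 2"
      by (simp add: ip_self fn_sq_integrable)
    finally show ?thesis using 1 by simp
  qed
qed

lemma kop_pow: "(kop k ^^ n) (fn f) = fn ((T ^^ n) f)"
  by (induction n) (simp_all add: fn_T)

lemma V_norm: "ip (V x) (V x) \<le> 1 / 4"
  using sq_int_exp_bound(2)[OF _ k_abs, of x] by (simp add: ip_self fn_V power2_eq_square)

lemma ip_V: "ip f (V x) = fn (T f) x"
  using fn_T_eq_ip ip_sym by metis

end

text \<open>Both h and 1 - h have even moments bounded by \<open>ip f f\<close>, so both have
  modulus at most 1 almost everywhere; together this places h in [0,1].\<close>

lemma (in contraction_form) moments_AE_unit_interval: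
  fixes h :: "'b \<Rightarrow> real"
  assumes int: "\<And>k. integrable \<mu> (\<lambda>s. h s ^ k)"
    and m: "\<And>k. (LINT s|\<mu>. h s ^ k) = ip ((T ^^ k) f) f"
    and fin: "finite_measure \<mu>" and [measurable]: "h \<in> borel_measurable \<mu>"
  shows "AE s in \<mu>. 0 \<le> h s \<and> h s \<le> 1"
proof -
  note mm = mixed_moment[OF int m]
  have "AE s in \<mu>. \<bar>h s\<bar> \<le> 1"
  proof (rule AE_abs_le_1_of_power_moments[OF int _ _ fin])
    show "(LINT s|\<mu>. h s ^ (2 * n)) \<le> ip f f" for n
      using mm[of "2 * n" 0] mom_le[of f "2 * n" 0] by simp
  qed measurable
  moreover have "AE s in \<mu>. \<bar>1 - h s\<bar> \<le> 1"
  proof (rule AE_abs_le_1_of_power_moments[OF _ _ _ fin])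
    show "integrable \<mu> (\<lambda>s. (1 - h s) ^ (2 * n))" for n
      using mm[of 0 "2 * n"] by simp
    show "(LINT s|\<mu>. (1 - h s) ^ (2 * n)) \<le> ip f f" for n
      using mm[of 0 "2 * n"] mom_le[of f 0 "2 * n"] by simp
  qed measurable
  ultimately show ?thesis by eventually_elim auto
qed

text \<open>The cut-off at c of 1/t^2, whose form on the rows is the kernel of a spectral
  projection. The maximum in the denominator changes no value but exhibits the function as a
  continuous function times a cut-off.\<close>

definition inv_sq :: "real \<Rightarrow> real \<Rightarrow> real" where
  "inv_sq c t = (if c \<le> t then 1 / (max c t)\<^sup>2 else 0)"

lemma inv_sq_nonneg: "0 \<le> inv_sq c t"
  by (simp add: inv_sq_def)

lemma inv_sq_eq: "c \<le> t \<Longrightarrow> inv_sq c t = 1 / t\<^sup>2"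
  by (simp add: inv_sq_def max_absorb2)

lemma inv_sq_less: "t < c \<Longrightarrow> inv_sq c t = 0"
  by (simp add: inv_sq_def)

lemma inv_sq_le: "inv_sq c t \<le> 1 / t\<^sup>2"
  by (cases "c \<le> t") (simp_all add: inv_sq_eq inv_sq_less not_le)

lemma inv_sq_antimono: "c \<le> c' \<Longrightarrow> inv_sq c' t \<le> inv_sq c t"
  by (cases "c' \<le> t") (simp_all add: inv_sq_eq inv_sq_less inv_sq_nonneg not_le)

lemma inv_sq_measurable [measurable]: "inv_sq c \<in> borel_measurable borel"
  unfolding inv_sq_def[abs_def] by measurable

lemma polynomial_sequence_inv_sq:
  assumes "0 < c"
  shows "\<exists>a d D. (\<forall>n. \<forall>s\<in>{0..1}. \<bar>\<Sum>i\<le>d n. a n i * s ^ i\<bar> \<le> D) \<and>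
    (\<forall>s\<in>{0..1}. (\<lambda>n. \<Sum>i\<le>d n. a n i * s ^ i) \<longlonglongrightarrow> inv_sq c s)"
  unfolding inv_sq_def
proof (rule polynomial_sequence_threshold)
  have "max c s \<noteq> 0" for s using assms by (simp add: max_def)
  then show "continuous_on {0..1} (\<lambda>s. 1 / (max c s)\<^sup>2)" by (intro continuous_intros) auto
qed

lemma sums_Suc_power: 
  assumes "0 < s" "s \<le> (1::real)"
  shows "(\<Sum>n. ennreal (real (Suc n) * (1 - s) ^ n)) = ennreal (1 / s\<^sup>2)"
    and "(\<Sum>n. ennreal ((1 - s) ^ n)) = ennreal (1 / s)"
    and "(\<Sum>n. ennreal (real (Suc n) * (s * (1 - s) ^ n))) = ennreal (1 / s)"
proof -
  have 1: "(\<lambda>n. real (Suc n) * (1 - s) ^ n) sums (1 / s\<^sup>2)"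
    using geometric_deriv_sums[of "1 - s"] assms by simp
  show "(\<Sum>n. ennreal (real (Suc n) * (1 - s) ^ n)) = ennreal (1 / s\<^sup>2)"
    by (rule suminf_ennreal_eq[OF _ 1]) (use assms in simp)
  have 2: "(\<lambda>n. (1 - s) ^ n) sums (1 / s)"
    using geometric_sums[of "1 - s"] assms by simp
  show "(\<Sum>n. ennreal ((1 - s) ^ n)) = ennreal (1 / s)"
    by (rule suminf_ennreal_eq[OF _ 2]) (use assms in simp)
  have 3: "(\<lambda>n. real (Suc n) * (s * (1 - s) ^ n)) sums (1 / s)"
    using sums_mult[OF 1, of s] assms by (simp add: power2_eq_square mult.left_commute)
  show "(\<Sum>n. ennreal (real (Suc n) * (s * (1 - s) ^ n))) = ennreal (1 / s)"
    by (rule suminf_ennreal_eq[OF _ 3]) (use assms in simp)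
qed

context contraction_form
begin

text \<open>On the zero set of h the function (1 - h)^n is 1, so the mass of that set is at most
  \<open>mom f 0 n\<close> for every n. The series for 1/s and 1/s^2 therefore converge almost
  everywhere.\<close>

lemma AE_pos_of_mom_null:
  fixes h :: "'b \<Rightarrow> real"
  assumes int: "\<And>k. integrable \<mu> (\<lambda>s. h s ^ k)"
    and m: "\<And>k. (LINT s|\<mu>. h s ^ k) = ip ((T ^^ k) f) f"
    and fin: "finite_measure \<mu>" and h[measurable]: "h \<in> borel_measurable \<mu>"
    and null: "(\<lambda>n. mom f 0 n) \<longlonglongrightarrow> 0"
  shows "AE s in \<mu>. 0 < h s \<and> h s \<le> 1"
proof -
  interpret finite_measure \<mu> by fact
  note AE = moments_AE_unit_interval[OF int m fin h]
  note mm = mixed_moment[OF int m]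
  have "measure \<mu> {s\<in>space \<mu>. h s = 0} \<le> mom f 0 n" for n
  proof -
    have "measure \<mu> {s\<in>space \<mu>. h s = 0} = (LINT s|\<mu>. indicator {s\<in>space \<mu>. h s = 0} s)"
      by simp
    also have "\<dots> \<le> (LINT s|\<mu>. (1 - h s) ^ n)"
    proof (rule integral_mono_AE)
      show "integrable \<mu> (\<lambda>s. (1 - h s) ^ n)" using mm[of 0 n] by simp
      show "AE s in \<mu>. indicator {s\<in>space \<mu>. h s = 0} s \<le> (1 - h s) ^ n"
        using AE by eventually_elim (auto simp: indicator_def)
      show "integrable \<mu> (indicat_real {s\<in>space \<mu>. h s = 0})"
        by (rule integrable_real_indicator) (auto simp: less_top[symmetric])
    qed
    also have "\<dots> = mom f 0 n" using mm[of 0 n] by simp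
    finally show ?thesis .
  qed
  then have "measure \<mu> {s\<in>space \<mu>. h s = 0} \<le> 0"
    by (intro LIMSEQ_le_const[OF null]) auto
  then have "emeasure \<mu> {s\<in>space \<mu>. h s = 0} = 0"
    by (simp add: emeasure_eq_measure measure_le_0_iff)
  then have "AE s in \<mu>. h s \<noteq> 0"
    by (intro AE_I[of _ _ "{s\<in>space \<mu>. h s = 0}"]) auto
  then show ?thesis using AE by eventually_elim auto
qed

lemma suminf_mom_inv_sq:
  fixes h :: "'b \<Rightarrow> real"
  assumes int: "\<And>k. integrable \<mu> (\<lambda>s. h s ^ k)"
    and m: "\<And>k. (LINT s|\<mu>. h s ^ k) = ip ((T ^^ k) f) f"
    and fin: "finite_measure \<mu>" and h[measurable]: "h \<in> borel_measurable \<mu>"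
    and null: "(\<lambda>n. mom f 0 n) \<longlonglongrightarrow> 0"
  shows "(\<Sum>n. ennreal (real (Suc n) * mom f 0 n)) = (\<integral>\<^sup>+ s. ennreal (1 / (h s)\<^sup>2) \<partial>\<mu>)"
    and "(\<Sum>n. ennreal (mom f 0 n)) = (\<integral>\<^sup>+ s. ennreal (1 / h s) \<partial>\<mu>)"
    and "(\<Sum>n. ennreal (real (Suc n) * mom f 1 n)) = (\<integral>\<^sup>+ s. ennreal (1 / h s) \<partial>\<mu>)"
proof -
  note AE = AE_pos_of_mom_null[OF assms]
  note mm = mixed_moment[OF int m]
  have eq: "(\<Sum>n. ennreal (g n * mom f j n)) = (\<integral>\<^sup>+ s. (\<Sum>n. ennreal (g n * (h s ^ j * (1 - h s) ^ n))) \<partial>\<mu>)"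
    if "\<And>n. 0 \<le> g n" for g :: "nat \<Rightarrow> real" and j
  proof -
    have "(\<integral>\<^sup>+ s. ennreal (g n * (h s ^ j * (1 - h s) ^ n)) \<partial>\<mu>) = ennreal (g n * mom f j n)" for n
    proof (subst nn_integral_eq_integral)
      show "AE s in \<mu>. 0 \<le> g n * (h s ^ j * (1 - h s) ^ n)"
        using AE by eventually_elim (simp add: that)
    qed (use mm[of j n] in auto)
    moreover have "(\<integral>\<^sup>+ s. (\<Sum>n. ennreal (g n * (h s ^ j * (1 - h s) ^ n))) \<partial>\<mu>)
      = (\<Sum>n. \<integral>\<^sup>+ s. ennreal (g n * (h s ^ j * (1 - h s) ^ n)) \<partial>\<mu>)"
      by (rule nn_integral_suminf) measurable
    ultimately show ?thesis by simp
  qed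
  show "(\<Sum>n. ennreal (real (Suc n) * mom f 0 n)) = (\<integral>\<^sup>+ s. ennreal (1 / (h s)\<^sup>2) \<partial>\<mu>)"
    unfolding eq[of "\<lambda>n. real (Suc n)", OF of_nat_0_le_iff]
    by (rule nn_integral_cong_AE, use AE in eventually_elim) (simp only: power_0 mult_1 sums_Suc_power(1))
  show "(\<Sum>n. ennreal (mom f 0 n)) = (\<integral>\<^sup>+ s. ennreal (1 / h s) \<partial>\<mu>)"
    using eq[of "\<lambda>n. 1" 0]
    by (simp only: mult_1 power_0 zero_le_one, intro nn_integral_cong_AE, use AE in eventually_elim)
      (simp only: sums_Suc_power(2))
  show "(\<Sum>n. ennreal (real (Suc n) * mom f 1 n)) = (\<integral>\<^sup>+ s. ennreal (1 / h s) \<partial>\<mu>)"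
    unfolding eq[of "\<lambda>n. real (Suc n)", OF of_nat_0_le_iff]
    by (rule nn_integral_cong_AE, use AE in eventually_elim) (simp only: power_one_right sums_Suc_power(3))
qed

text \<open>Both series integrate 1/s against the spectral measure. This is where the power of T
  gained by transport is absorbed and the weights n + 1 disappear.\<close>

lemma suminf_mom_1:
  assumes null: "(\<lambda>n. mom f 0 n) \<longlonglongrightarrow> 0"
  shows "(\<Sum>n. ennreal (real (Suc n) * mom f 1 n)) = (\<Sum>n. ennreal (mom f 0 n))"
proof -
  obtain \<mu> where fin: "finite_measure \<mu>" and [measurable_cong]: "sets \<mu> = sets borel" and
    AE: "AE s in \<mu>. 0 \<le> s \<and> s \<le> 1" and m: "\<And>k. (LINT s|\<mu>. s ^ k) = ip ((T ^^ k) f) f"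
    and int: "\<And>k. integrable \<mu> (\<lambda>s. s ^ k)"
    using spectral_measure[of f] by blast
  interpret finite_measure \<mu> by fact
  show ?thesis
    using suminf_mom_inv_sq(2,3)[OF int m fin _ null] by simp
qed

end

section \<open>The kernel of a spectral projection\<close>

text \<open>Bumps shrinking to x, left unnormalised. They are continuous with compact support, hence
  admissible in the condition that characterises \<open>spec_kernel\<close>, and square integrable,
  hence admissible in weak measurability and covariance.\<close>

definition tent :: "real \<Rightarrow> nat \<Rightarrow> real \<Rightarrow> real" where
  "tent x n y = max 0 (1 - real (Suc n) * \<bar>y - x\<bar>)"

lemma tent_continuous: "continuous_on UNIV (tent x n)"
  unfolding tent_def by (intro continuous_intros)

lemma tent_measurable [measurable]: "tent x n \<in> borel_measurable borel"
  by (rule borel_measurable_continuous_onI[OF tent_continuous])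

lemma tent_bounds: "0 \<le> tent x n y" "tent x n y \<le> 1"
  by (auto simp: tent_def)

lemma tent_zero: "1 / real (Suc n) \<le> \<bar>y - x\<bar> \<Longrightarrow> tent x n y = 0"
  by (simp add: tent_def field_simps)

lemma tent_zero': "1 \<le> \<bar>y - x\<bar> \<Longrightarrow> tent x n y = 0"
proof -
  assume "1 \<le> \<bar>y - x\<bar>"
  moreover have "1 / real (Suc n) \<le> 1" by simp
  ultimately show ?thesis by (intro tent_zero) linarith
qed

lemma tent_support: "\<bar>y\<bar> > \<bar>x\<bar> + 1 \<Longrightarrow> tent x n y = 0"
  by (rule tent_zero') linarith

lemma integrable_bounded_support:
  fixes f :: "real \<Rightarrow> real"
  assumes [measurable]: "f \<in> borel_measurable borel" and "\<And>y. \<bar>f y\<bar> \<le> D" "\<And>y. \<bar>y\<bar> > r \<Longrightarrow> f y = 0"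
  shows "integrable lborel f"
proof (rule integrableI_bounded_set[where A="{-r..r}" and B=D])
  show "AE x in lborel. x \<in> {- r..r} \<longrightarrow> norm (f x) \<le> D" using assms(2) by simp
  show "AE x in lborel. x \<notin> {-r..r} \<longrightarrow> f x = 0" using assms(3) by (auto simp: abs_le_iff not_le)
qed (auto simp: emeasure_lborel_Icc_eq ennreal_less_top)

lemma tent_integrable: "integrable lborel (tent x n)"
  by (rule integrable_bounded_support[where D=1 and r="\<bar>x\<bar> + 1"]) (auto simp: tent_bounds tent_support)

lemma tent_sq_int: "sq_int (tent x n)"
  unfolding sq_int_def
  by (auto intro!: integrable_bounded_support[where D=1 and r="\<bar>x\<bar> + 1"] simp: tent_support power_le_one tent_bounds)

lemma tent_integral_pos: "0 < (LINT y|lborel. tent x n y)"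
proof -
  have "emeasure lborel {y. tent x n y \<noteq> 0} \<noteq> 0"
  proof -
    have "{x <..< x + 1 / real (Suc n)} \<subseteq> {y. tent x n y \<noteq> 0}"
      by (auto simp: tent_def field_simps)
    then have "emeasure lborel {x <..< x + 1 / real (Suc n)} \<le> emeasure lborel {y. tent x n y \<noteq> 0}"
      by (intro emeasure_mono) auto
    moreover have "emeasure lborel {x <..< x + 1 / real (Suc n)} > 0" by simp
    ultimately show ?thesis by auto
  qed
  then have "(LINT y|lborel. tent x n y) \<noteq> 0"
    by (subst integral_nonneg_eq_0_iff_AE) (auto simp: tent_integrable tent_bounds AE_iff_measurable[OF _ refl])
  moreover have "0 \<le> (LINT y|lborel. tent x n y)"
    by (intro integral_nonneg_AE) (simp add: tent_bounds)
  ultimately show ?thesis by linarith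
qed

text \<open>A continuous kernel is determined on the diagonal by its quadratic form on bumps. On the
  support of a narrow product bump the kernel is within e / 2 of P x x, and the squared integral
  normalises.\<close>

lemma tent_average_tendsto:
  fixes P :: "real \<Rightarrow> real \<Rightarrow> real"
  assumes cont: "continuous_on UNIV (\<lambda>(x, y). P x y)"
  shows "(\<lambda>n. (LINT y|lborel. LINT z|lborel. P y z * tent x n y * tent x n z) / (LINT y|lborel. tent x n y)\<^sup>2)
    \<longlonglongrightarrow> P x x"
proof (rule LIMSEQ_I)
  fix e :: real assume e: "0 < e"
  have [measurable]: "case_prod P \<in> borel_measurable (borel \<Otimes>\<^sub>M borel)"
    unfolding borel_prod using cont by (intro borel_measurable_continuous_onI) simp
  have "isCont (\<lambda>(x, y). P x y) (x, x)" using cont by (simp add: continuous_on_eq_continuous_at)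
  then obtain \<delta> where \<delta>: "0 < \<delta>" "\<And>q. dist q (x, x) < \<delta> \<Longrightarrow> dist (case q of (y, z) \<Rightarrow> P y z) (P x x) < e / 2"
    using e unfolding continuous_at_eps_delta by (metis (no_types, lifting) case_prod_conv half_gt_zero)
  obtain N where N: "1 / real (Suc N) < \<delta> / 2"
    using \<delta>(1) reals_Archimedean[of "\<delta> / 2"] by (auto simp: inverse_eq_divide)
  show "\<exists>N. \<forall>n\<ge>N. norm ((LINT y|lborel. LINT z|lborel. P y z * tent x n y * tent x n z) /
      (LINT y|lborel. tent x n y)\<^sup>2 - P x x) < e"
  proof (intro exI[of _ N] allI impI)
    fix n assume n: "N \<le> n"
    define I where "I = (LINT y|lborel. tent x n y)"
    have I: "0 < I" by (simp add: I_def tent_integral_pos)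
    have close: "\<bar>P y z - P x x\<bar> \<le> e / 2" if "tent x n y \<noteq> 0" "tent x n z \<noteq> 0" for y z
    proof -
      have "1 / real (Suc n) \<le> 1 / real (Suc N)" using n by (simp add: frac_le)
      moreover have "\<bar>y - x\<bar> < 1 / real (Suc n)" "\<bar>z - x\<bar> < 1 / real (Suc n)"
        using that tent_zero by (meson not_le)+
      ultimately have "\<bar>y - x\<bar> < \<delta> / 2" "\<bar>z - x\<bar> < \<delta> / 2" using N by linarith+
      moreover have "dist (y, z) (x, x) \<le> \<bar>y - x\<bar> + \<bar>z - x\<bar>"
        unfolding dist_prod_def by (simp add: dist_real_def sqrt_sum_squares_le_sum_abs)
      ultimately have "dist (y, z) (x, x) < \<delta>" by linarith
      then show ?thesis using \<delta>(2)[of "(y, z)"] by (simp add: dist_real_def)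
    qed
    have bd: "\<bar>(P y z - P x x) * tent x n y * tent x n z\<bar> \<le> e / 2 * tent x n y * tent x n z" for y z
    proof (cases "tent x n y = 0 \<or> tent x n z = 0")
      case False
      then have "\<bar>P y z - P x x\<bar> * (tent x n y * tent x n z) \<le> e / 2 * (tent x n y * tent x n z)"
        by (intro mult_right_mono close) (auto simp: tent_bounds)
      then show ?thesis by (simp add: abs_mult tent_bounds mult.assoc)
    qed auto
    have int1: "integrable lborel (\<lambda>z. (P y z - P x x) * tent x n y * tent x n z)" for y
      by (rule Bochner_Integration.integrable_bound[where f="\<lambda>z. e / 2 * tent x n y * tent x n z"])
        (use bd tent_integrable order_trans[OF bd abs_ge_self] in \<open>auto\<close>)
    have int1': "integrable lborel (\<lambda>z. P x x * tent x n y * tent x n z)" for y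
      using tent_integrable by simp
    have split: "(LINT z|lborel. P y z * tent x n y * tent x n z)
        = (LINT z|lborel. (P y z - P x x) * tent x n y * tent x n z) + P x x * tent x n y * I" for y
    proof -
      have "(LINT z|lborel. P y z * tent x n y * tent x n z) = (LINT z|lborel. (P y z - P x x) * tent x n y * tent x n z + P x x * tent x n y * tent x n z)"
        by (simp add: algebra_simps)
      also have "\<dots> = (LINT z|lborel. (P y z - P x x) * tent x n y * tent x n z) + (LINT z|lborel. P x x * tent x n y * tent x n z)"
        by (rule Bochner_Integration.integral_add[OF int1 int1'])
      finally show ?thesis by (simp add: I_def)
    qed
    have bd1: "\<bar>LINT z|lborel. (P y z - P x x) * tent x n y * tent x n z\<bar> \<le> e / 2 * tent x n y * I" for y
    proof -
      have "\<bar>LINT z|lborel. (P y z - P x x) * tent x n y * tent x n z\<bar> \<le> (LINT z|lborel. \<bar>(P y z - P x x) * tent x n y * tent x n z\<bar>)"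
        by (rule integral_abs_bound)
      also have "\<dots> \<le> (LINT z|lborel. e / 2 * tent x n y * tent x n z)"
        by (rule integral_mono[OF integrable_abs[OF int1]]) (use tent_integrable bd in auto)
      finally show ?thesis by (simp add: I_def)
    qed
    have int2: "integrable lborel (\<lambda>y. LINT z|lborel. (P y z - P x x) * tent x n y * tent x n z)"
    proof (rule Bochner_Integration.integrable_bound[where f="\<lambda>y. e / 2 * tent x n y * I"])
      show "AE y in lborel. norm (LINT z|lborel. (P y z - P x x) * tent x n y * tent x n z) \<le> norm (e / 2 * tent x n y * I)"
        using order_trans[OF bd1 abs_ge_self] by simp
    qed (use tent_integrable in auto)
    have "(LINT y|lborel. LINT z|lborel. P y z * tent x n y * tent x n z)
        = (LINT y|lborel. LINT z|lborel. (P y z - P x x) * tent x n y * tent x n z) + P x x * I * I"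
      unfolding split by (subst Bochner_Integration.integral_add[OF int2]) (auto simp: I_def tent_integrable)
    moreover have "\<bar>LINT y|lborel. LINT z|lborel. (P y z - P x x) * tent x n y * tent x n z\<bar> \<le> e / 2 * I * I"
    proof -
      have "\<bar>LINT y|lborel. LINT z|lborel. (P y z - P x x) * tent x n y * tent x n z\<bar> \<le> (LINT y|lborel. \<bar>LINT z|lborel. (P y z - P x x) * tent x n y * tent x n z\<bar>)"
        by (rule integral_abs_bound)
      also have "\<dots> \<le> (LINT y|lborel. e / 2 * tent x n y * I)"
        by (rule integral_mono[OF integrable_abs[OF int2]]) (use tent_integrable bd1 in auto)
      finally show ?thesis by (simp add: I_def)
    qed
    ultimately have "\<bar>(LINT y|lborel. LINT z|lborel. P y z * tent x n y * tent x n z) / I\<^sup>2 - P x x\<bar> \<le> e / 2"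
      using I by (simp add: power2_eq_square add_divide_distrib abs_divide divide_le_eq)
    then show "norm ((LINT y|lborel. LINT z|lborel. P y z * tent x n y * tent x n z) /
      (LINT y|lborel. tent x n y)\<^sup>2 - P x x) < e"
      using e by (simp add: I_def)
  qed
qed

lemma continuous_compact_support_facts:
  fixes f :: "real \<Rightarrow> real"
  assumes "continuous_on UNIV f" "\<And>x. \<bar>x\<bar> > r \<Longrightarrow> f x = 0"
  shows "integrable lborel f" "sq_int f"
proof -
  have [measurable]: "f \<in> borel_measurable borel"
    using assms(1) by (rule borel_measurable_continuous_onI)
  have "compact (f ` {-r..r})"
    by (intro compact_continuous_image continuous_on_subset[OF assms(1)]) auto
  then obtain b where b: "\<And>x. x \<in> {-r..r} \<Longrightarrow> \<bar>f x\<bar> \<le> b"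
    using compact_imp_bounded by (fastforce simp: bounded_iff)
  have bd: "\<bar>f x\<bar> \<le> \<bar>b\<bar>" for x
  proof (cases "\<bar>x\<bar> > r")
    case False
    then have "\<bar>f x\<bar> \<le> b" by (intro b) (auto simp: abs_le_iff not_less)
    then show ?thesis by linarith
  qed (simp add: assms(2))
  show "integrable lborel f"
    by (rule integrable_bounded_support[where D="\<bar>b\<bar>" and r=r]) (auto simp: bd assms(2))
  have "(f x)\<^sup>2 \<le> b\<^sup>2" for x using bd[of x] by (simp add: abs_le_square_iff[symmetric])
  then show "sq_int f"
    unfolding sq_int_def
    by (auto intro!: integrable_bounded_support[where D="b\<^sup>2" and r=r] simp: assms(2))
qed

text \<open>K is the kernel that occurs in the definition of the spectral objects, k its multiple to
  which the contraction results apply. A spectral variable s of K corresponds to \<kappa> s for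
  k.\<close>

locale scaled_kernel = contraction_kernel k for k +
  fixes K :: "real \<Rightarrow> real \<Rightarrow> real" and \<kappa> :: real
  assumes scale: "k x y = \<kappa> * K x y" and \<kappa>_pos: "0 < \<kappa>"
    and k_cont: "isCont (\<lambda>x. k x y) x"
begin

lemma V_continuous: "((\<lambda>z. ip (V z - V x) (V z - V x)) \<longlongrightarrow> 0) (at x)"
  unfolding V_def by (rule exp_family_continuous[where D="1/4"]) (use k_abs k_cont in auto)

text \<open>Lebesgue measure has full support, so every row is orthogonal to the kernel of T. The
  required inequality reads: the square of T is at most T.\<close>

lemma V_null: "(\<lambda>n. mom (V x) 0 n) \<longlonglongrightarrow> 0"
proof (rule mom_null_on_support[where m=lborel, OF V_continuous])
  fix f
  have "(\<integral>\<^sup>+ y. ennreal ((ip f (V y))\<^sup>2) \<partial>lborel) = ennreal (ip (T f) (T f))"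
    by (simp add: ip_V ip_self nn_integral_eq_integral fn_sq_integrable)
  also have "ip (T f) (T f) = mom f 2 0"
    by (simp add: mom_def T_sym numeral_2_eq_2)
  also have "\<dots> \<le> mom f 1 0"
    using mom_decreasing(2)[of f 1 0] by (simp add: numeral_2_eq_2)
  also have "mom f 1 0 = ip (T f) f" by (simp add: mom_def)
  finally show "(\<integral>\<^sup>+ y. ennreal ((ip f (V y))\<^sup>2) \<partial>lborel) \<le> ennreal (ip (T f) f)"
    using ennreal_leI by auto
qed (auto simp: ball_eq_greaterThanLessThan)

lemma kop_K: "kop K f = (\<lambda>x. (1 / \<kappa>) * kop k f x)"
proof
  fix x
  have "kop k f x = \<kappa> * kop K f x"
    unfolding kop_def by (simp add: scale mult.assoc)
  then show "kop K f x = (1 / \<kappa>) * kop k f x" using \<kappa>_pos by simp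
qed

lemma kop_cmult: "kop k (\<lambda>x. b * f x) = (\<lambda>x. b * kop k f x)"
  by (simp add: kop_def mult.left_commute)

lemma kop_K_pow: "(kop K ^^ n) (fn F) = (\<lambda>x. (1 / \<kappa>) ^ n * fn ((T ^^ n) F) x)"
  by (induction n) (simp_all add: kop_K kop_cmult fn_T mult.assoc)

lemma spec_meas_iff:
  "spec_meas K (fn F) \<mu> \<longleftrightarrow> finite_measure \<mu> \<and> sets \<mu> = sets borel \<and>
     (\<forall>n. integrable \<mu> (\<lambda>s. (\<kappa> * s) ^ n) \<and> (LINT s|\<mu>. (\<kappa> * s) ^ n) = ip ((T ^^ n) F) F)"
proof -
  have 1: "l2_inner ((kop K ^^ n) (fn F)) (fn F) = ip ((T ^^ n) F) F / \<kappa> ^ n" for n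
    by (simp add: kop_K_pow l2_inner_def ip_def mult.assoc power_one_over)
  show ?thesis
    unfolding spec_meas_def 1 using \<kappa>_pos by (simp add: power_mult_distrib field_simps)
qed

lemma spec_meas_exists: "\<exists>\<mu>. spec_meas K (fn F) \<mu>"
proof -
  obtain \<nu> where fin: "finite_measure \<nu>" and [measurable_cong]: "sets \<nu> = sets borel" and
    AE: "AE s in \<nu>. 0 \<le> s \<and> s \<le> 1" and m: "\<And>k. (LINT s|\<nu>. s ^ k) = ip ((T ^^ k) F) F"
    and int: "\<And>k. integrable \<nu> (\<lambda>s. s ^ k)"
    using spectral_measure[of F] by blast
  interpret finite_measure \<nu> by fact
  have "spec_meas K (fn F) (distr \<nu> borel (\<lambda>s. s / \<kappa>))"
    unfolding spec_meas_iff using \<kappa>_pos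
    by (auto intro!: finite_measure_distr simp: integral_distr integrable_distr_eq int m)
  then show ?thesis by blast
qed

text \<open>The very measure that \<open>specproj_form\<close> selects, so that results about its
  moments apply to the projections in the statement.\<close>

definition spm :: "l2 \<Rightarrow> real measure" where
  "spm F = (SOME \<mu>. spec_meas K (fn F) \<mu>)"

lemma spm:
  shows finite_spm: "finite_measure (spm F)" and sets_spm [measurable_cong]: "sets (spm F) = sets borel"
    and spm_integrable: "integrable (spm F) (\<lambda>s. (\<kappa> * s) ^ n)"
    and spm_moment: "(LINT s|spm F. (\<kappa> * s) ^ n) = ip ((T ^^ n) F) F"
proof -
  have "spec_meas K (fn F) (spm F)"
    unfolding spm_def by (rule someI_ex[OF spec_meas_exists])
  then show "finite_measure (spm F)" "sets (spm F) = sets borel" "integrable (spm F) (\<lambda>s. (\<kappa> * s) ^ n)"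
    "(LINT s|spm F. (\<kappa> * s) ^ n) = ip ((T ^^ n) F) F"
    by (simp_all add: spec_meas_iff)
qed

lemma spm_AE: "AE s in spm F. 0 \<le> \<kappa> * s \<and> \<kappa> * s \<le> 1"
  by (rule moments_AE_unit_interval[OF spm_integrable spm_moment finite_spm]) measurable

lemma pform_spm: "pform b m F F = (\<Sum>i\<le>m. b i * (LINT s|spm F. (\<kappa> * s) ^ i))"
  by (simp add: pform_def spm_moment)

text \<open>The polynomials p_n approximate the truncated inverse square in the variable \<kappa> s.
  The kernel of the projection onto the ray from \<epsilon> is built as the limit of
  \<open><p_n(T) T_x, T_y>\<close>.\<close>

context
  fixes a :: "nat \<Rightarrow> nat \<Rightarrow> real" and d :: "nat \<Rightarrow> nat" and D \<epsilon> :: real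
  assumes \<epsilon>: "0 < \<epsilon>"
    and approx_bound: "\<And>n s. s \<in> {0..1} \<Longrightarrow> \<bar>\<Sum>i\<le>d n. a n i * s ^ i\<bar> \<le> D"
    and approx_lim: "\<And>s. s \<in> {0..1} \<Longrightarrow> (\<lambda>n. \<Sum>i\<le>d n. a n i * s ^ i) \<longlonglongrightarrow> inv_sq (\<kappa> * \<epsilon>) s"
begin

lemma pform_diag_tendsto:
  "(\<lambda>n. pform (a n) (d n) F F) \<longlonglongrightarrow> (LINT s|spm F. inv_sq (\<kappa> * \<epsilon>) (\<kappa> * s))"
proof -
  have "(\<lambda>n. \<Sum>i\<le>d n. a n i * (LINT s|spm F. (\<kappa> * s) ^ (i + 0))) \<longlonglongrightarrow>
      (LINT s|spm F. inv_sq (\<kappa> * \<epsilon>) (\<kappa> * s) * (\<kappa> * s) ^ 0)"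
    by (rule integral_polynomial_sequence_tendsto(1)[OF finite_spm _ spm_AE approx_bound approx_lim]) auto
  then show ?thesis by (simp add: pform_spm)
qed

lemma pform_polarise:
  "pform b m F G = (pform b m (F + G) (F + G) - pform b m (F - G) (F - G)) / 4"
proof -
  have 1: "pform b m H (F + G) = pform b m H F + pform b m H G"
    "pform b m H (F - G) = pform b m H F - pform b m H G" for H
    using pform_sym[of b m H] by (simp_all add: pform_add pform_diff)
  show ?thesis
    using pform_sym[of b m G F] by (simp add: pform_add pform_diff 1)
qed

definition plim :: "l2 \<Rightarrow> l2 \<Rightarrow> real" where
  "plim F G = lim (\<lambda>n. pform (a n) (d n) F G)"

lemma plim: "(\<lambda>n. pform (a n) (d n) F G) \<longlonglongrightarrow> plim F G"
proof -
  have "convergent (\<lambda>n. pform (a n) (d n) F G)"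
    unfolding pform_polarise[of _ _ F G]
    by (rule convergentI, rule tendsto_divide, rule tendsto_diff, (rule pform_diag_tendsto)+, rule tendsto_const) simp
  then show ?thesis by (simp add: plim_def convergent_LIMSEQ_iff)
qed

lemma plim_diag: "plim F F = (LINT s|spm F. inv_sq (\<kappa> * \<epsilon>) (\<kappa> * s))"
  by (rule LIMSEQ_unique[OF plim pform_diag_tendsto])

lemma plim_sym: "plim F G = plim G F"
  by (simp only: plim_def pform_sym[of _ _ F G])

lemma plim_diff: "plim (F - F') G = plim F G - plim F' G"
  by (rule LIMSEQ_unique[OF plim]) (simp only: pform_diff, intro tendsto_diff plim)

lemma plim_bound: "\<bar>plim F G\<bar> \<le> D * sqrt (ip F F) * sqrt (ip G G)"
  by (rule LIMSEQ_le_const2[OF tendsto_rabs[OF plim]]) (use pform_bound[OF approx_bound] in blast)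

lemma D_nonneg: "0 \<le> D"
  by (rule order_trans[OF abs_ge_zero approx_bound[of 0 0]]) simp

lemma sqrt_V: "sqrt (ip (V x) (V x)) \<le> 1 / 2"
  using real_sqrt_le_mono[OF V_norm[of x]] by (simp add: real_sqrt_divide)

lemma plim_V_bound: "\<bar>plim (V x) (V y)\<bar> \<le> D / 4" "\<bar>pform (a n) (d n) (V x) (V y)\<bar> \<le> D / 4"
proof -
  have "D * sqrt (ip (V x) (V x)) * sqrt (ip (V y) (V y)) \<le> D * (1 / 2) * (1 / 2)"
    by (intro mult_mono sqrt_V) (auto simp: D_nonneg ip_pos)
  then show "\<bar>plim (V x) (V y)\<bar> \<le> D / 4" "\<bar>pform (a n) (d n) (V x) (V y)\<bar> \<le> D / 4"
    using plim_bound[of "V x" "V y"] pform_bound[OF approx_bound, of n "V x" "V y"] by simp_all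
qed

text \<open>The limit form is bounded by D, the rows have norm at most 1/2 and depend continuously
  on their index in mean square, so moving one index at a time gives joint continuity.\<close>

lemma plim_continuous: "continuous_on UNIV (\<lambda>(x, y). plim (V x) (V y))"
proof (rule continuous_at_imp_continuous_on, rule ballI)
  fix p :: "real \<times> real"
  obtain x y where p: "p = (x, y)" by (cases p)
  define N where "N z0 z = sqrt (ip (V z - V z0) (V z - V z0))" for z0 z
  have N: "(N z0 \<longlongrightarrow> 0) (nhds z0)" for z0
  proof -
    have "(N z0 \<longlongrightarrow> sqrt 0) (at z0)"
      unfolding N_def by (intro tendsto_intros V_continuous)
    then have "(N z0 \<longlongrightarrow> N z0 z0) (at z0)" by (simp add: N_def ip_zero)
    then have "(N z0 \<longlongrightarrow> N z0 z0) (nhds z0)" by (simp only: tendsto_at_iff_tendsto_nhds)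
    then show ?thesis by (simp add: N_def ip_zero)
  qed
  have id: "((\<lambda>q. q) \<longlongrightarrow> (x, y)) (nhds (x, y))" by (rule filterlim_ident)
  have "((\<lambda>q. N x (fst q)) \<longlongrightarrow> 0) (nhds (x, y))" "((\<lambda>q. N y (snd q)) \<longlongrightarrow> 0) (nhds (x, y))"
    using filterlim_compose[OF N tendsto_fst[OF id, simplified]] filterlim_compose[OF N tendsto_snd[OF id, simplified]]
    by simp_all
  then have lim0: "((\<lambda>q. D * N x (fst q) + D * N y (snd q)) \<longlongrightarrow> D * 0 + D * 0) (nhds (x, y))"
    by (intro tendsto_intros)
  have "((\<lambda>q. (case q of (x, y) \<Rightarrow> plim (V x) (V y)) - plim (V x) (V y)) \<longlongrightarrow> 0) (nhds (x, y))"
  proof (rule Lim_null_comparison)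
    show "((\<lambda>q. D * N x (fst q) + D * N y (snd q)) \<longlongrightarrow> 0) (nhds (x, y))" using lim0 by simp
    show "\<forall>\<^sub>F q in nhds (x, y). norm ((case q of (x, y) \<Rightarrow> plim (V x) (V y)) - plim (V x) (V y))
        \<le> D * N x (fst q) + D * N y (snd q)"
    proof (rule always_eventually, rule allI)
      fix q :: "real \<times> real"
      obtain x' y' where q: "q = (x', y')" by (cases q)
      have "plim (V x') (V y') - plim (V x) (V y) = plim (V x' - V x) (V y') + plim (V y' - V y) (V x)"
        using plim_sym[of "V x" "V y"] plim_sym[of "V x" "V y'"] by (simp add: plim_diff)
      moreover have "\<bar>plim (V x' - V x) (V y')\<bar> \<le> D * N x x' * 1"
        unfolding N_def
        by (rule order_trans[OF plim_bound], intro mult_left_mono order_trans[OF sqrt_V]) (auto simp: D_nonneg ip_pos)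
      moreover have "\<bar>plim (V y' - V y) (V x)\<bar> \<le> D * N y y' * 1"
        unfolding N_def
        by (rule order_trans[OF plim_bound], intro mult_left_mono order_trans[OF sqrt_V]) (auto simp: D_nonneg ip_pos)
      ultimately show "norm ((case q of (x, y) \<Rightarrow> plim (V x) (V y)) - plim (V x) (V y))
        \<le> D * N x (fst q) + D * N y (snd q)" unfolding q by simp
    qed
  qed
  then have "((\<lambda>q. case q of (x, y) \<Rightarrow> plim (V x) (V y)) \<longlongrightarrow> (case (x, y) of (x, y) \<Rightarrow> plim (V x) (V y))) (nhds (x, y))"
    by (simp add: LIM_zero_iff)
  then show "isCont (\<lambda>(x, y). plim (V x) (V y)) p"
    unfolding p isCont_def tendsto_at_iff_tendsto_nhds .
qed

text \<open>Pairing with a row evaluates T f at a point, so the two rows contribute one factor T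
  each; this is the shift from i to i + 2.\<close>

lemma pform_V_integral:
  "(LINT y|lborel. pform (a n) (d n) (V x) (V y) * fn F x * fn F y)
    = (\<Sum>i\<le>d n. a n i * (fn ((T ^^ (i + 2)) F) x * fn F x))"
proof -
  have eq: "ip ((T ^^ (i + 1)) (V x)) F = fn ((T ^^ (i + 2)) F) x" for i
    by (simp only: Tn_sym) (simp add: fn_T_eq_ip)
  have "pform (a n) (d n) (V x) (V y) * fn F x * fn F y
      = (\<Sum>i\<le>d n. a n i * fn F x * (fn ((T ^^ (i + 1)) (V x)) y * fn F y))" for y
    by (simp add: pform_def ip_V sum_distrib_right mult.assoc mult.left_commute)
  then have "(LINT y|lborel. pform (a n) (d n) (V x) (V y) * fn F x * fn F y)
    = (\<Sum>i\<le>d n. a n i * fn F x * ip ((T ^^ (i + 1)) (V x)) F)"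
    by (simp add: ip_integrable ip_def l2_inner_def)
  then show ?thesis unfolding eq by (simp add: ac_simps)
qed

lemma plim_quadratic_form:
  assumes f: "continuous_on UNIV f" "\<And>x. \<bar>x\<bar> > r \<Longrightarrow> f x = 0"
  shows "(LINT x|lborel. LINT y|lborel. plim (V x) (V y) * f x * f y) = specproj_form K {\<epsilon>..} f"
proof -
  define F where "F = mkl2 f"
  note ff = continuous_compact_support_facts[OF f]
  have fnF: "fn F = f" unfolding F_def by (rule fn_mkl2[OF ff(2)])
  have [measurable]: "f \<in> borel_measurable borel" by (rule sq_int_measurable[OF ff(2)])
  have [measurable]: "(\<lambda>(x, y). plim (V x) (V y)) \<in> borel_measurable (borel \<Otimes>\<^sub>M borel)"
    unfolding borel_prod by (rule borel_measurable_continuous_onI[OF plim_continuous])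
  let ?\<Phi> = "\<lambda>n x. \<Sum>i\<le>d n. a n i * (fn ((T ^^ (i + 2)) F) x * f x)"
  let ?J = "LINT y|lborel. \<bar>f y\<bar>"
  note \<Phi>_eq = pform_V_integral[of _ _ F, unfolded fnF]
  have bd: "\<bar>pform (a n) (d n) (V x) (V y) * f x * f y\<bar> \<le> D / 4 * \<bar>f x\<bar> * \<bar>f y\<bar>" for n x y
    unfolding abs_mult by (intro mult_right_mono plim_V_bound) auto
  have meas_y: "(\<lambda>y. pform (a n) (d n) (V x) (V y) * f x * f y) \<in> borel_measurable lborel" for n x
    unfolding pform_def ip_V by measurable
  have \<Phi>_lim: "(\<lambda>n. ?\<Phi> n x) \<longlonglongrightarrow> (LINT y|lborel. plim (V x) (V y) * f x * f y)" for x
    unfolding \<Phi>_eq[symmetric]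
  proof (rule integral_dominated_convergence[where w="\<lambda>y. D / 4 * \<bar>f x\<bar> * \<bar>f y\<bar>"])
    show "AE y in lborel. (\<lambda>n. pform (a n) (d n) (V x) (V y) * f x * f y) \<longlonglongrightarrow> plim (V x) (V y) * f x * f y"
      by (intro AE_I2 tendsto_intros plim)
    show "integrable lborel (\<lambda>y. D / 4 * \<bar>f x\<bar> * \<bar>f y\<bar>)" using ff(1) by auto
    show "AE y in lborel. norm (pform (a n) (d n) (V x) (V y) * f x * f y) \<le> D / 4 * \<bar>f x\<bar> * \<bar>f y\<bar>" for n
      using bd by simp
    show "(\<lambda>y. pform (a n) (d n) (V x) (V y) * f x * f y) \<in> borel_measurable lborel" for n
      by (rule meas_y)
  qed measurable
  have \<Phi>_bd: "\<bar>?\<Phi> n x\<bar> \<le> D / 4 * ?J * \<bar>f x\<bar>" for n x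
  proof -
    have "\<bar>LINT y|lborel. pform (a n) (d n) (V x) (V y) * f x * f y\<bar> \<le> (LINT y|lborel. D / 4 * \<bar>f x\<bar> * \<bar>f y\<bar>)"
    proof (rule order_trans[OF integral_abs_bound], rule integral_mono)
      show int: "integrable lborel (\<lambda>y. D / 4 * \<bar>f x\<bar> * \<bar>f y\<bar>)" using ff(1) by auto
      show "integrable lborel (\<lambda>y. \<bar>pform (a n) (d n) (V x) (V y) * f x * f y\<bar>)"
        by (rule integrable_abs, rule Bochner_Integration.integrable_bound[OF int meas_y])
          (use order_trans[OF bd abs_ge_self] in simp)
    qed (rule bd)
    then show ?thesis unfolding \<Phi>_eq by (simp add: ac_simps)
  qed
  have lim1: "(\<lambda>n. LINT x|lborel. ?\<Phi> n x) \<longlonglongrightarrow> (LINT x|lborel. LINT y|lborel. plim (V x) (V y) * f x * f y)"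
  proof (rule integral_dominated_convergence[where w="\<lambda>x. D / 4 * ?J * \<bar>f x\<bar>"])
    show "AE x in lborel. (\<lambda>n. ?\<Phi> n x) \<longlonglongrightarrow> (LINT y|lborel. plim (V x) (V y) * f x * f y)"
      by (intro AE_I2 \<Phi>_lim)
    show "integrable lborel (\<lambda>x. D / 4 * ?J * \<bar>f x\<bar>)" using ff(1) by auto
    show "AE x in lborel. norm (?\<Phi> n x) \<le> D / 4 * ?J * \<bar>f x\<bar>" for n
      using \<Phi>_bd by simp
  qed measurable
  have eq: "(LINT x|lborel. ?\<Phi> n x) = (\<Sum>i\<le>d n. a n i * (LINT s|spm F. (\<kappa> * s) ^ (i + 2)))" for n
    unfolding fnF[symmetric] spm_moment
    by (subst Bochner_Integration.integral_sum) (simp_all only: ip_integrable integrable_mult_right integral_mult_right_zero ip_def l2_inner_def)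
  have lim2: "(\<lambda>n. \<Sum>i\<le>d n. a n i * (LINT s|spm F. (\<kappa> * s) ^ (i + 2))) \<longlonglongrightarrow>
      (LINT s|spm F. inv_sq (\<kappa> * \<epsilon>) (\<kappa> * s) * (\<kappa> * s) ^ 2)"
    by (rule integral_polynomial_sequence_tendsto(1)[OF finite_spm _ spm_AE approx_bound approx_lim]) auto
  \<comment> \<open>The factor s^2 supplied by the two rows cancels the inverse square, leaving
    exactly the indicator of the ray.\<close>
  have "(LINT s|spm F. inv_sq (\<kappa> * \<epsilon>) (\<kappa> * s) * (\<kappa> * s) ^ 2) = measure (spm F) {\<epsilon>..}"
  proof -
    have "inv_sq (\<kappa> * \<epsilon>) (\<kappa> * s) * (\<kappa> * s) ^ 2 = indicat_real {\<epsilon>..} s" for s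
      using \<kappa>_pos \<epsilon> by (cases "\<epsilon> \<le> s") (simp_all add: inv_sq_eq inv_sq_less)
    then show ?thesis by (simp add: sets_eq_imp_space_eq[OF sets_spm])
  qed
  then have "(LINT x|lborel. LINT y|lborel. plim (V x) (V y) * f x * f y) = measure (spm F) {\<epsilon>..}"
    using LIMSEQ_unique[OF lim1[unfolded eq] lim2] by (rule trans[rotated])
  then show ?thesis by (simp add: specproj_form_def spm_def fnF)
qed

text \<open>\<open>plim\<close> satisfies the condition in the definition of
  \<open>spec_kernel\<close>, hence the selected kernel does too. Two such kernels have the same
  quadratic form on bumps and so agree on the diagonal, which is all that \<open>ids\<close>
  reads.\<close>

lemma spec_kernel_diag: "spec_kernel K {\<epsilon>..} x x = plim (V x) (V x)"
proof -
  define good where "good P \<longleftrightarrow> continuous_on UNIV (\<lambda>(x, y). P x y) \<and> (\<forall>x y. P x y = P y x) \<and>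
      (\<forall>f. continuous_on UNIV f \<and> (\<exists>R. \<forall>x. \<bar>x\<bar> > R \<longrightarrow> f x = 0) \<longrightarrow>
         (LINT x|lborel. LINT y|lborel. P x y * f x * f y) = specproj_form K {\<epsilon>..} f)" for P :: "real \<Rightarrow> real \<Rightarrow> real"
  have g: "good (\<lambda>x y. plim (V x) (V y))"
    unfolding good_def
  proof (intro conjI allI impI)
    show "plim (V x) (V y) = plim (V y) (V x)" for x y by (rule plim_sym)
    fix f :: "real \<Rightarrow> real"
    assume f: "continuous_on UNIV f \<and> (\<exists>R. \<forall>x. \<bar>x\<bar> > R \<longrightarrow> f x = 0)"
    then obtain r where "\<forall>x. \<bar>x\<bar> > r \<longrightarrow> f x = 0" by blast
    then show "(LINT x|lborel. LINT y|lborel. plim (V x) (V y) * f x * f y) = specproj_form K {\<epsilon>..} f"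
      using f plim_quadratic_form[of f r] by blast
  qed (rule plim_continuous)
  have spec: "good (spec_kernel K {\<epsilon>..})"
    using someI[of good, OF g] unfolding spec_kernel_def good_def .
  have test: "(LINT y|lborel. LINT z|lborel. P y z * tent x n y * tent x n z) = specproj_form K {\<epsilon>..} (tent x n)"
    if "good P" for P n
    using that tent_continuous[of x n] tent_support[of x _ n] unfolding good_def by blast
  have "(\<lambda>n. specproj_form K {\<epsilon>..} (tent x n) / (LINT y|lborel. tent x n y)\<^sup>2) \<longlonglongrightarrow> P x x" if "good P" for P
    using tent_average_tendsto[of P x] that unfolding test[OF that] by (simp add: good_def)
  from LIMSEQ_unique[OF this[OF spec] this[OF g]] show ?thesis .
qed

lemma spec_kernel_tendsto:
  "(\<lambda>n. \<Sum>i\<le>d n. a n i * ip ((T ^^ i) (V x)) (V x)) \<longlonglongrightarrow> spec_kernel K {\<epsilon>..} x x"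
  using plim[of "V x" "V x"] by (simp add: spec_kernel_diag pform_def)

lemma spec_kernel_integral:
  "ennreal (spec_kernel K {\<epsilon>..} x x) = (\<integral>\<^sup>+ s. ennreal (inv_sq (\<kappa> * \<epsilon>) (\<kappa> * s)) \<partial>spm (V x))"
proof -
  have "integrable (spm (V x)) (\<lambda>s. inv_sq (\<kappa> * \<epsilon>) (\<kappa> * s) * (\<kappa> * s) ^ 0)"
    by (rule integral_polynomial_sequence_tendsto(2)[OF finite_spm _ spm_AE approx_bound approx_lim]) auto
  then show ?thesis
    by (simp add: spec_kernel_diag plim_diag nn_integral_eq_integral inv_sq_nonneg)
qed

end

lemma spec_kernel_integral':
  assumes "0 < \<epsilon>"
  shows "ennreal (spec_kernel K {\<epsilon>..} x x) = (\<integral>\<^sup>+ s. ennreal (inv_sq (\<kappa> * \<epsilon>) (\<kappa> * s)) \<partial>spm (V x))"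
proof -
  obtain a d D where "\<And>n s. s \<in> {0..1} \<Longrightarrow> \<bar>\<Sum>i\<le>d n. a n i * s ^ i\<bar> \<le> D"
    "\<And>s. s \<in> {0..1} \<Longrightarrow> (\<lambda>n. \<Sum>i\<le>d n. a n i * s ^ i) \<longlonglongrightarrow> inv_sq (\<kappa> * \<epsilon>) s"
    using polynomial_sequence_inv_sq[of "\<kappa> * \<epsilon>"] \<kappa>_pos assms by (auto simp: Ball_def)
  then show ?thesis using spec_kernel_integral[OF assms] by blast
qed

lemma spec_kernel_antimono:
  assumes "0 < \<epsilon>" "\<epsilon> \<le> \<epsilon>'"
  shows "ennreal (spec_kernel K {\<epsilon>'..} x x) \<le> ennreal (spec_kernel K {\<epsilon>..} x x)"
proof -
  have "inv_sq (\<kappa> * \<epsilon>') t \<le> inv_sq (\<kappa> * \<epsilon>) t" for t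
    using assms \<kappa>_pos by (intro inv_sq_antimono mult_left_mono) auto
  then show ?thesis
    using assms by (simp add: spec_kernel_integral') (intro nn_integral_mono ennreal_leI)
qed

text \<open>As the threshold falls to 0 the truncated inverse squares increase to 1/s^2 wherever s >
  0, and \<open>V_null\<close> ensures that the spectral measure of a row has no mass at 0.\<close>

lemma SUP_spec_kernel:
  "(SUP m. ennreal (spec_kernel K {1 / real (Suc m)..} x x)) = (\<Sum>n. ennreal (real (Suc n) * mom (V x) 0 n))"
proof -
  let ?f = "\<lambda>m s. ennreal (inv_sq (\<kappa> * (1 / real (Suc m))) (\<kappa> * s))"
  have inc: "incseq ?f"
  proof (intro incseq_SucI le_funI ennreal_leI)
    fix m s
    show "inv_sq (\<kappa> * (1 / real (Suc m))) (\<kappa> * s) \<le> inv_sq (\<kappa> * (1 / real (Suc (Suc m)))) (\<kappa> * s)"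
      using \<kappa>_pos by (intro inv_sq_antimono mult_left_mono) (auto simp: frac_le)
  qed
  have "(SUP m. ennreal (spec_kernel K {1 / real (Suc m)..} x x)) = (SUP m. \<integral>\<^sup>+ s. ?f m s \<partial>spm (V x))"
    by (intro SUP_cong refl spec_kernel_integral') simp
  also have "\<dots> = (\<integral>\<^sup>+ s. (SUP m. ?f m s) \<partial>spm (V x))"
    by (rule nn_integral_monotone_convergence_SUP[OF inc, symmetric]) measurable
  also have "\<dots> = (\<integral>\<^sup>+ s. ennreal (1 / (\<kappa> * s)\<^sup>2) \<partial>spm (V x))"
  proof (rule nn_integral_cong_AE)
    have "AE s in spm (V x). 0 < \<kappa> * s \<and> \<kappa> * s \<le> 1"
      by (rule AE_pos_of_mom_null[OF spm_integrable spm_moment finite_spm _ V_null]) measurable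
    then show "AE s in spm (V x). (SUP m. ?f m s) = ennreal (1 / (\<kappa> * s)\<^sup>2)"
    proof eventually_elim
      case (elim s)
      then have s: "0 < s" using \<kappa>_pos by (simp add: zero_less_mult_iff)
      obtain N where N: "1 / real (Suc N) < s"
        using s reals_Archimedean[of s] by (auto simp: inverse_eq_divide)
      show ?case
      proof (rule antisym)
        show "(SUP m. ?f m s) \<le> ennreal (1 / (\<kappa> * s)\<^sup>2)"
          by (intro SUP_least ennreal_leI inv_sq_le)
        have "\<kappa> * (1 / real (Suc N)) \<le> \<kappa> * s" using N \<kappa>_pos by (intro mult_left_mono) auto
        then have eq: "?f N s = ennreal (1 / (\<kappa> * s)\<^sup>2)" by (simp only: inv_sq_eq)
        have "?f N s \<le> (SUP m. ?f m s)" by (rule SUP_upper) simp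
        then show "ennreal (1 / (\<kappa> * s)\<^sup>2) \<le> (SUP m. ?f m s)" unfolding eq .
      qed
    qed
  qed
  also have "\<dots> = (\<Sum>n. ennreal (real (Suc n) * mom (V x) 0 n))"
    by (rule suminf_mom_inv_sq(1)[OF spm_integrable spm_moment finite_spm _ V_null, symmetric]) measurable
  finally show ?thesis .
qed

end

section \<open>Positive Hankel operators\<close>

lemma hbeta_pos: "0 < hbeta z"
  by (simp add: hbeta_def)

lemma hbeta_measurable [measurable]: "hbeta \<in> borel_measurable borel"
  unfolding hbeta_def[abs_def] by measurable

lemma hbeta_isCont: "isCont hbeta z"
  unfolding hbeta_def[abs_def] by (intro continuous_intros) simp

lemma hbeta_le: "hbeta z \<le> exp (- (\<bar>z\<bar> / 2))"
proof (cases "0 \<le> z")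
  case True
  have "z \<le> exp z" using exp_ge_add_one_self[of z] by linarith
  then show ?thesis using True by (simp add: hbeta_def mult_exp_exp)
next
  case False
  then show ?thesis by (simp add: hbeta_def mult_exp_exp)
qed

lemma hbeta_mult:
  "hbeta (x - \<xi>) * hbeta (y - \<xi>) = exp ((x + y) / 2) * (exp (- (exp x + exp y) * exp (- \<xi>)) * exp (- \<xi>))"
proof -
  have "(exp x + exp y) * exp (- \<xi>) = exp (x - \<xi>) + exp (y - \<xi>)"
    by (simp add: distrib_right mult_exp_exp)
  then have "exp (- (exp x + exp y) * exp (- \<xi>)) = exp (- (exp (x - \<xi>) + exp (y - \<xi>)))"
    by (simp only: mult_minus_left)
  then show ?thesis
    unfolding hbeta_def by (simp add: mult_exp_exp field_simps)
qed

definition W :: "real \<Rightarrow> l2" where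
  "W \<xi> = mkl2 (\<lambda>x. hbeta (x - \<xi>))"

lemma hbeta_bound: "\<bar>hbeta (x - \<xi>)\<bar> \<le> 1 * exp (- (\<bar>\<xi> - x\<bar> / 2))"
  using hbeta_le[of "x - \<xi>"] hbeta_pos[of "x - \<xi>"] by (simp add: abs_minus_commute)

lemma fn_W: "fn (W \<xi>) = (\<lambda>x. hbeta (x - \<xi>))"
  unfolding W_def by (rule fn_mkl2, rule sq_int_exp_bound(1)[OF _ hbeta_bound]) measurable

lemma W_continuous: "((\<lambda>z. ip (W z - W \<xi>) (W z - W \<xi>)) \<longlongrightarrow> 0) (at \<xi>)"
  unfolding W_def
proof (rule exp_family_continuous[OF _ hbeta_bound])
  show "isCont (\<lambda>\<xi>. hbeta (y - \<xi>)) \<xi>" for y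
    by (intro isCont_o2[OF _ hbeta_isCont] continuous_intros)
qed measurable

text \<open>The transforms \<open>\<xi> \<mapsto> ip u (W \<xi>)\<close> are \<open>\<surd>s\<close> times the Laplace transform at \<open>s = exp (- \<xi>)\<close>;
  step functions give the differences of exponentials.\<close>

lemma laplace_step:
  assumes "0 < p" "p \<le> q"
  shows "\<exists>u. \<forall>\<xi>. ip u (W \<xi>) = (exp (- p * exp (- \<xi>)) - exp (- q * exp (- \<xi>))) * exp (\<xi> / 2)"
proof -
  define f where "f x = indicat_real {ln p..ln q} x * exp (x / 2)" for x
  have [measurable]: "f \<in> borel_measurable borel" unfolding f_def by measurable
  have "(\<integral>\<^sup>+ x. ennreal (norm ((f x)\<^sup>2)) \<partial>lborel) \<le> (\<integral>\<^sup>+ x. ennreal (exp (ln q)) * indicator {ln p..ln q} x \<partial>lborel)"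
    by (intro nn_integral_mono) (auto simp: f_def indicator_def exp_double[symmetric] intro!: ennreal_leI)
  also have "\<dots> < \<infinity>"
    by (simp add: nn_integral_cmult_indicator ennreal_mult_less_top emeasure_lborel_Icc_eq)
  finally have "sq_int f" unfolding sq_int_def by (auto intro!: integrableI_bounded)
  then have fn_u: "fn (mkl2 f) = f" by (rule fn_mkl2)
  have "ip (mkl2 f) (W \<xi>) = (exp (- p * exp (- \<xi>)) - exp (- q * exp (- \<xi>))) * exp (\<xi> / 2)" for \<xi>
  proof -
    define s where "s = exp (- \<xi>)"
    have s: "0 < s" by (simp add: s_def)
    define F where "F x = - exp (- s * exp x) / s * exp (- (\<xi> / 2))" for x
    have "f x * hbeta (x - \<xi>) = (exp (- s * exp x) * exp x * exp (- (\<xi> / 2))) * indicator {ln p..ln q} x" for x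
    proof -
      have "exp (x - \<xi>) = s * exp x" by (simp add: s_def mult_exp_exp)
      then have "exp (x / 2) * hbeta (x - \<xi>) = exp (- s * exp x) * (exp (x / 2) * exp ((x - \<xi>) / 2))"
        by (simp add: hbeta_def)
      also have "exp (x / 2) * exp ((x - \<xi>) / 2) = exp x * exp (- (\<xi> / 2))"
        by (simp add: mult_exp_exp field_simps)
      finally show ?thesis by (simp add: f_def indicator_def)
    qed
    then have "ip (mkl2 f) (W \<xi>) = (LINT x|lborel. (exp (- s * exp x) * exp x * exp (- (\<xi> / 2))) * indicator {ln p..ln q} x)"
      by (simp add: ip_def l2_inner_def fn_u fn_W)
    also have "\<dots> = F (ln q) - F (ln p)"
    proof (rule integral_FTC_Icc_real)
      show "ln p \<le> ln q" using assms by simp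
      show "DERIV F x :> exp (- s * exp x) * exp x * exp (- (\<xi> / 2))" for x
        unfolding F_def using s by (auto intro!: derivative_eq_intros)
      show "isCont (\<lambda>x. exp (- s * exp x) * exp x * exp (- (\<xi> / 2))) x" for x
        by (intro continuous_intros)
    qed
    also have "\<dots> = (exp (- s * p) - exp (- s * q)) * (exp (- (\<xi> / 2)) / s)"
      using assms s by (simp add: F_def diff_divide_distrib left_diff_distrib)
    also have "exp (- (\<xi> / 2)) / s = exp (\<xi> / 2)"
      by (simp add: s_def exp_minus[symmetric] field_simps mult_exp_exp)
    finally show ?thesis by (simp add: s_def mult.commute)
  qed
  then show ?thesis by blast
qed

text \<open>Generated by differences of exponentials because these are transforms of step functions
  on bounded intervals; a single exponential would require a step without right end, which is not
  square integrable. Closure under differences is enough to reach the powers of z - z^2.\<close>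

inductive laplace_span :: "(real \<Rightarrow> real) \<Rightarrow> bool" where
  step: "0 < p \<Longrightarrow> p \<le> q \<Longrightarrow> laplace_span (\<lambda>s. exp (- p * s) - exp (- q * s))"
| diff: "laplace_span F \<Longrightarrow> laplace_span G \<Longrightarrow> laplace_span (\<lambda>s. F s - G s)"

lemma laplace_span_shift:
  assumes "laplace_span F" "0 \<le> a"
  shows "laplace_span (\<lambda>s. exp (- a * s) * F s)"
  using assms(1)
proof induction
  case (step p q)
  have "(\<lambda>s. exp (- a * s) * (exp (- p * s) - exp (- q * s))) = (\<lambda>s. exp (- (a + p) * s) - exp (- (a + q) * s))"
    by (simp add: right_diff_distrib mult_exp_exp algebra_simps)
  then show ?case
    using laplace_span.step[of "a + p" "a + q"] step assms(2) by simp
next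
  case (diff F G)
  then show ?case using laplace_span.diff by (simp add: right_diff_distrib)
qed

lemma laplace_span_power:
  assumes "0 < a"
  shows "laplace_span (\<lambda>s. (exp (- a * s) - exp (- (2 * a) * s)) ^ Suc m)"
proof (induction m)
  case 0
  then show ?case using laplace_span.step[of a "2 * a"] assms by simp
next
  case (Suc m)
  have "laplace_span (\<lambda>s. exp (- a * s) * (exp (- a * s) - exp (- (2 * a) * s)) ^ Suc m
      - exp (- (2 * a) * s) * (exp (- a * s) - exp (- (2 * a) * s)) ^ Suc m)"
    using assms by (intro laplace_span.diff laplace_span_shift Suc) auto
  then show ?case by (simp add: left_diff_distrib)
qed

lemma laplace_span_transform:
  assumes "laplace_span F"
  shows "\<exists>u. \<forall>\<xi>. ip u (W \<xi>) = F (exp (- \<xi>)) * exp (\<xi> / 2)"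
  using assms
proof induction
  case (step p q)
  then show ?case by (rule laplace_step)
next
  case (diff F G)
  then obtain u v where "\<And>\<xi>. ip u (W \<xi>) = F (exp (- \<xi>)) * exp (\<xi> / 2)" "\<And>\<xi>. ip v (W \<xi>) = G (exp (- \<xi>)) * exp (\<xi> / 2)"
    by metis
  moreover have "ip (u - v) (W \<xi>) = ip u (W \<xi>) - ip v (W \<xi>)" for \<xi>
    using l2_ip_simps(1)[of "u - v" v "W \<xi>"] by simp
  ultimately show ?case by (intro exI[of _ "u - v"]) (simp add: left_diff_distrib)
qed

text \<open>With \<open>z = exp (- a * s)\<close> the function \<open>4 * z * (1 - z)\<close> has its strict maximum \<open>1\<close> at \<open>s = ln 2 / a\<close>,
  so its powers converge to the indicator function of that point.\<close>

lemma peak_transforms: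
  "\<exists>u q g. (\<forall>m \<xi>. ip (u m) (W \<xi>) = q \<xi> * g \<xi> ^ Suc m) \<and> q \<xi>\<^sub>0 = 1 \<and> g \<xi>\<^sub>0 = 1 \<and>
    (\<forall>\<xi>. 0 \<le> g \<xi> \<and> g \<xi> \<le> 1) \<and> (\<forall>\<xi>. \<xi> \<noteq> \<xi>\<^sub>0 \<longrightarrow> g \<xi> < 1)"
proof -
  define s0 where "s0 = exp (- \<xi>\<^sub>0)"
  define a where "a = ln 2 / s0"
  have a: "0 < a" by (simp add: a_def s0_def)
  define z where "z \<xi> = exp (- a * exp (- \<xi>))" for \<xi>
  define g where "g \<xi> = 4 * (z \<xi> * (1 - z \<xi>))" for \<xi>
  define q where "q \<xi> = exp ((\<xi> - \<xi>\<^sub>0) / 2)" for \<xi>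
  have "\<exists>u. \<forall>\<xi>. ip u (W \<xi>) = q \<xi> * g \<xi> ^ Suc m" for m
  proof -
    obtain u where u: "\<And>\<xi>. ip u (W \<xi>) = (exp (- a * exp (- \<xi>)) - exp (- (2 * a) * exp (- \<xi>))) ^ Suc m * exp (\<xi> / 2)"
      using laplace_span_transform[OF laplace_span_power[OF a, of m]] by blast
    have "exp (- a * exp (- \<xi>)) - exp (- (2 * a) * exp (- \<xi>)) = z \<xi> * (1 - z \<xi>)" for \<xi>
      by (simp add: z_def right_diff_distrib mult_exp_exp)
    then have "ip ((4 ^ Suc m * exp (- (\<xi>\<^sub>0 / 2))) *\<^sub>R u) (W \<xi>) = q \<xi> * g \<xi> ^ Suc m" for \<xi>
      by (simp only: l2_ip_simps(2) u g_def q_def power_mult_distrib diff_divide_distrib exp_diff)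
        (simp add: exp_minus field_simps)
    then show ?thesis by blast
  qed
  then obtain u where u: "\<And>m \<xi>. ip (u m) (W \<xi>) = q \<xi> * g \<xi> ^ Suc m" by metis
  have z0: "z \<xi>\<^sub>0 = 1 / 2"
    by (simp add: z_def a_def s0_def[symmetric]) (simp add: s0_def exp_minus)
  have z: "0 < z \<xi>" "z \<xi> < 1" for \<xi> using a by (auto simp: z_def)
  have gz: "g \<xi> = 1 - (2 * z \<xi> - 1)\<^sup>2" for \<xi>
    by (simp add: g_def power2_eq_square algebra_simps)
  have "g \<xi> < 1" if "\<xi> \<noteq> \<xi>\<^sub>0" for \<xi>
  proof -
    have "z \<xi> \<noteq> z \<xi>\<^sub>0" using that a by (simp add: z_def)
    then have "2 * z \<xi> - 1 \<noteq> 0" using z0 by simp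
    then show ?thesis by (simp add: gz)
  qed
  moreover have "g \<xi>\<^sub>0 = 1" by (simp add: g_def z0)
  moreover have "0 \<le> g \<xi> \<and> g \<xi> \<le> 1" for \<xi>
  proof
    show "0 \<le> g \<xi>" unfolding g_def using z[of \<xi>] by (intro mult_nonneg_nonneg) auto
    show "g \<xi> \<le> 1" by (simp add: gz)
  qed
  ultimately show ?thesis
    using u by (intro exI[of _ u] exI[of _ q] exI[of _ g]) (auto simp: q_def)
qed

text \<open>The bound 1 / (4 t) is the normalisation of \<open>contraction_kernel\<close>: exp x +
  exp y is at least exp (max x y), and exp ((x + y) / 2 - max x y) is exp (-
  \<open>\<bar>x - y\<bar>\<close> / 2).\<close>

locale hankel_measure =
  fixes h :: "real \<Rightarrow> real" and \<Sigma> :: "real measure"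
  assumes sets_\<Sigma> [measurable_cong]: "sets \<Sigma> = sets borel"
    and h_repr: "0 < t \<Longrightarrow> has_bochner_integral \<Sigma> (\<lambda>\<xi>. exp (- t * exp (- \<xi>)) * exp (- \<xi>)) (h t)"
    and h_bound: "0 < t \<Longrightarrow> \<bar>h t\<bar> \<le> 1 / (4 * t)"
    and h_psd: "sq_int f \<Longrightarrow> 0 \<le> l2_inner (kop (hankel_kernel h) f) f"
begin

lemma space_\<Sigma>: "space \<Sigma> = UNIV"
  using sets_eq_imp_space_eq[OF sets_\<Sigma>] by simp

lemma h_isCont:
  assumes t: "0 < t"
  shows "isCont h t"
  unfolding isCont_def tendsto_at_iff_sequentially
proof (intro allI impI)
  fix X :: "nat \<Rightarrow> real" assume X: "X \<longlonglongrightarrow> t"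
  \<comment> \<open>The sequence X may leave the positive half line. Y agrees with it eventually,
    and its lower bound t / 2 provides an integrable dominating function.\<close>
  define Y where "Y n = max (X n) (t / 2)" for n
  have "Y \<longlonglongrightarrow> max t (t / 2)" unfolding Y_def by (intro tendsto_intros X)
  then have Y: "Y \<longlonglongrightarrow> t" "\<And>n. 0 < Y n" "\<And>n. t / 2 \<le> Y n"
    using t by (auto simp: Y_def less_max_iff_disj)
  have int: "integrable \<Sigma> (\<lambda>\<xi>. exp (- t * exp (- \<xi>)) * exp (- \<xi>))"
    and eq: "(LINT \<xi>|\<Sigma>. exp (- t * exp (- \<xi>)) * exp (- \<xi>)) = h t" if "0 < t" for t
    using h_repr[OF that] by (auto simp: has_bochner_integral_iff)
  have "(\<lambda>n. LINT \<xi>|\<Sigma>. exp (- Y n * exp (- \<xi>)) * exp (- \<xi>)) \<longlonglongrightarrow> (LINT \<xi>|\<Sigma>. exp (- t * exp (- \<xi>)) * exp (- \<xi>))"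
  proof (rule integral_dominated_convergence[where w="\<lambda>\<xi>. exp (- (t / 2) * exp (- \<xi>)) * exp (- \<xi>)"])
    show "AE \<xi> in \<Sigma>. (\<lambda>n. exp (- Y n * exp (- \<xi>)) * exp (- \<xi>)) \<longlonglongrightarrow> exp (- t * exp (- \<xi>)) * exp (- \<xi>)"
      by (intro AE_I2 tendsto_intros Y)
    show "AE \<xi> in \<Sigma>. norm (exp (- Y n * exp (- \<xi>)) * exp (- \<xi>)) \<le> exp (- (t / 2) * exp (- \<xi>)) * exp (- \<xi>)" for n
      using Y(3)[of n] by (intro AE_I2) (simp add: abs_mult)
    show "integrable \<Sigma> (\<lambda>\<xi>. exp (- (t / 2) * exp (- \<xi>)) * exp (- \<xi>))"
      using t by (intro int) simp
  qed measurable
  then have "(\<lambda>n. h (Y n)) \<longlonglongrightarrow> h t"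
    unfolding eq[OF t] eq[OF Y(2)] .
  moreover have "\<forall>\<^sub>F n in sequentially. h (Y n) = (h \<circ> X) n"
    using order_tendstoD(1)[OF X, of "t / 2"] t by (auto elim!: eventually_mono simp: Y_def max_def)
  ultimately show "(h \<circ> X) \<longlonglongrightarrow> h t"
    by (rule Lim_transform_eventually)
qed

lemma kernel_repr: "has_bochner_integral \<Sigma> (\<lambda>\<xi>. hbeta (x - \<xi>) * hbeta (y - \<xi>)) (hankel_kernel h x y)"
  unfolding hbeta_mult hankel_kernel_def
  by (intro has_bochner_integral_mult_right h_repr add_pos_pos) auto

lemma kernel_continuous: "continuous_on UNIV (\<lambda>(x, y). hankel_kernel h x y)"
proof -
  have "continuous_on {0<..} h"
    by (intro continuous_at_imp_continuous_on ballI h_isCont) simp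
  then have "continuous_on UNIV (\<lambda>p :: real \<times> real. h (exp (fst p) + exp (snd p)))"
  proof (rule continuous_on_compose2)
    show "continuous_on UNIV (\<lambda>p :: real \<times> real. exp (fst p) + exp (snd p))"
      by (intro continuous_intros)
  qed (auto intro: add_pos_pos)
  then have "continuous_on UNIV (\<lambda>p :: real \<times> real. exp ((fst p + snd p) / 2) * h (exp (fst p) + exp (snd p)))"
    by (rule continuous_on_mult[rotated]) (intro continuous_intros, simp)
  then show ?thesis by (simp add: hankel_kernel_def case_prod_unfold)
qed

lemma kernel_bound: "hankel_kernel h x y \<le> 1 / 4 * exp (- (\<bar>x - y\<bar> / 2))"
proof -
  have pos: "0 < exp x + exp y" by (intro add_pos_pos) auto
  have "hankel_kernel h x y \<le> exp ((x + y) / 2) * (1 / (4 * (exp x + exp y)))"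
    unfolding hankel_kernel_def by (rule mult_left_mono[OF abs_le_D1[OF h_bound[OF pos]]]) simp
  also have "\<dots> \<le> exp ((x + y) / 2) * (1 / (4 * exp (max x y)))"
  proof (rule mult_left_mono[OF divide_left_mono])
    show "4 * exp (max x y) \<le> 4 * (exp x + exp y)"
      using exp_gt_zero[of x] exp_gt_zero[of y] by (cases "x \<le> y") (simp_all add: max_def)
    show "0 < 4 * (exp x + exp y) * (4 * exp (max x y))"
      by (intro mult_pos_pos pos) simp_all
  qed simp_all
  also have "\<dots> = 1 / 4 * (exp ((x + y) / 2) / exp (max x y))" by simp
  also have "exp ((x + y) / 2) / exp (max x y) = exp (- (\<bar>x - y\<bar> / 2))"
    unfolding exp_diff[symmetric] by (cases "x \<le> y") (simp_all add: max_def field_simps)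
  finally show ?thesis .
qed

lemma contraction_kernel_hankel: "contraction_kernel (hankel_kernel h)"
proof
  show "case_prod (hankel_kernel h) \<in> borel_measurable (borel \<Otimes>\<^sub>M borel)"
    unfolding borel_prod by (rule borel_measurable_continuous_onI[OF kernel_continuous])
  show "hankel_kernel h x y = hankel_kernel h y x" for x y
    by (simp add: hankel_kernel_def add.commute)
  show "0 \<le> hankel_kernel h x y" for x y
  proof -
    have "0 \<le> (LINT \<xi>|\<Sigma>. hbeta (x - \<xi>) * hbeta (y - \<xi>))"
      by (intro integral_nonneg_AE AE_I2 mult_nonneg_nonneg less_imp_le hbeta_pos)
    then show ?thesis using kernel_repr[of x y] by (simp add: has_bochner_integral_iff)
  qed
qed (use kernel_bound h_psd in auto)

sublocale contraction_kernel "hankel_kernel h"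
  by (rule contraction_kernel_hankel)

lemma kernel_isCont: "isCont (\<lambda>x. hankel_kernel h x y) x"
proof -
  have "continuous_on UNIV (\<lambda>x. (x, y))" by (intro continuous_intros)
  from continuous_on_compose2[OF kernel_continuous this]
  have "continuous_on UNIV (\<lambda>x. hankel_kernel h x y)" by simp
  then show ?thesis by (simp add: continuous_on_eq_continuous_at)
qed

lemma emeasure_Icc_finite: "emeasure \<Sigma> {a..b} < \<infinity>"
proof -
  \<comment> \<open>A lower bound on [a,b] for the integrand that represents h 1: the first factor
    is smallest at a, the second at b.\<close>
  define c where "c = exp (- exp (- a)) * exp (- b)"
  have le: "ennreal c * indicator {a..b} \<xi> \<le> ennreal (exp (- 1 * exp (- \<xi>)) * exp (- \<xi>))" for \<xi>
    unfolding c_def by (auto simp: indicator_def intro!: ennreal_leI mult_mono)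
  have "ennreal c * emeasure \<Sigma> {a..b} = (\<integral>\<^sup>+ \<xi>. ennreal c * indicator {a..b} \<xi> \<partial>\<Sigma>)"
    by (simp add: nn_integral_cmult_indicator)
  also have "\<dots> \<le> (\<integral>\<^sup>+ \<xi>. ennreal (exp (- 1 * exp (- \<xi>)) * exp (- \<xi>)) \<partial>\<Sigma>)"
    by (intro nn_integral_mono le)
  also have "\<dots> = ennreal (h 1)"
    using h_repr[of 1] by (subst nn_integral_eq_integral) (auto simp: has_bochner_integral_iff)
  finally have "ennreal c * emeasure \<Sigma> {a..b} < \<infinity>" by (simp add: le_less_trans)
  then show ?thesis by (auto simp: ennreal_mult_less_top c_def)
qed

lemma sigma_finite: "sigma_finite_measure \<Sigma>"
proof
  show "\<exists>A. countable A \<and> A \<subseteq> sets \<Sigma> \<and> \<Union> A = space \<Sigma> \<and> (\<forall>a\<in>A. emeasure \<Sigma> a \<noteq> \<infinity>)"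
  proof (intro exI[of _ "range (\<lambda>n::nat. {- real n..real n})"] conjI)
    show "\<Union> (range (\<lambda>n::nat. {- real n..real n})) = space \<Sigma>"
    proof -
      have "\<exists>n::nat. - real n \<le> x \<and> x \<le> real n" for x
        using real_arch_simple[of "\<bar>x\<bar>"] by (auto simp: abs_le_iff intro: minus_le_iff[THEN iffD1])
      then show ?thesis by (auto simp: space_\<Sigma>)
    qed
    show "\<forall>a\<in>range (\<lambda>n::nat. {- real n..real n}). emeasure \<Sigma> a \<noteq> \<infinity>"
      using emeasure_Icc_finite by (auto simp: less_top)
  qed auto
qed

lemma pair_sigma_finite_lborel: "pair_sigma_finite lborel \<Sigma>"
  by (intro pair_sigma_finite.intro sigma_finite lborel.sigma_finite_measure_axioms)

lemma ip_W_measurable [measurable]: "(\<lambda>\<xi>. ip f (W \<xi>)) \<in> borel_measurable borel"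
  unfolding ip_def l2_inner_def fn_W by measurable

text \<open>The factorisation T f = A (A^* f), where A^* f is the function \<xi> \<mapsto>
  \<open>ip f (W \<xi>)\<close> and A integrates translates of \<open>hbeta\<close> against
  \<Sigma>. The second estimate supplies the absolute integrability for the next application of
  Fubini.\<close>

lemma W_repr:
  shows "has_bochner_integral \<Sigma> (\<lambda>\<xi>. hbeta (x - \<xi>) * ip f (W \<xi>)) (fn (T f) x)"
    and "(LINT \<xi>|\<Sigma>. hbeta (x - \<xi>) * \<bar>ip f (W \<xi>)\<bar>) \<le> kop (hankel_kernel h) (\<lambda>y. \<bar>fn f y\<bar>) x"
proof -
  interpret P: pair_sigma_finite lborel \<Sigma> by (rule pair_sigma_finite_lborel)
  let ?g = "\<lambda>y \<xi>. fn f y * (hbeta (x - \<xi>) * hbeta (y - \<xi>))"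
  have inner: "integrable \<Sigma> (\<lambda>\<xi>. hbeta (x - \<xi>) * hbeta (y - \<xi>))"
    "(LINT \<xi>|\<Sigma>. hbeta (x - \<xi>) * hbeta (y - \<xi>)) = hankel_kernel h x y" for y
    using kernel_repr by (auto simp: has_bochner_integral_iff)
  have pair: "integrable (lborel \<Otimes>\<^sub>M \<Sigma>) (\<lambda>(y, \<xi>). ?g y \<xi>)"
  proof (rule P.Fubini_integrable)
    show "AE y in lborel. integrable \<Sigma> (\<lambda>\<xi>. case (y, \<xi>) of (y, \<xi>) \<Rightarrow> ?g y \<xi>)"
      using inner by simp
    have "norm (?g y \<xi>) = \<bar>fn f y\<bar> * (hbeta (x - \<xi>) * hbeta (y - \<xi>))" for y \<xi>
      using hbeta_pos by (simp add: abs_mult abs_of_pos)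
    then have "(\<lambda>y. LINT \<xi>|\<Sigma>. norm (case (y, \<xi>) of (y, \<xi>) \<Rightarrow> ?g y \<xi>)) = (\<lambda>y. hankel_kernel h x y * \<bar>fn f y\<bar>)"
      using inner by (simp add: mult.commute)
    then show "integrable lborel (\<lambda>y. LINT \<xi>|\<Sigma>. norm (case (y, \<xi>) of (y, \<xi>) \<Rightarrow> ?g y \<xi>))"
      using kop_integrable[OF sq_int_abs[OF sq_int_fn]] by simp
  qed measurable
  have eq: "(LINT y|lborel. ?g y \<xi>) = hbeta (x - \<xi>) * ip f (W \<xi>)" for \<xi>
  proof -
    have "(LINT y|lborel. ?g y \<xi>) = (LINT y|lborel. hbeta (x - \<xi>) * (fn f y * hbeta (y - \<xi>)))"
      by (intro Bochner_Integration.integral_cong) (auto simp: ac_simps)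
    then show ?thesis by (simp add: ip_def l2_inner_def fn_W)
  qed
  have int: "integrable \<Sigma> (\<lambda>\<xi>. hbeta (x - \<xi>) * ip f (W \<xi>))"
    using P.integrable_snd[OF pair] by (simp only: eq)
  moreover have "(LINT \<xi>|\<Sigma>. hbeta (x - \<xi>) * ip f (W \<xi>)) = fn (T f) x"
    using P.Fubini_integral[OF pair] inner by (simp only: eq) (simp add: fn_T kop_def mult.commute)
  ultimately show "has_bochner_integral \<Sigma> (\<lambda>\<xi>. hbeta (x - \<xi>) * ip f (W \<xi>)) (fn (T f) x)"
    by (simp add: has_bochner_integral_iff)
  have pair': "integrable (lborel \<Otimes>\<^sub>M \<Sigma>) (\<lambda>(y, \<xi>). norm (?g y \<xi>))"
    using integrable_norm[OF pair] by (simp add: case_prod_unfold)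
  have "(LINT \<xi>|\<Sigma>. hbeta (x - \<xi>) * \<bar>ip f (W \<xi>)\<bar>) \<le> (LINT \<xi>|\<Sigma>. LINT y|lborel. norm (?g y \<xi>))"
  proof (rule integral_mono)
    have "hbeta (x - \<xi>) * \<bar>ip f (W \<xi>)\<bar> = \<bar>hbeta (x - \<xi>) * ip f (W \<xi>)\<bar>" for \<xi>
      using hbeta_pos[of "x - \<xi>"] by (simp add: abs_mult)
    then show "integrable \<Sigma> (\<lambda>\<xi>. hbeta (x - \<xi>) * \<bar>ip f (W \<xi>)\<bar>)"
      "hbeta (x - \<xi>) * \<bar>ip f (W \<xi>)\<bar> \<le> (LINT y|lborel. norm (?g y \<xi>))" for \<xi>
      using int eq[symmetric] integral_norm_bound[of lborel "\<lambda>y. ?g y \<xi>"] by (auto simp only: real_norm_def intro!: integrable_abs)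
    show "integrable \<Sigma> (\<lambda>\<xi>. LINT y|lborel. norm (?g y \<xi>))"
      using P.integrable_snd[OF pair'] .
  qed
  also have "\<dots> = (LINT y|lborel. LINT \<xi>|\<Sigma>. norm (?g y \<xi>))"
    by (rule P.Fubini_integral[OF pair'])
  also have "\<dots> = kop (hankel_kernel h) (\<lambda>y. \<bar>fn f y\<bar>) x"
  proof -
    have "norm (?g y \<xi>) = \<bar>fn f y\<bar> * (hbeta (x - \<xi>) * hbeta (y - \<xi>))" for y \<xi>
      using hbeta_pos by (simp add: abs_mult abs_of_pos)
    then show ?thesis using inner by (simp add: kop_def mult.commute)
  qed
  finally show "(LINT \<xi>|\<Sigma>. hbeta (x - \<xi>) * \<bar>ip f (W \<xi>)\<bar>) \<le> kop (hankel_kernel h) (\<lambda>y. \<bar>fn f y\<bar>) x" .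
qed

text \<open>The form of T is the squared norm of A^* f in L^2(\<Sigma>). Questions about the form
  thereby become questions about functions of \<xi>.\<close>

lemma form_eq_integral: "has_bochner_integral \<Sigma> (\<lambda>\<xi>. (ip f (W \<xi>))\<^sup>2) (ip (T f) f)"
proof -
  interpret P: pair_sigma_finite lborel \<Sigma> by (rule pair_sigma_finite_lborel)
  let ?g = "\<lambda>x \<xi>. fn f x * (hbeta (x - \<xi>) * ip f (W \<xi>))"
  have inner: "integrable \<Sigma> (\<lambda>\<xi>. hbeta (x - \<xi>) * ip f (W \<xi>))"
    "(LINT \<xi>|\<Sigma>. hbeta (x - \<xi>) * ip f (W \<xi>)) = fn (T f) x" for x
    using W_repr(1)[of x f] by (auto simp: has_bochner_integral_iff)
  have pair: "integrable (lborel \<Otimes>\<^sub>M \<Sigma>) (\<lambda>(x, \<xi>). ?g x \<xi>)"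
  proof (rule P.Fubini_integrable)
    show "AE x in lborel. integrable \<Sigma> (\<lambda>\<xi>. case (x, \<xi>) of (x, \<xi>) \<Rightarrow> ?g x \<xi>)"
      using inner by simp
    have norm: "norm (?g x \<xi>) = \<bar>fn f x\<bar> * (hbeta (x - \<xi>) * \<bar>ip f (W \<xi>)\<bar>)" for x \<xi>
      using hbeta_pos[of "x - \<xi>"] by (simp add: abs_mult)
    show "integrable lborel (\<lambda>x. LINT \<xi>|\<Sigma>. norm (case (x, \<xi>) of (x, \<xi>) \<Rightarrow> ?g x \<xi>))"
    proof (rule Bochner_Integration.integrable_bound)
      show "integrable lborel (\<lambda>x. \<bar>fn f x\<bar> * kop (hankel_kernel h) (\<lambda>y. \<bar>fn f y\<bar>) x)"
        by (intro sq_int_mult sq_int_kop sq_int_abs sq_int_fn)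
      have "(LINT \<xi>|\<Sigma>. norm (?g x \<xi>)) \<le> \<bar>fn f x\<bar> * kop (hankel_kernel h) (\<lambda>y. \<bar>fn f y\<bar>) x" for x
        unfolding norm using W_repr(2)[of x f] by (simp add: mult_left_mono)
      moreover have "0 \<le> (LINT \<xi>|\<Sigma>. norm (?g x \<xi>))" for x
        by (rule integral_nonneg_AE) simp
      ultimately show "AE x in lborel. norm (LINT \<xi>|\<Sigma>. norm (case (x, \<xi>) of (x, \<xi>) \<Rightarrow> ?g x \<xi>))
          \<le> norm (\<bar>fn f x\<bar> * kop (hankel_kernel h) (\<lambda>y. \<bar>fn f y\<bar>) x)"
        using order_trans abs_ge_self by (intro AE_I2) (simp only: real_norm_def abs_of_nonneg case_prod_conv, blast)
      show "(\<lambda>x. LINT \<xi>|\<Sigma>. norm (case (x, \<xi>) of (x, \<xi>) \<Rightarrow> ?g x \<xi>)) \<in> borel_measurable lborel"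
        by (rule P.M2.borel_measurable_lebesgue_integral) measurable
    qed
  qed measurable
  have eq: "(LINT x|lborel. ?g x \<xi>) = (ip f (W \<xi>))\<^sup>2" for \<xi>
    by (simp add: ip_def l2_inner_def fn_W power2_eq_square mult.assoc[symmetric])
  have "integrable \<Sigma> (\<lambda>\<xi>. (ip f (W \<xi>))\<^sup>2)"
    using P.integrable_snd[OF pair] by (simp only: eq)
  moreover have "(LINT \<xi>|\<Sigma>. (ip f (W \<xi>))\<^sup>2) = ip (T f) f"
    using P.Fubini_integral[OF pair] inner by (simp only: eq) (simp add: ip_def l2_inner_def mult.commute)
  ultimately show ?thesis by (simp add: has_bochner_integral_iff)
qed

lemma form_eq_nn_integral: "(\<integral>\<^sup>+ \<xi>. ennreal ((ip f (W \<xi>))\<^sup>2) \<partial>\<Sigma>) = ennreal (ip (T f) f)"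
  using form_eq_integral[of f] by (subst nn_integral_eq_integral) (auto simp: has_bochner_integral_iff)

lemma W_null:
  assumes "\<xi> \<in> measure_support \<Sigma>"
  shows "(\<lambda>n. mom (W \<xi>) 0 n) \<longlonglongrightarrow> 0"
  by (rule mom_null_on_support[where m=\<Sigma>, OF W_continuous])
    (use assms form_eq_nn_integral in \<open>auto simp: measure_support_def sets_\<Sigma>\<close>)

lemma atom_finite: "emeasure \<Sigma> {\<xi>} < \<infinity>"
  using emeasure_Icc_finite[of \<xi> \<xi>] by simp

text \<open>Transforms with value 1 at \<xi> whose squared norm in L^2(\<Sigma>) shrinks to the mass
  of the atom. The squares decrease with m, so the square for m = 0 dominates. This is the form in
  which injectivity of A is used.\<close>

lemma peak_form_tendsto:
  "\<exists>u. (\<forall>m. ip (u m) (W \<xi>) = 1) \<and> (\<lambda>m. ip (T (u m)) (u m)) \<longlonglongrightarrow> measure \<Sigma> {\<xi>}"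
proof -
  obtain u q g where u: "\<And>m \<eta>. ip (u m) (W \<eta>) = q \<eta> * g \<eta> ^ Suc m" and q: "q \<xi> = 1" "g \<xi> = 1"
    and g: "\<And>\<eta>. 0 \<le> g \<eta>" "\<And>\<eta>. g \<eta> \<le> 1" "\<And>\<eta>. \<eta> \<noteq> \<xi> \<Longrightarrow> g \<eta> < 1"
    using peak_transforms[of \<xi>] by metis
  have eq: "(LINT \<eta>|\<Sigma>. (ip (u m) (W \<eta>))\<^sup>2) = ip (T (u m)) (u m)"
    and int: "integrable \<Sigma> (\<lambda>\<eta>. (ip (u m) (W \<eta>))\<^sup>2)" for m
    using form_eq_integral[of "u m"] by (auto simp: has_bochner_integral_iff)
  have "(\<lambda>m. LINT \<eta>|\<Sigma>. (ip (u m) (W \<eta>))\<^sup>2) \<longlonglongrightarrow> (LINT \<eta>|\<Sigma>. indicator {\<xi>} \<eta>)"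
  proof (rule integral_dominated_convergence[OF _ _ int[of 0]])
    show "AE \<eta> in \<Sigma>. (\<lambda>m. (ip (u m) (W \<eta>))\<^sup>2) \<longlonglongrightarrow> indicator {\<xi>} \<eta>"
    proof (rule AE_I2)
      fix \<eta>
      show "(\<lambda>m. (ip (u m) (W \<eta>))\<^sup>2) \<longlonglongrightarrow> indicator {\<xi>} \<eta>"
      proof (cases "\<eta> = \<xi>")
        case False
        have "(\<lambda>m. g \<eta> ^ Suc m) \<longlonglongrightarrow> 0"
          by (rule LIMSEQ_Suc[OF LIMSEQ_power_zero]) (use g[of \<eta>] False in simp)
        then have "(\<lambda>m. (q \<eta> * g \<eta> ^ Suc m)\<^sup>2) \<longlonglongrightarrow> (q \<eta> * 0)\<^sup>2"
          by (intro tendsto_intros)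
        then show ?thesis using False by (simp only: u) simp
      qed (simp add: u q)
    qed
    show "AE \<eta> in \<Sigma>. norm ((ip (u m) (W \<eta>))\<^sup>2) \<le> (ip (u 0) (W \<eta>))\<^sup>2" for m
    proof (rule AE_I2)
      fix \<eta>
      have "g \<eta> ^ Suc m \<le> g \<eta> ^ Suc 0" using g[of \<eta>] by (intro power_decreasing) auto
      then have "(g \<eta> ^ Suc m)\<^sup>2 \<le> (g \<eta> ^ Suc 0)\<^sup>2" using g[of \<eta>] by (intro power_mono) auto
      then show "norm ((ip (u m) (W \<eta>))\<^sup>2) \<le> (ip (u 0) (W \<eta>))\<^sup>2"
        unfolding u power_mult_distrib by (simp add: mult_left_mono)
    qed
  qed measurable
  also have "(LINT \<eta>|\<Sigma>. indicator {\<xi>} \<eta>) = measure \<Sigma> {\<xi>}" by (simp add: space_\<Sigma>)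
  finally show ?thesis unfolding eq using u q by (intro exI[of _ u]) simp
qed

text \<open>An atom of mass m alone contributes m times the squared value at \<xi> to the form,
  which bounds the series by 1 / m. Conversely, if the sum is A, the peak transforms give 1 \<le> A
  m in the limit; in particular the series diverges where there is no atom.\<close>

theorem suminf_mom_W:
  assumes supp: "\<xi> \<in> measure_support \<Sigma>"
  shows "(\<Sum>n. ennreal (mom (W \<xi>) 0 n)) = inverse (emeasure \<Sigma> {\<xi>})"
proof -
  define m where "m = measure \<Sigma> {\<xi>}"
  have m: "emeasure \<Sigma> {\<xi>} = ennreal m" "0 \<le> m"
    using atom_finite[of \<xi>] by (auto simp: m_def emeasure_eq_ennreal_measure less_top)
  let ?G = "\<Sum>n. ennreal (mom (W \<xi>) 0 n)"
  have "m * (ip v (W \<xi>))\<^sup>2 \<le> ip (T v) v" for v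
  proof -
    have "ennreal (m * (ip v (W \<xi>))\<^sup>2) = (\<integral>\<^sup>+ \<eta>. ennreal ((ip v (W \<eta>))\<^sup>2) * indicator {\<xi>} \<eta> \<partial>\<Sigma>)"
      using m by (subst nn_integral_indicator_singleton) (auto simp: ennreal_mult[symmetric] mult.commute)
    also have "\<dots> \<le> (\<integral>\<^sup>+ \<eta>. ennreal ((ip v (W \<eta>))\<^sup>2) \<partial>\<Sigma>)"
      by (intro nn_integral_mono) (auto simp: indicator_def)
    finally show ?thesis by (simp add: form_eq_nn_integral T_pos)
  qed
  from sum_mom_le[OF m(2) this] have le: "m * (\<Sum>i<n. mom (W \<xi>) 0 i) \<le> 1" for n .
  have partial: "?G \<le> ennreal c" if "\<And>n. (\<Sum>i<n. mom (W \<xi>) 0 i) \<le> c" for c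
  proof (rule suminf_le_const)
    fix n
    have "(\<Sum>i<n. ennreal (mom (W \<xi>) 0 i)) = ennreal (\<Sum>i<n. mom (W \<xi>) 0 i)"
      by (rule sum_ennreal) (rule mom_nonneg)
    also have "\<dots> \<le> ennreal c" by (intro ennreal_leI that)
    finally show "(\<Sum>i<n. ennreal (mom (W \<xi>) 0 i)) \<le> ennreal c" .
  qed simp
  have upper: "?G \<le> inverse (ennreal m)"
  proof (cases "m = 0")
    case False
    then have "?G \<le> ennreal (1 / m)"
      using le m(2) by (intro partial) (simp add: field_simps)
    then show ?thesis using False m(2) by (simp add: inverse_ennreal inverse_eq_divide)
  qed simp
  have lower: "inverse (ennreal m) \<le> ?G"
  proof (cases "?G = \<infinity>")
    case False
    then obtain A where A: "?G = ennreal A" "0 \<le> A" by (cases ?G) auto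
    have bd: "(\<Sum>i<n. mom (W \<xi>) 0 i) \<le> A" for n
    proof -
      have "ennreal (\<Sum>i<n. mom (W \<xi>) 0 i) = (\<Sum>i<n. ennreal (mom (W \<xi>) 0 i))"
        by (rule sum_ennreal[symmetric]) (rule mom_nonneg)
      also have "\<dots> \<le> ennreal A" unfolding A(1)[symmetric] by (intro sum_le_suminf) auto
      finally show ?thesis using A(2) by simp
    qed
    obtain u where u: "\<And>n. ip (u n) (W \<xi>) = 1" "(\<lambda>n. ip (T (u n)) (u n)) \<longlonglongrightarrow> m"
      using peak_form_tendsto[of \<xi>] by (auto simp: m_def)
    have "1 \<le> A * ip (T (u n)) (u n)" for n
      using ip_sq_le_sum_mom[OF W_null[OF supp] bd, of "u n"] u(1)[of n] by (simp add: ip_sym[of "W \<xi>"])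
    then have Am: "1 \<le> A * m"
      by (intro LIMSEQ_le_const[OF tendsto_mult_left[OF u(2)]]) auto
    then have "0 < m" using m(2) by (cases "m = 0") auto
    then show ?thesis
      unfolding A(1) using Am by (simp add: inverse_ennreal ennreal_leI field_simps)
  qed simp
  show ?thesis unfolding m(1) by (rule antisym[OF upper lower])
qed

end

section \<open>Counting the support\<close>

text \<open>The complement of the support is covered by countably many open intervals with rational
  ends and measure 0.\<close>

lemma AE_measure_support:
  assumes [measurable_cong]: "sets \<Sigma> = sets borel"
  shows "AE \<xi> in \<Sigma>. \<xi> \<in> measure_support \<Sigma>"
proof -
  define D where "D = {(a, b) \<in> \<rat> \<times> \<rat>. emeasure \<Sigma> {a<..<b} = 0}"
  have "countable D"
    by (rule countable_subset[of _ "\<rat> \<times> \<rat>"]) (auto simp: D_def countable_rat)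
  then have "(\<Union>(a, b)\<in>D. {a<..<b}) \<in> null_sets \<Sigma>"
    by (intro null_sets_UN') (auto simp: D_def null_sets_def)
  then show ?thesis
  proof (rule AE_I')
    show "{\<xi>\<in>space \<Sigma>. \<xi> \<notin> measure_support \<Sigma>} \<subseteq> (\<Union>(a, b)\<in>D. {a<..<b})"
    proof clarify
      fix x assume "x \<notin> measure_support \<Sigma>"
      then obtain e where e: "0 < e" "emeasure \<Sigma> (ball x e) = 0"
        by (auto simp: measure_support_def not_gr_zero)
      obtain a where a: "a \<in> \<rat>" "x - e < a" "a < x" using Rats_dense_in_real[of "x - e" x] e by auto
      obtain b where b: "b \<in> \<rat>" "x < b" "b < x + e" using Rats_dense_in_real[of x "x + e"] e by auto
      have "emeasure \<Sigma> {a<..<b} \<le> emeasure \<Sigma> (ball x e)"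
        using a b by (intro emeasure_mono) (auto simp: ball_eq_greaterThanLessThan)
      then have "(a, b) \<in> D" using a b e by (simp add: D_def)
      then show "x \<in> (\<Union>(a, b)\<in>D. {a<..<b})" using a b by (intro UN_I[of "(a, b)"]) auto
    qed
  qed
qed

context
  fixes \<Sigma> :: "real measure" and G :: "real \<Rightarrow> ennreal"
  assumes sets_\<Sigma> [measurable_cong]: "sets \<Sigma> = sets borel"
    and finite_Icc: "\<And>a b. emeasure \<Sigma> {a..b} < \<infinity>"
    and G_measurable [measurable]: "G \<in> borel_measurable borel"
    and G: "\<And>\<xi>. \<xi> \<in> measure_support \<Sigma> \<Longrightarrow> G \<xi> = inverse (emeasure \<Sigma> {\<xi>})"
begin

text \<open>Infinity times 0 is 0 for \<open>ennreal\<close>: a point without mass contributes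
  nothing although G is infinite there. The integral of G over a finite part of the support thus
  counts atoms.\<close>

lemma inverse_mult_atom: "inverse (emeasure \<Sigma> {\<xi>}) * emeasure \<Sigma> {\<xi>} = (if emeasure \<Sigma> {\<xi>} = 0 then 0 else 1)"
  using finite_Icc[of \<xi> \<xi>]
  by (cases "emeasure \<Sigma> {\<xi>}") (auto simp: inverse_ennreal ennreal_mult[symmetric] less_le)

lemma nn_integral_finite_support:
  assumes "finite F" "F \<subseteq> measure_support \<Sigma>"
  shows "(\<integral>\<^sup>+ \<xi>\<in>F. G \<xi> \<partial>\<Sigma>) = (\<Sum>\<xi>\<in>F. if emeasure \<Sigma> {\<xi>} = 0 then 0 else 1)"
proof -
  have "(\<integral>\<^sup>+ \<xi>\<in>F. G \<xi> \<partial>\<Sigma>) = (\<Sum>\<xi>\<in>F. G \<xi> * emeasure \<Sigma> {\<xi>})"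
    by (rule nn_integral_indicator_finite[OF assms(1)]) simp
  also have "\<dots> = (\<Sum>\<xi>\<in>F. if emeasure \<Sigma> {\<xi>} = 0 then 0 else 1)"
    using assms(2) by (intro sum.cong refl) (auto simp: G inverse_mult_atom subset_iff)
  finally show ?thesis .
qed

lemma nn_integral_restrict_support:
  "(\<integral>\<^sup>+ \<xi>\<in>I. G \<xi> \<partial>\<Sigma>) = (\<integral>\<^sup>+ \<xi>\<in>measure_support \<Sigma> \<inter> I. G \<xi> \<partial>\<Sigma>)"
  by (rule nn_integral_cong_AE, use AE_measure_support[OF sets_\<Sigma>] in eventually_elim) (auto simp: indicator_def)

lemma nn_integral_le_ecard: "(\<integral>\<^sup>+ \<xi>\<in>I. G \<xi> \<partial>\<Sigma>) \<le> ecard (measure_support \<Sigma> \<inter> I)"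
proof (cases "finite (measure_support \<Sigma> \<inter> I)")
  case True
  then have "(\<integral>\<^sup>+ \<xi>\<in>I. G \<xi> \<partial>\<Sigma>) = (\<Sum>\<xi>\<in>measure_support \<Sigma> \<inter> I. if emeasure \<Sigma> {\<xi>} = 0 then 0 else 1)"
    unfolding nn_integral_restrict_support[of I] by (intro nn_integral_finite_support) auto
  also have "\<dots> \<le> (\<Sum>\<xi>\<in>measure_support \<Sigma> \<inter> I. 1)"
    by (intro sum_mono) auto
  finally show ?thesis using True by (simp add: ecard_def)
qed (simp add: ecard_def)

lemma atom_in_support: "emeasure \<Sigma> {x} \<noteq> 0 \<Longrightarrow> x \<in> measure_support \<Sigma>"
proof -
  assume "emeasure \<Sigma> {x} \<noteq> 0"
  then have pos: "0 < emeasure \<Sigma> {x}" by (simp add: zero_less_iff_neq_zero)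
  have "emeasure \<Sigma> {x} \<le> emeasure \<Sigma> (ball x e)" if "0 < e" for e
    using that by (intro emeasure_mono) auto
  then show ?thesis
    unfolding measure_support_def using less_le_trans[OF pos] by blast
qed

text \<open>Finiteness leaves finitely many atoms in each cell and, as G is infinite at points of
  the support without mass, makes almost every point an atom. A locally finite set is closed, so the
  atoms are the whole support. All cells are involved because a neighbourhood of 0 meets the
  preceding one.\<close>

lemma nn_integral_eq_ecard:
  assumes \<tau>: "0 < \<tau>"
    and fin: "\<And>k::int. (\<integral>\<^sup>+ \<xi>\<in>{\<tau> * k..<\<tau> * (k + 1)}. G \<xi> \<partial>\<Sigma>) < \<infinity>"
  shows "(\<integral>\<^sup>+ \<xi>\<in>{0..<\<tau>}. G \<xi> \<partial>\<Sigma>) = ecard (measure_support \<Sigma> \<inter> {0..<\<tau>})"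
proof -
  define A where "A = {x. emeasure \<Sigma> {x} \<noteq> 0}"
  define I where "I k = {\<tau> * real_of_int k..<\<tau> * (real_of_int k + 1)}" for k
  have fin': "(\<integral>\<^sup>+ \<xi>\<in>I k. G \<xi> \<partial>\<Sigma>) < \<infinity>" for k
    using fin[of k] by (simp add: I_def)
  have I: "x \<in> I \<lfloor>x / \<tau>\<rfloor>" for x
  proof -
    have "real_of_int \<lfloor>x / \<tau>\<rfloor> \<le> x / \<tau>" "x / \<tau> < real_of_int \<lfloor>x / \<tau>\<rfloor> + 1"
      using floor_correct[of "x / \<tau>"] by simp_all
    then have "real_of_int \<lfloor>x / \<tau>\<rfloor> * \<tau> \<le> x" "x < (real_of_int \<lfloor>x / \<tau>\<rfloor> + 1) * \<tau>"
      unfolding pos_le_divide_eq[OF \<tau>] pos_divide_less_eq[OF \<tau>] .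
    then show ?thesis
      unfolding I_def by (simp only: atLeastLessThan_iff mult.commute[of \<tau>] simp_thms)
  qed
  have A_supp: "A \<subseteq> measure_support \<Sigma>" using atom_in_support by (auto simp: A_def)
  have finA: "finite (A \<inter> I k)" for k
  proof (rule ccontr)
    assume inf: "infinite (A \<inter> I k)"
    obtain c where c: "(\<integral>\<^sup>+ \<xi>\<in>I k. G \<xi> \<partial>\<Sigma>) = ennreal c" "0 \<le> c"
      using fin'[of k] by (cases "\<integral>\<^sup>+ \<xi>\<in>I k. G \<xi> \<partial>\<Sigma>") auto
    obtain n :: nat where n: "c < real n" using reals_Archimedean2 by blast
    obtain F where F: "finite F" "card F = n" "F \<subseteq> A \<inter> I k"
      using infinite_arbitrarily_large[OF inf] by blast
    have "ennreal (real n) = (\<Sum>\<xi>\<in>F. if emeasure \<Sigma> {\<xi>} = 0 then 0 else 1)"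
    proof -
      have "(\<Sum>\<xi>\<in>F. if emeasure \<Sigma> {\<xi>} = 0 then 0 else 1) = (\<Sum>\<xi>\<in>F. 1 :: ennreal)"
        using F(3) by (intro sum.cong) (auto simp: A_def)
      then show ?thesis using F(2) by (simp add: ennreal_of_nat_eq_real_of_nat)
    qed
    also have "\<dots> = (\<integral>\<^sup>+ \<xi>\<in>F. G \<xi> \<partial>\<Sigma>)"
      using F A_supp by (intro nn_integral_finite_support[symmetric]) auto
    also have "\<dots> \<le> (\<integral>\<^sup>+ \<xi>\<in>I k. G \<xi> \<partial>\<Sigma>)"
      using F(3) by (intro nn_integral_mono) (auto simp: indicator_def)
    finally show False using n c by simp
  qed
  have "AE \<xi> in \<Sigma>. \<forall>k. G \<xi> * indicator (I k) \<xi> \<noteq> \<infinity>"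
    unfolding AE_all_countable
  proof
    fix k
    have [measurable]: "I k \<in> sets borel" by (simp add: I_def)
    show "AE \<xi> in \<Sigma>. G \<xi> * indicator (I k) \<xi> \<noteq> \<infinity>"
      using fin'[of k] by (intro nn_integral_noteq_infinite) auto
  qed
  then have AE_A: "AE \<xi> in \<Sigma>. \<xi> \<in> A"
    using AE_measure_support[OF sets_\<Sigma>]
  proof eventually_elim
    case (elim \<xi>)
    then have "G \<xi> * indicator (I \<lfloor>\<xi> / \<tau>\<rfloor>) \<xi> \<noteq> \<infinity>" by blast
    then have "inverse (emeasure \<Sigma> {\<xi>}) \<noteq> \<infinity>" using I[of \<xi>] G[OF elim(2)] by simp
    then show ?case by (auto simp: A_def)
  qed
  have "measure_support \<Sigma> \<subseteq> A"
  proof (rule ccontr)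
    assume "\<not> ?thesis"
    then obtain x where x: "x \<in> measure_support \<Sigma>" "x \<notin> A" by blast
    have "A \<inter> {x - 1..x + 1} \<subseteq> (\<Union>k\<in>{\<lfloor>(x - 1) / \<tau>\<rfloor>..\<lfloor>(x + 1) / \<tau>\<rfloor>}. A \<inter> I k)"
    proof
      fix y assume y: "y \<in> A \<inter> {x - 1..x + 1}"
      then have "\<lfloor>y / \<tau>\<rfloor> \<in> {\<lfloor>(x - 1) / \<tau>\<rfloor>..\<lfloor>(x + 1) / \<tau>\<rfloor>}"
        using \<tau> by (auto intro!: floor_mono divide_right_mono)
      then show "y \<in> (\<Union>k\<in>{\<lfloor>(x - 1) / \<tau>\<rfloor>..\<lfloor>(x + 1) / \<tau>\<rfloor>}. A \<inter> I k)"
        using y I[of y] by blast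
    qed
    then have "finite (A \<inter> {x - 1..x + 1})"
      by (rule finite_subset) (intro finite_UN_I finA, simp)
    then obtain d where d: "0 < d" "\<And>y. y \<in> A \<inter> {x - 1..x + 1} \<Longrightarrow> y \<noteq> x \<Longrightarrow> d \<le> dist x y"
      using finite_set_avoid by metis
    \<comment> \<open>Only atoms within distance 1 of x were separated from x by d, hence the
      minimum with 1.\<close>
    have avoid: "y \<notin> ball x (min d 1)" if "y \<in> A" for y
    proof
      assume "y \<in> ball x (min d 1)"
      then have "dist x y < d" "dist x y < 1" by auto
      moreover have "y \<noteq> x" using that x(2) by auto
      ultimately show False using d(2)[of y] that by (auto simp: dist_real_def abs_less_iff)
    qed
    have "AE \<xi> in \<Sigma>. \<xi> \<notin> ball x (min d 1)"
      using AE_A by eventually_elim (use avoid in blast)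
    then have "emeasure \<Sigma> (ball x (min d 1)) = 0"
      by (subst (asm) AE_iff_measurable[of "ball x (min d 1)"])
        (auto simp: sets_eq_imp_space_eq[OF sets_\<Sigma>])
    moreover have "emeasure \<Sigma> (ball x (min d 1)) > 0"
      using x(1) d(1) by (auto simp: measure_support_def)
    ultimately show False by simp
  qed
  with A_supp have supp: "measure_support \<Sigma> = A" by blast
  have I0: "I 0 = {0..<\<tau>}" by (simp add: I_def)
  have fin0: "finite (A \<inter> {0..<\<tau>})" using finA[of 0] unfolding I0 .
  have "(\<integral>\<^sup>+ \<xi>\<in>{0..<\<tau>}. G \<xi> \<partial>\<Sigma>) = (\<Sum>\<xi>\<in>A \<inter> {0..<\<tau>}. if emeasure \<Sigma> {\<xi>} = 0 then 0 else 1)"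
    unfolding nn_integral_restrict_support[of "{0..<\<tau>}"] supp
    using fin0 A_supp by (intro nn_integral_finite_support) auto
  also have "\<dots> = (\<Sum>\<xi>\<in>A \<inter> {0..<\<tau>}. 1)"
    by (intro sum.cong) (auto simp: A_def)
  finally show ?thesis using fin0 by (simp add: supp ecard_def)
qed

end

section \<open>Recovering the measure from the kernel function\<close>

text \<open>The integrand that represents h 1, also the density of the standard Gumbel distribution.
  As a density it turns the possibly infinite measure \<Sigma> into a finite one of total mass h
  1.\<close>

definition gumbel_weight :: "real \<Rightarrow> real" where
  "gumbel_weight \<xi> = exp (- exp (- \<xi>)) * exp (- \<xi>)"

lemma gumbel_weight_pos: "0 < gumbel_weight \<xi>"
  by (simp add: gumbel_weight_def)

lemma gumbel_weight_measurable [measurable]: "gumbel_weight \<in> borel_measurable borel"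
  unfolding gumbel_weight_def[abs_def] by measurable

definition weighted :: "real measure \<Rightarrow> real measure" where
  "weighted \<Sigma> = density \<Sigma> (\<lambda>\<xi>. ennreal (gumbel_weight \<xi>))"

lemma sets_weighted [measurable_cong]: "sets (weighted \<Sigma>) = sets \<Sigma>"
  by (simp add: weighted_def)

lemma nn_integral_weighted:
  assumes [measurable_cong]: "sets \<Sigma> = sets borel" and [measurable]: "f \<in> borel_measurable borel"
  shows "(\<integral>\<^sup>+ \<xi>. f \<xi> \<partial>\<Sigma>) = (\<integral>\<^sup>+ \<xi>. f \<xi> * ennreal (1 / gumbel_weight \<xi>) \<partial>weighted \<Sigma>)"
proof -
  have "ennreal (gumbel_weight \<xi>) * (f \<xi> * ennreal (1 / gumbel_weight \<xi>)) = f \<xi>" for \<xi>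
  proof -
    have "ennreal (gumbel_weight \<xi>) * ennreal (1 / gumbel_weight \<xi>) = 1"
      using gumbel_weight_pos[of \<xi>] by (simp add: ennreal_mult[symmetric])
    then show ?thesis by (metis mult.left_commute mult.right_neutral)
  qed
  moreover have "(\<integral>\<^sup>+ \<xi>. f \<xi> * ennreal (1 / gumbel_weight \<xi>) \<partial>weighted \<Sigma>)
    = (\<integral>\<^sup>+ \<xi>. ennreal (gumbel_weight \<xi>) * (f \<xi> * ennreal (1 / gumbel_weight \<xi>)) \<partial>\<Sigma>)"
    unfolding weighted_def by (subst nn_integral_density) measurable
  ultimately show ?thesis by simp
qed

lemma weighted_inject:
  assumes "sets \<Sigma> = sets borel" "sets \<Sigma>' = sets borel" "weighted \<Sigma> = weighted \<Sigma>'"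
  shows "\<Sigma> = \<Sigma>'"
proof (rule measure_eqI)
  show "sets \<Sigma> = sets \<Sigma>'" using assms by simp
  fix A assume A: "A \<in> sets \<Sigma>"
  then have [measurable]: "A \<in> sets borel" using assms(1) by simp
  have "emeasure N A = (\<integral>\<^sup>+ \<xi>. indicator A \<xi> * ennreal (1 / gumbel_weight \<xi>) \<partial>weighted N)"
    if "sets N = sets borel" for N
    using nn_integral_weighted[OF that, of "indicator A"] that by simp
  from this[OF assms(1)] this[OF assms(2)] show "emeasure \<Sigma> A = emeasure \<Sigma>' A"
    using assms(3) by simp
qed

text \<open>Under \<open>\<xi> \<mapsto> exp (- exp (- \<xi>))\<close> the values \<open>h (1 + n)\<close> become the moments of a finite measure on \<open>[0, 1]\<close>.
  The coefficients turn them into the mass of a ray, uniformly in the measure; this yields both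
  uniqueness and measurable dependence on a parameter.\<close>

definition ray_coeff :: "(nat \<Rightarrow> nat \<Rightarrow> real) \<Rightarrow> (nat \<Rightarrow> nat) \<Rightarrow> real \<Rightarrow> bool" where
  "ray_coeff a d x \<longleftrightarrow> (\<forall>(M :: real measure) f. finite_measure M \<longrightarrow> f \<in> borel_measurable M \<longrightarrow>
     (AE s in M. 0 \<le> f s \<and> f s \<le> 1) \<longrightarrow>
     (\<lambda>n. \<Sum>i\<le>d n. a n i * (LINT s|M. f s ^ i)) \<longlonglongrightarrow> measure M {s\<in>space M. exp (- exp (- x)) \<le> f s})"

lemma ex_ray_coeff: "\<exists>a d. ray_coeff a d x"
  unfolding ray_coeff_def by (rule threshold_measure_limit)

context hankel_measure
begin

lemma emeasure_weighted: "emeasure (weighted \<Sigma>) UNIV = ennreal (h 1)"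
proof -
  have "emeasure (weighted \<Sigma>) UNIV = (\<integral>\<^sup>+ \<xi>. ennreal (exp (- 1 * exp (- \<xi>)) * exp (- \<xi>)) \<partial>\<Sigma>)"
    unfolding weighted_def by (subst emeasure_density) (auto simp: sets_\<Sigma> gumbel_weight_def)
  also have "\<dots> = ennreal (h 1)"
    using h_repr[of 1] by (subst nn_integral_eq_integral) (auto simp: has_bochner_integral_iff)
  finally show ?thesis .
qed

lemma space_weighted: "space (weighted \<Sigma>) = UNIV"
  by (simp add: weighted_def space_\<Sigma>)

lemma finite_weighted: "finite_measure (weighted \<Sigma>)"
  by (rule finite_measureI) (simp add: space_weighted emeasure_weighted)

lemma subprob_weighted: "subprob_space (weighted \<Sigma>)"
proof
  have "h 1 \<le> 1" using h_bound[of 1] by simp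
  then show "emeasure (weighted \<Sigma>) (space (weighted \<Sigma>)) \<le> 1"
    unfolding space_weighted emeasure_weighted by simp
qed (simp add: space_weighted)

lemma weighted_moment: "(LINT \<xi>|weighted \<Sigma>. exp (- exp (- \<xi>)) ^ n) = h (1 + real n)"
proof -
  have "(LINT \<xi>|weighted \<Sigma>. exp (- exp (- \<xi>)) ^ n) = (LINT \<xi>|\<Sigma>. gumbel_weight \<xi> * exp (- exp (- \<xi>)) ^ n)"
    unfolding weighted_def by (subst integral_density) (auto intro!: AE_I2 less_imp_le gumbel_weight_pos)
  also have "\<dots> = (LINT \<xi>|\<Sigma>. exp (- (1 + real n) * exp (- \<xi>)) * exp (- \<xi>))"
    by (intro Bochner_Integration.integral_cong refl)
      (simp add: gumbel_weight_def exp_of_nat_mult[symmetric] mult_exp_exp algebra_simps)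
  also have "\<dots> = h (1 + real n)"
    using h_repr[of "1 + real n"] by (simp add: has_bochner_integral_iff)
  finally show ?thesis .
qed

lemma weighted_ray_tendsto:
  assumes "ray_coeff a d x"
  shows "(\<lambda>n. \<Sum>i\<le>d n. a n i * h (1 + real i)) \<longlonglongrightarrow> measure (weighted \<Sigma>) {x..}"
proof -
  have "(\<lambda>n. \<Sum>i\<le>d n. a n i * (LINT \<xi>|weighted \<Sigma>. exp (- exp (- \<xi>)) ^ i))
      \<longlonglongrightarrow> measure (weighted \<Sigma>) {\<xi>\<in>space (weighted \<Sigma>). exp (- exp (- x)) \<le> exp (- exp (- \<xi>))}"
    by (rule assms[unfolded ray_coeff_def, rule_format, OF finite_weighted]) auto
  then show ?thesis by (simp add: weighted_moment space_weighted atLeast_def)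
qed

end

lemma hankel_measure_unique:
  assumes 1: "hankel_measure h \<Sigma>" and 2: "hankel_measure h' \<Sigma>'" and eq: "\<And>t. 0 < t \<Longrightarrow> h t = h' t"
  shows "\<Sigma> = \<Sigma>'"
proof -
  interpret a: hankel_measure h \<Sigma> by fact
  interpret b: hankel_measure h' \<Sigma>' by fact
  have "weighted \<Sigma> = weighted \<Sigma>'"
  proof (rule finite_measure_eqI_atLeast[OF _ _ a.finite_weighted])
    fix x
    obtain a d where ad: "ray_coeff a d x" using ex_ray_coeff by blast
    have "measure (weighted \<Sigma>) {x..} = measure (weighted \<Sigma>') {x..}"
      using LIMSEQ_unique[OF a.weighted_ray_tendsto[OF ad]] b.weighted_ray_tendsto[OF ad] by (simp add: eq)
    then show "emeasure (weighted \<Sigma>) {x..} = emeasure (weighted \<Sigma>') {x..}"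
      by (simp add: finite_measure.emeasure_eq_measure[OF a.finite_weighted] finite_measure.emeasure_eq_measure[OF b.finite_weighted])
  qed (simp_all add: sets_weighted a.sets_\<Sigma> b.sets_\<Sigma>)
  then show ?thesis by (rule weighted_inject[OF a.sets_\<Sigma> b.sets_\<Sigma>])
qed

section \<open>Moments as functions of the kernel\<close>

text \<open>The numbers \<open>mom (V x) j n\<close> and, for \<open>momW\<close>,
  \<open>mom (W \<xi>) j n\<close>, with the exponent n of 1 - T listed before the exponent j of T.
  They are written as repeated differences of plain moments of the kernel, so that measurability and
  translation covariance pass through by induction on n.\<close>

primrec momV :: "(real \<Rightarrow> real \<Rightarrow> real) \<Rightarrow> nat \<Rightarrow> nat \<Rightarrow> real \<Rightarrow> real" where
  "momV K 0 = (\<lambda>j x. l2_inner ((kop K ^^ j) (K x)) (K x))"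
| "momV K (Suc n) = (\<lambda>j x. momV K n j x - momV K n (Suc j) x)"

primrec momW :: "(real \<Rightarrow> real \<Rightarrow> real) \<Rightarrow> nat \<Rightarrow> nat \<Rightarrow> real \<Rightarrow> real" where
  "momW K 0 = (\<lambda>j \<xi>. l2_inner ((kop K ^^ j) (\<lambda>x. hbeta (x - \<xi>))) (\<lambda>x. hbeta (x - \<xi>)))"
| "momW K (Suc n) = (\<lambda>j \<xi>. momW K n j \<xi> - momW K n (Suc j) \<xi>)"

lemma (in contraction_kernel) momV_eq: "momV k n j x = mom (V x) j n"
proof (induction n arbitrary: j)
  case 0
  then show ?case unfolding mom_def using kop_pow[of j "V x"] by (simp add: ip_def fn_V)
next
  case (Suc n)
  have "mom (V x) j n = mom (V x) (Suc j) n + mom (V x) j (Suc n)" by (rule mom_rec)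
  then show ?case unfolding momV.simps Suc by linarith
qed

lemma (in contraction_kernel) momW_eq: "momW k n j \<xi> = mom (W \<xi>) j n"
proof (induction n arbitrary: j)
  case 0
  then show ?case unfolding mom_def using kop_pow[of j "W \<xi>"] by (simp add: ip_def fn_W)
next
  case (Suc n)
  have "mom (W \<xi>) j n = mom (W \<xi>) (Suc j) n + mom (W \<xi>) j (Suc n)" by (rule mom_rec)
  then show ?case unfolding momW.simps Suc by linarith
qed

section \<open>Behaviour under translations\<close>

lemma lborel_integral_shift: "(LINT y|lborel. f (y + c)) = (LINT y|lborel. f y)" for f :: "real \<Rightarrow> real"
  using lborel_integral_real_affine[of 1 f c] by (simp add: add.commute)

lemma lborel_nn_integral_shift:
  fixes c :: real
  assumes "f \<in> borel_measurable borel"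
  shows "(\<integral>\<^sup>+ y. f (y + c) \<partial>lborel) = (\<integral>\<^sup>+ y. f y \<partial>lborel)"
  using nn_integral_real_affine[OF assms, of 1 c] by (simp add: add.commute)

lemma hankel_kernel_shift:
  assumes "\<And>t. 0 < t \<Longrightarrow> h' t = exp c * h (exp c * t)"
  shows "hankel_kernel h' x y = hankel_kernel h (x + c) (y + c)"
proof -
  have pos: "0 < exp x + exp y" by (intro add_pos_pos) auto
  have "exp c * (exp x + exp y) = exp (x + c) + exp (y + c)"
    by (simp add: exp_add algebra_simps)
  moreover have "exp ((x + y) / 2) * exp c = exp ((x + c + (y + c)) / 2)"
    by (simp add: mult_exp_exp field_simps)
  ultimately show ?thesis
    using assms[OF pos] by (simp add: hankel_kernel_def mult.assoc[symmetric])
qed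

lemma kop_apply: "kop K f x = (LINT y|lborel. K x y * f y)"
  by (simp add: kop_def)

lemma kop_pow_shift:
  assumes "\<And>x y. K' x y = K (x + c) (y + c)"
  shows "(kop K' ^^ j) (\<lambda>y. f (y + c)) = (\<lambda>x. (kop K ^^ j) f (x + c))"
proof (induction j)
  case (Suc j)
  have "kop K' (\<lambda>y. g (y + c)) = (\<lambda>x. kop K g (x + c))" for g
    unfolding kop_def assms using lborel_integral_shift[of "\<lambda>y. K _ y * g y" c] by simp
  then show ?case using Suc by simp
qed simp

lemma momV_shift:
  assumes "\<And>x y. K' x y = K (x + c) (y + c)"
  shows "momV K' n j x = momV K n j (x + c)"
proof (induction n arbitrary: j)
  case 0
  have K': "K' x = (\<lambda>y. K (x + c) (y + c))" using assms by blast
  show ?case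
    unfolding momV.simps K' kop_pow_shift[of K' K c, OF assms] l2_inner_def
    using lborel_integral_shift[of "\<lambda>y. (kop K ^^ j) (K (x + c)) y * K (x + c) y" c] by simp
qed simp

lemma momW_shift:
  assumes "\<And>x y. K' x y = K (x + c) (y + c)"
  shows "momW K' n j \<xi> = momW K n j (\<xi> + c)"
proof (induction n arbitrary: j)
  case 0
  have eq: "(\<lambda>x. hbeta (x - \<xi>)) = (\<lambda>y. hbeta (y + c - (\<xi> + c)))" by simp
  show ?case
    unfolding momW.simps eq kop_pow_shift[of K' K c, OF assms, of j "\<lambda>y. hbeta (y - (\<xi> + c))"] l2_inner_def
    using lborel_integral_shift[of "\<lambda>y. (kop K ^^ j) (\<lambda>y. hbeta (y - (\<xi> + c))) y * hbeta (y - (\<xi> + c))" c] by simp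
qed simp

section \<open>Decomposition of the line into cells of length \<tau>\<close>

lemma suminf_indicator_cells:
  fixes \<tau> x :: real
  assumes \<tau>: "0 < \<tau>" and e: "bij (e :: nat \<Rightarrow> int)"
  shows "(\<Sum>n. indicator {\<tau> * real_of_int (e n)..<\<tau> * (real_of_int (e n) + 1)} x) = (1 :: ennreal)"
proof -
  have mem: "x \<in> {\<tau> * real_of_int k..<\<tau> * (real_of_int k + 1)} \<longleftrightarrow> k = \<lfloor>x / \<tau>\<rfloor>" for k
  proof -
    have "x \<in> {\<tau> * real_of_int k..<\<tau> * (real_of_int k + 1)} \<longleftrightarrow> real_of_int k \<le> x / \<tau> \<and> x / \<tau> < real_of_int k + 1"
      using \<tau> by (simp add: pos_le_divide_eq pos_divide_less_eq mult.commute)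
    then show ?thesis using floor_eq_iff[of "x / \<tau>" k] by auto
  qed
  obtain n where n: "e n = \<lfloor>x / \<tau>\<rfloor>" using e by (metis bij_pointE)
  have "(\<Sum>n. indicator {\<tau> * real_of_int (e n)..<\<tau> * (real_of_int (e n) + 1)} x) = (\<Sum>m\<in>{n}. indicator {\<tau> * real_of_int (e m)..<\<tau> * (real_of_int (e m) + 1)} x :: ennreal)"
  proof (rule suminf_finite)
    fix m assume "m \<notin> {n}"
    then have "e m \<noteq> e n" using e by (auto simp: bij_def inj_eq)
    then show "indicator {\<tau> * real_of_int (e m)..<\<tau> * (real_of_int (e m) + 1)} x = (0 :: ennreal)"
      using mem[of "e m"] n by (simp add: indicator_def)
  qed simp
  then show ?thesis using mem[of "e n"] n by simp
qed

lemma nn_integral_cells: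
  fixes \<tau> :: real
  assumes "0 < \<tau>" and e: "bij (e :: nat \<Rightarrow> int)"
    and [measurable]: "f \<in> borel_measurable N" and [measurable_cong]: "sets N = sets borel"
  shows "(\<integral>\<^sup>+ x. f x \<partial>N) = (\<Sum>n. \<integral>\<^sup>+ x\<in>{\<tau> * real_of_int (e n)..<\<tau> * (real_of_int (e n) + 1)}. f x \<partial>N)"
proof -
  have "(\<integral>\<^sup>+ x. f x \<partial>N) = (\<integral>\<^sup>+ x. (\<Sum>n. f x * indicator {\<tau> * real_of_int (e n)..<\<tau> * (real_of_int (e n) + 1)} x) \<partial>N)"
    by (simp only: ennreal_suminf_cmult suminf_indicator_cells[OF assms(1) e] mult_1_right)
  also have "\<dots> = (\<Sum>n. \<integral>\<^sup>+ x\<in>{\<tau> * real_of_int (e n)..<\<tau> * (real_of_int (e n) + 1)}. f x \<partial>N)"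
    by (rule nn_integral_suminf) measurable
  finally show ?thesis .
qed

section \<open>Stationary families\<close>

text \<open>Integer shifts suffice for transport between cells of length \<tau>, so the continuous
  and the discrete case are treated together. The representation holds for every \<omega>, the
  covariance almost surely.\<close>

locale stationary_hankel = prob_space M for M :: "'a measure" +
  fixes Sh :: "int \<Rightarrow> 'a \<Rightarrow> 'a" and \<tau> :: real and h :: "'a \<Rightarrow> real \<Rightarrow> real" and \<Sigma> :: "'a \<Rightarrow> real measure"
  assumes \<tau>: "0 < \<tau>"
    and Sh_measurable [measurable]: "Sh k \<in> measurable M M"
    and Sh_distr: "distr M M (Sh k) = M"
    and hankel: "hankel_measure (h \<omega>) (\<Sigma> \<omega>)"
    and h_measurable: "0 < t \<Longrightarrow> (\<lambda>\<omega>. h \<omega> t) \<in> borel_measurable M"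
    and covariant: "AE \<omega> in M. \<forall>t>0. h (Sh k \<omega>) t = exp (\<tau> * k) * h \<omega> (exp (\<tau> * k) * t)"
begin

abbreviation K :: "'a \<Rightarrow> real \<Rightarrow> real \<Rightarrow> real" where
  "K \<omega> \<equiv> hankel_kernel (h \<omega>)"

text \<open>A function measurable in \<omega> and continuous in u is jointly measurable: u is
  rounded down to a multiple of 1/(n + 1), which leaves countably many values.\<close>

lemma h_joint_measurable: "(\<lambda>(\<omega>, u). h \<omega> (exp u)) \<in> borel_measurable (M \<Otimes>\<^sub>M borel)"
  unfolding case_prod_unfold
proof (rule borel_measurable_LIMSEQ_real[where u="\<lambda>n p. h (fst p) (exp (real_of_int \<lfloor>real (Suc n) * snd p\<rfloor> / real (Suc n)))"])
  fix p :: "'a \<times> real" assume "p \<in> space (M \<Otimes>\<^sub>M borel)"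
  obtain \<omega> u where p: "p = (\<omega>, u)" by (cases p)
  have "(\<lambda>n. real_of_int \<lfloor>real (Suc n) * u\<rfloor> / real (Suc n) - u) \<longlonglongrightarrow> 0"
  proof (rule Lim_null_comparison[OF _ LIMSEQ_inverse_real_of_nat], rule always_eventually, rule allI)
    fix n
    have "\<bar>real_of_int \<lfloor>real (Suc n) * u\<rfloor> - real (Suc n) * u\<bar> \<le> 1"
      using floor_correct[of "real (Suc n) * u"] by linarith
    then have "\<bar>real_of_int \<lfloor>real (Suc n) * u\<rfloor> - real (Suc n) * u\<bar> / real (Suc n) \<le> 1 / real (Suc n)"
      by (intro divide_right_mono) auto
    moreover have "real_of_int \<lfloor>real (Suc n) * u\<rfloor> / real (Suc n) - u
        = (real_of_int \<lfloor>real (Suc n) * u\<rfloor> - real (Suc n) * u) / real (Suc n)"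
      by (simp add: diff_divide_distrib)
    ultimately show "norm (real_of_int \<lfloor>real (Suc n) * u\<rfloor> / real (Suc n) - u) \<le> inverse (real (Suc n))"
      by (simp add: abs_divide inverse_eq_divide)
  qed
  then have lim: "(\<lambda>n. real_of_int \<lfloor>real (Suc n) * u\<rfloor> / real (Suc n)) \<longlonglongrightarrow> u"
    by (simp only: LIM_zero_iff)
  have "isCont (\<lambda>u. h \<omega> (exp u)) u"
    by (intro isCont_o2[OF _ hankel_measure.h_isCont[OF hankel]] continuous_intros) simp
  from isCont_tendsto_compose[OF this lim]
  show "(\<lambda>n. h (fst p) (exp (real_of_int \<lfloor>real (Suc n) * snd p\<rfloor> / real (Suc n))))
      \<longlonglongrightarrow> h (fst p) (exp (snd p))"
    unfolding p fst_conv snd_conv .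
next
  fix n
  have "(\<lambda>p. (\<lambda>i p. h (fst p) (exp (real_of_int i / real (Suc n)))) \<lfloor>real (Suc n) * snd p\<rfloor> p)
      \<in> borel_measurable (M \<Otimes>\<^sub>M borel)"
  proof (rule measurable_compose_countable[where f="\<lambda>i p. h (fst p) (exp (real_of_int i / real (Suc n)))"
        and g="\<lambda>p. \<lfloor>real (Suc n) * snd p\<rfloor>"])
    show "(\<lambda>p. h (fst p) (exp (real_of_int i / real (Suc n)))) \<in> borel_measurable (M \<Otimes>\<^sub>M borel)" for i
      by (rule measurable_compose[OF measurable_fst h_measurable]) simp
    show "(\<lambda>p. \<lfloor>real (Suc n) * snd p\<rfloor>) \<in> M \<Otimes>\<^sub>M borel \<rightarrow>\<^sub>M count_space UNIV"
      by measurable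
  qed
  then show "(\<lambda>p. h (fst p) (exp (real_of_int \<lfloor>real (Suc n) * snd p\<rfloor> / real (Suc n))))
      \<in> borel_measurable (M \<Otimes>\<^sub>M borel)" .
qed

lemma K_measurable [measurable (raw)]:
  assumes [measurable]: "p \<in> measurable N M" "f \<in> borel_measurable N" "g \<in> borel_measurable N"
  shows "(\<lambda>w. K (p w) (f w) (g w)) \<in> borel_measurable N"
proof -
  have "(\<lambda>w. h (p w) (exp (ln (exp (f w) + exp (g w))))) \<in> borel_measurable N"
    using measurable_compose[of "\<lambda>w. (p w, ln (exp (f w) + exp (g w)))" N, OF _ h_joint_measurable] by simp
  moreover have "exp (ln (exp (f w) + exp (g w))) = exp (f w) + exp (g w)" for w
    by (intro exp_ln add_pos_pos) auto
  ultimately show ?thesis unfolding hankel_kernel_def by simp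
qed

lemma kop_pow_measurable [measurable (raw)]:
  assumes p[measurable]: "p \<in> measurable N M" and f: "(\<lambda>(w, y). f w y) \<in> borel_measurable (N \<Otimes>\<^sub>M borel)"
  shows "(\<lambda>(w, y). (kop (K (p w)) ^^ j) (f w) y) \<in> borel_measurable (N \<Otimes>\<^sub>M borel)"
proof (induction j)
  case (Suc j)
  note Suc[measurable]
  have "(\<lambda>q. LINT z|lborel. K (p (fst q)) (snd q) z * (kop (K (p (fst q))) ^^ j) (f (fst q)) z) \<in> borel_measurable (N \<Otimes>\<^sub>M borel)"
    by measurable
  moreover have "(kop (K (p w)) ^^ Suc j) (f w) y = (LINT z|lborel. K (p w) y z * (kop (K (p w)) ^^ j) (f w) z)" for w y
    by (simp only: funpow.simps comp_apply) (rule kop_apply)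
  ultimately show ?case by (simp only: case_prod_unfold)
qed (use f in simp)

lemma kop_pow_measurable':
  assumes [measurable]: "p \<in> measurable N M" and [measurable]: "(\<lambda>(w, y). f w y) \<in> borel_measurable (N \<Otimes>\<^sub>M borel)"
    "g \<in> borel_measurable N"
  shows "(\<lambda>w. (kop (K (p w)) ^^ j) (f w) (g w)) \<in> borel_measurable N"
  using measurable_compose[of "\<lambda>w. (w, g w)" N, OF _ kop_pow_measurable[OF assms(1,2), of j]] by simp

lemma momV_measurable [measurable]: "(\<lambda>(\<omega>, x). momV (K \<omega>) n j x) \<in> borel_measurable (M \<Otimes>\<^sub>M borel)"
proof (induction n arbitrary: j)
  case 0
  have "(\<lambda>w. LINT y|lborel. (kop (K (fst w)) ^^ j) (K (fst w) (snd w)) y * K (fst w) (snd w) y) \<in> borel_measurable (M \<Otimes>\<^sub>M borel)"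
  proof (rule lborel.borel_measurable_lebesgue_integral)
    have "(\<lambda>(w, y). (kop (K (fst w)) ^^ j) (K (fst w) (snd w)) y) \<in> borel_measurable ((M \<Otimes>\<^sub>M borel) \<Otimes>\<^sub>M borel)"
      by (rule kop_pow_measurable) measurable
    then show "(\<lambda>(w, y). (kop (K (fst w)) ^^ j) (K (fst w) (snd w)) y * K (fst w) (snd w) y) \<in> borel_measurable ((M \<Otimes>\<^sub>M borel) \<Otimes>\<^sub>M lborel)"
      by (simp add: case_prod_unfold)
  qed
  then show ?case by (simp add: l2_inner_def case_prod_unfold)
next
  case (Suc n)
  note Suc[measurable]
  show ?case by simp
qed

lemma momW_measurable [measurable]: "(\<lambda>(\<omega>, \<xi>). momW (K \<omega>) n j \<xi>) \<in> borel_measurable (M \<Otimes>\<^sub>M borel)"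
proof (induction n arbitrary: j)
  case 0
  have "(\<lambda>w. LINT y|lborel. (kop (K (fst w)) ^^ j) (\<lambda>x. hbeta (x - snd w)) y * hbeta (y - snd w)) \<in> borel_measurable (M \<Otimes>\<^sub>M borel)"
  proof (rule lborel.borel_measurable_lebesgue_integral)
    have "(\<lambda>(w, y). (kop (K (fst w)) ^^ j) (\<lambda>x. hbeta (x - snd w)) y) \<in> borel_measurable ((M \<Otimes>\<^sub>M borel) \<Otimes>\<^sub>M borel)"
      by (rule kop_pow_measurable) measurable
    then show "(\<lambda>(w, y). (kop (K (fst w)) ^^ j) (\<lambda>x. hbeta (x - snd w)) y * hbeta (y - snd w)) \<in> borel_measurable ((M \<Otimes>\<^sub>M borel) \<Otimes>\<^sub>M lborel)"
      by (simp add: case_prod_unfold)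
  qed
  then show ?case by (simp add: l2_inner_def case_prod_unfold)
next
  case (Suc n)
  note Suc[measurable]
  show ?case by simp
qed

text \<open>The mass of a ray is a limit of combinations of values of h with coefficients
  independent of \<omega>, and rays generate. The weight is there because \<Sigma> \<omega> itself
  may have infinite mass.\<close>

lemma weighted_measurable: "(\<lambda>\<omega>. weighted (\<Sigma> \<omega>)) \<in> measurable M (subprob_algebra borel)"
proof (rule measurable_subprob_algebra_generated[OF sets_borel_atLeast Int_stable_atLeast])
  interpret hankel_measure "h \<omega>" "\<Sigma> \<omega>" for \<omega> by (rule hankel)
  fix A :: "real set" assume "A \<in> range atLeast"
  then obtain x where A: "A = {x..}" by blast
  obtain a d where ad: "ray_coeff a d x" using ex_ray_coeff by blast
  have "(\<lambda>\<omega>. measure (weighted (\<Sigma> \<omega>)) {x..}) \<in> borel_measurable M"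
  proof (rule borel_measurable_LIMSEQ_real)
    show "(\<lambda>n. \<Sum>i\<le>d n. a n i * h \<omega> (1 + real i)) \<longlonglongrightarrow> measure (weighted (\<Sigma> \<omega>)) {x..}" for \<omega>
      by (rule weighted_ray_tendsto[OF ad])
    show "(\<lambda>\<omega>. \<Sum>i\<le>d n. a n i * h \<omega> (1 + real i)) \<in> borel_measurable M" for n
      by (intro borel_measurable_sum borel_measurable_times borel_measurable_const h_measurable) simp
  qed
  then show "(\<lambda>\<omega>. emeasure (weighted (\<Sigma> \<omega>)) A) \<in> borel_measurable M"
    unfolding A finite_measure.emeasure_eq_measure[OF finite_weighted] by measurable
next
  interpret hankel_measure "h \<omega>" "\<Sigma> \<omega>" for \<omega> by (rule hankel)
  show "(\<lambda>\<omega>. emeasure (weighted (\<Sigma> \<omega>)) UNIV) \<in> borel_measurable M"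
    unfolding emeasure_weighted using h_measurable[of 1] by simp
  show "subprob_space (weighted (\<Sigma> \<omega>))" for \<omega> by (rule subprob_weighted)
  show "sets (weighted (\<Sigma> \<omega>)) = sets borel" for \<omega> by (simp add: sets_weighted sets_\<Sigma>)
qed simp

lemma sets_\<Sigma> [measurable_cong]: "sets (\<Sigma> \<omega>) = sets borel"
  by (rule hankel_measure.sets_\<Sigma>[OF hankel])

lemma nn_integral_\<Sigma>_measurable:
  assumes [measurable]: "p \<in> measurable N M" "(\<lambda>(w, \<xi>). f w \<xi>) \<in> borel_measurable (N \<Otimes>\<^sub>M borel)"
  shows "(\<lambda>w. \<integral>\<^sup>+ \<xi>. f w \<xi> \<partial>\<Sigma> (p w)) \<in> borel_measurable N"
proof -
  have "(\<lambda>w. \<integral>\<^sup>+ \<xi>. f w \<xi> * ennreal (1 / gumbel_weight \<xi>) \<partial>weighted (\<Sigma> (p w))) \<in> borel_measurable N"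
    by (rule nn_integral_measurable_subprob_algebra2[OF _ measurable_compose[OF assms(1) weighted_measurable]]) measurable
  moreover have "(\<integral>\<^sup>+ \<xi>. f w \<xi> \<partial>\<Sigma> (p w)) = (\<integral>\<^sup>+ \<xi>. f w \<xi> * ennreal (1 / gumbel_weight \<xi>) \<partial>weighted (\<Sigma> (p w)))"
    if "w \<in> space N" for w
    using measurable_Pair2[OF assms(2) that] by (intro nn_integral_weighted[OF sets_\<Sigma>]) simp
  ultimately show ?thesis by (subst measurable_cong) auto
qed

lemma K_shift: "AE \<omega> in M. \<forall>x y. K (Sh k \<omega>) x y = K \<omega> (x + \<tau> * k) (y + \<tau> * k)"
  using covariant[of k]
proof eventually_elim
  case (elim \<omega>)
  then have "K (Sh k \<omega>) x y = K \<omega> (x + \<tau> * k) (y + \<tau> * k)" for x y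
    by (intro hankel_kernel_shift) blast
  then show ?case by blast
qed

text \<open>Covariance of the measures is derived from that of the kernel functions: the translated
  measure represents the shifted kernel function, and the representing measure is unique.\<close>

lemma \<Sigma>_shift: "AE \<omega> in M. \<Sigma> (Sh k \<omega>) = distr (\<Sigma> \<omega>) borel (\<lambda>\<xi>. \<xi> - \<tau> * k)"
  using covariant[of k]
proof eventually_elim
  case (elim \<omega>)
  interpret hm: hankel_measure "h \<omega>" "\<Sigma> \<omega>" by (rule hankel)
  interpret hs: hankel_measure "h (Sh k \<omega>)" "\<Sigma> (Sh k \<omega>)" by (rule hankel)
  define c where "c = \<tau> * real_of_int k"
  have "hankel_measure (h (Sh k \<omega>)) (distr (\<Sigma> \<omega>) borel (\<lambda>\<xi>. \<xi> - c))"
  proof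
    fix t :: real assume t: "0 < t"
    have "has_bochner_integral (\<Sigma> \<omega>) (\<lambda>\<xi>. exp c * (exp (- (exp c * t) * exp (- \<xi>)) * exp (- \<xi>)))
        (exp c * h \<omega> (exp c * t))"
      by (intro has_bochner_integral_mult_right hm.h_repr mult_pos_pos t) simp
    also have "(\<lambda>\<xi>. exp c * (exp (- (exp c * t) * exp (- \<xi>)) * exp (- \<xi>)))
        = (\<lambda>\<xi>. exp (- t * exp (- (\<xi> - c))) * exp (- (\<xi> - c)))"
    proof
      fix \<xi>
      have "exp (- (\<xi> - c)) = exp c * exp (- \<xi>)" by (simp add: mult_exp_exp)
      then show "exp c * (exp (- (exp c * t) * exp (- \<xi>)) * exp (- \<xi>)) = exp (- t * exp (- (\<xi> - c))) * exp (- (\<xi> - c))"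
        by (simp add: ac_simps)
    qed
    also have "exp c * h \<omega> (exp c * t) = h (Sh k \<omega>) t" using elim t by (simp add: c_def)
    finally show "has_bochner_integral (distr (\<Sigma> \<omega>) borel (\<lambda>\<xi>. \<xi> - c)) (\<lambda>\<xi>. exp (- t * exp (- \<xi>)) * exp (- \<xi>)) (h (Sh k \<omega>) t)"
      by (intro has_bochner_integral_distr) auto
  qed (use hs.h_bound hs.h_psd in auto)
  then show ?case
    using hankel_measure_unique[OF hankel[of "Sh k \<omega>"]] by (simp add: c_def)
qed

lemma expectation_shift:
  assumes [measurable]: "F \<in> borel_measurable M"
  shows "(\<integral>\<^sup>+ \<omega>. F (Sh k \<omega>) \<partial>M) = (\<integral>\<^sup>+ \<omega>. F \<omega> \<partial>M)"
  using nn_integral_distr[of "Sh k" M M F] by (simp add: Sh_distr)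

abbreviation cell :: "int \<Rightarrow> real set" where
  "cell k \<equiv> {\<tau> * real_of_int k..<\<tau> * (real_of_int k + 1)}"

lemma indicator_cell_shift: "indicator (cell a) x = indicator (cell (a + k)) (x + \<tau> * k)"
  by (simp add: indicator_def algebra_simps)

text \<open>Let \<Phi> a b be the mass sent from cell a to cell b. Stationarity gives the mean of
  \<Phi> 0 b the same value as that of \<Phi> (- b) 0; summing over b, the mean mass leaving cell 0
  equals the mean mass arriving there.\<close>

lemma mass_transport:
  fixes Q :: "'a \<Rightarrow> real \<Rightarrow> real \<Rightarrow> ennreal"
  assumes Q[measurable]: "(\<lambda>((\<omega>, x), \<xi>). Q \<omega> x \<xi>) \<in> borel_measurable ((M \<Otimes>\<^sub>M borel) \<Otimes>\<^sub>M borel)"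
    and shift: "\<And>k. AE \<omega> in M. \<forall>x \<xi>. Q (Sh k \<omega>) x \<xi> = Q \<omega> (x + \<tau> * k) (\<xi> + \<tau> * k)"
  shows "(\<integral>\<^sup>+ \<omega>. (\<integral>\<^sup>+ x\<in>{0..<\<tau>}. (\<integral>\<^sup>+ \<xi>. Q \<omega> x \<xi> \<partial>\<Sigma> \<omega>) \<partial>lborel) \<partial>M)
    = (\<integral>\<^sup>+ \<omega>. (\<integral>\<^sup>+ \<xi>\<in>{0..<\<tau>}. (\<integral>\<^sup>+ x. Q \<omega> x \<xi> \<partial>lborel) \<partial>\<Sigma> \<omega>) \<partial>M)"
proof -
  define \<Phi> where "\<Phi> \<omega> a b = (\<integral>\<^sup>+ x. (\<integral>\<^sup>+ \<xi>. Q \<omega> x \<xi> * indicator (cell a) x * indicator (cell b) \<xi> \<partial>\<Sigma> \<omega>) \<partial>lborel)" for \<omega> a b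
  have [measurable]: "(\<lambda>w. Q (fst (fst w)) (snd (fst w)) (snd w)) \<in> borel_measurable ((M \<Otimes>\<^sub>M borel) \<Otimes>\<^sub>M borel)"
    using Q by (simp add: case_prod_unfold)
  have Qx: "(\<lambda>\<xi>. Q \<omega> x \<xi>) \<in> borel_measurable borel" if "\<omega> \<in> space M" for \<omega> x
    using measurable_Pair2[OF Q, of "(\<omega>, x)"] that by (simp add: space_pair_measure)
  have Qxx: "(\<lambda>(x, \<xi>). Q \<omega> x \<xi>) \<in> borel_measurable (borel \<Otimes>\<^sub>M borel)" if "\<omega> \<in> space M" for \<omega>
    using measurable_compose[of "\<lambda>(x, \<xi>). ((\<omega>, x), \<xi>)" "borel \<Otimes>\<^sub>M borel", OF _ Q] that
    by (simp add: case_prod_unfold)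
  have inner_meas: "(\<lambda>(\<omega>, x). \<integral>\<^sup>+ \<xi>. Q \<omega> x \<xi> * indicator (cell a) x * indicator (cell b) \<xi> \<partial>\<Sigma> \<omega>)
      \<in> borel_measurable (M \<Otimes>\<^sub>M borel)" for a b
    unfolding case_prod_unfold by (rule nn_integral_\<Sigma>_measurable) measurable
  have \<Phi>_meas: "(\<lambda>\<omega>. \<Phi> \<omega> a b) \<in> borel_measurable M" for a b
    unfolding \<Phi>_def using inner_meas[of a b] by (intro lborel.borel_measurable_nn_integral) simp
  have \<Phi>_shift: "AE \<omega> in M. \<Phi> (Sh k \<omega>) a b = \<Phi> \<omega> (a + k) (b + k)" for k a b
    using shift[of k] \<Sigma>_shift[of k] AE_space
  proof eventually_elim
    case (elim \<omega>)
    note [measurable] = Qxx[OF elim(3)] Qx[OF elim(3)]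
    interpret hm: hankel_measure "h \<omega>" "\<Sigma> \<omega>" by (rule hankel)
    interpret S: sigma_finite_measure "\<Sigma> \<omega>" by (rule hm.sigma_finite)
    define c where "c = \<tau> * real_of_int k"
    let ?q = "\<lambda>x \<xi>. Q \<omega> x \<xi> * indicator (cell (a + k)) x * indicator (cell (b + k)) \<xi>"
    have "\<Phi> (Sh k \<omega>) a b = (\<integral>\<^sup>+ x. (\<integral>\<^sup>+ \<xi>. ?q (x + c) (\<xi> + c) \<partial>distr (\<Sigma> \<omega>) borel (\<lambda>\<xi>. \<xi> - c)) \<partial>lborel)"
      unfolding \<Phi>_def using elim(1,2) by (simp add: c_def indicator_cell_shift[of a _ k] indicator_cell_shift[of b _ k])
    also have "\<dots> = (\<integral>\<^sup>+ x. (\<integral>\<^sup>+ \<xi>. ?q (x + c) \<xi> \<partial>\<Sigma> \<omega>) \<partial>lborel)"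
      by (subst nn_integral_distr) auto
    also have "\<dots> = (\<integral>\<^sup>+ x. (\<integral>\<^sup>+ \<xi>. ?q x \<xi> \<partial>\<Sigma> \<omega>) \<partial>lborel)"
      by (rule lborel_nn_integral_shift[of "\<lambda>x. \<integral>\<^sup>+ \<xi>. ?q x \<xi> \<partial>\<Sigma> \<omega>"]) measurable
    finally show ?case unfolding \<Phi>_def .
  qed
  have swap: "(\<integral>\<^sup>+ \<omega>. \<Phi> \<omega> 0 b \<partial>M) = (\<integral>\<^sup>+ \<omega>. \<Phi> \<omega> (- b) 0 \<partial>M)" for b
  proof -
    have "(\<integral>\<^sup>+ \<omega>. \<Phi> \<omega> 0 b \<partial>M) = (\<integral>\<^sup>+ \<omega>. \<Phi> (Sh (- b) \<omega>) 0 b \<partial>M)"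
      by (rule expectation_shift[OF \<Phi>_meas, symmetric])
    also have "\<dots> = (\<integral>\<^sup>+ \<omega>. \<Phi> \<omega> (- b) 0 \<partial>M)"
      using \<Phi>_shift[of "- b" 0 b] by (intro nn_integral_cong_AE) simp
    finally show ?thesis .
  qed
  have cell0: "cell 0 = {0..<\<tau>}" by simp
  have bij1: "bij int_decode" by (rule bij_int_decode)
  have "bij (uminus :: int \<Rightarrow> int)" by (rule bij_uminus)
  with bij1 have bij2: "bij (\<lambda>n. - int_decode n)"
    using bij_comp[of int_decode uminus] by (simp add: o_def)
  have "(\<integral>\<^sup>+ \<omega>. (\<integral>\<^sup>+ x\<in>{0..<\<tau>}. (\<integral>\<^sup>+ \<xi>. Q \<omega> x \<xi> \<partial>\<Sigma> \<omega>) \<partial>lborel) \<partial>M) = (\<integral>\<^sup>+ \<omega>. (\<Sum>n. \<Phi> \<omega> 0 (int_decode n)) \<partial>M)"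
  proof (rule nn_integral_cong)
    fix \<omega> assume \<omega>: "\<omega> \<in> space M"
    note [measurable] = Qxx[OF \<omega>] Qx[OF \<omega>]
    interpret hm: hankel_measure "h \<omega>" "\<Sigma> \<omega>" by (rule hankel)
    interpret S: sigma_finite_measure "\<Sigma> \<omega>" by (rule hm.sigma_finite)
    have "(\<integral>\<^sup>+ x\<in>{0..<\<tau>}. (\<integral>\<^sup>+ \<xi>. Q \<omega> x \<xi> \<partial>\<Sigma> \<omega>) \<partial>lborel)
      = (\<integral>\<^sup>+ x. (\<Sum>n. \<integral>\<^sup>+ \<xi>. Q \<omega> x \<xi> * indicator (cell 0) x * indicator (cell (int_decode n)) \<xi> \<partial>\<Sigma> \<omega>) \<partial>lborel)"
    proof (rule nn_integral_cong)
      fix x :: real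
      have "(\<integral>\<^sup>+ \<xi>. Q \<omega> x \<xi> \<partial>\<Sigma> \<omega>) * indicator {0..<\<tau>} x = (\<integral>\<^sup>+ \<xi>. Q \<omega> x \<xi> * indicator (cell 0) x \<partial>\<Sigma> \<omega>)"
        unfolding cell0 by (subst nn_integral_multc) auto
      also have "\<dots> = (\<Sum>n. \<integral>\<^sup>+ \<xi>. Q \<omega> x \<xi> * indicator (cell 0) x * indicator (cell (int_decode n)) \<xi> \<partial>\<Sigma> \<omega>)"
        by (rule nn_integral_cells[OF \<tau> bij1 _ sets_\<Sigma>]) measurable
      finally show "(\<integral>\<^sup>+ \<xi>. Q \<omega> x \<xi> \<partial>\<Sigma> \<omega>) * indicator {0..<\<tau>} x
        = (\<Sum>n. \<integral>\<^sup>+ \<xi>. Q \<omega> x \<xi> * indicator (cell 0) x * indicator (cell (int_decode n)) \<xi> \<partial>\<Sigma> \<omega>)" .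
    qed
    also have "\<dots> = (\<Sum>n. \<Phi> \<omega> 0 (int_decode n))"
      unfolding \<Phi>_def by (rule nn_integral_suminf) measurable
    finally show "(\<integral>\<^sup>+ x\<in>{0..<\<tau>}. (\<integral>\<^sup>+ \<xi>. Q \<omega> x \<xi> \<partial>\<Sigma> \<omega>) \<partial>lborel) = (\<Sum>n. \<Phi> \<omega> 0 (int_decode n))" .
  qed
  also have "\<dots> = (\<Sum>n. \<integral>\<^sup>+ \<omega>. \<Phi> \<omega> 0 (int_decode n) \<partial>M)"
    by (rule nn_integral_suminf[OF \<Phi>_meas])
  also have "\<dots> = (\<Sum>n. \<integral>\<^sup>+ \<omega>. \<Phi> \<omega> (- int_decode n) 0 \<partial>M)"
    by (simp only: swap)
  also have "\<dots> = (\<integral>\<^sup>+ \<omega>. (\<Sum>n. \<Phi> \<omega> (- int_decode n) 0) \<partial>M)"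
    by (rule nn_integral_suminf[OF \<Phi>_meas, symmetric])
  also have "\<dots> = (\<integral>\<^sup>+ \<omega>. (\<integral>\<^sup>+ \<xi>\<in>{0..<\<tau>}. (\<integral>\<^sup>+ x. Q \<omega> x \<xi> \<partial>lborel) \<partial>\<Sigma> \<omega>) \<partial>M)"
  proof (rule nn_integral_cong)
    fix \<omega> assume \<omega>: "\<omega> \<in> space M"
    note [measurable] = Qxx[OF \<omega>] Qx[OF \<omega>]
    interpret hm: hankel_measure "h \<omega>" "\<Sigma> \<omega>" by (rule hankel)
    interpret S: sigma_finite_measure "\<Sigma> \<omega>" by (rule hm.sigma_finite)
    interpret P: pair_sigma_finite lborel "\<Sigma> \<omega>" by (rule hm.pair_sigma_finite_lborel)
    have eq: "\<Phi> \<omega> a b = (\<integral>\<^sup>+ \<xi>. (\<integral>\<^sup>+ x. Q \<omega> x \<xi> * indicator (cell a) x * indicator (cell b) \<xi> \<partial>lborel) \<partial>\<Sigma> \<omega>)" for a b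
      unfolding \<Phi>_def by (rule P.Fubini'[symmetric]) measurable
    have "(\<integral>\<^sup>+ \<xi>\<in>{0..<\<tau>}. (\<integral>\<^sup>+ x. Q \<omega> x \<xi> \<partial>lborel) \<partial>\<Sigma> \<omega>)
      = (\<integral>\<^sup>+ \<xi>. (\<Sum>n. \<integral>\<^sup>+ x. Q \<omega> x \<xi> * indicator (cell (- int_decode n)) x * indicator (cell 0) \<xi> \<partial>lborel) \<partial>\<Sigma> \<omega>)"
    proof (rule nn_integral_cong)
      fix \<xi> :: real
      have "(\<integral>\<^sup>+ x. Q \<omega> x \<xi> \<partial>lborel) * indicator {0..<\<tau>} \<xi> = (\<integral>\<^sup>+ x. Q \<omega> x \<xi> * indicator (cell 0) \<xi> \<partial>lborel)"
        unfolding cell0 by (subst nn_integral_multc) auto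
      also have "\<dots> = (\<Sum>n. \<integral>\<^sup>+ x. Q \<omega> x \<xi> * indicator (cell 0) \<xi> * indicator (cell (- int_decode n)) x \<partial>lborel)"
        by (rule nn_integral_cells[OF \<tau> bij2]) auto
      finally show "(\<integral>\<^sup>+ x. Q \<omega> x \<xi> \<partial>lborel) * indicator {0..<\<tau>} \<xi>
        = (\<Sum>n. \<integral>\<^sup>+ x. Q \<omega> x \<xi> * indicator (cell (- int_decode n)) x * indicator (cell 0) \<xi> \<partial>lborel)"
        by (simp only: ac_simps)
    qed
    also have "\<dots> = (\<Sum>n. \<Phi> \<omega> (- int_decode n) 0)"
      unfolding eq by (rule nn_integral_suminf) measurable
    finally show "(\<Sum>n. \<Phi> \<omega> (- int_decode n) 0) = (\<integral>\<^sup>+ \<xi>\<in>{0..<\<tau>}. (\<integral>\<^sup>+ x. Q \<omega> x \<xi> \<partial>lborel) \<partial>\<Sigma> \<omega>)" ..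
  qed
  finally show ?thesis .
qed

end

lemma (in contraction_kernel) fn_T_pow_nonneg:
  assumes "\<And>x. 0 \<le> fn f x"
  shows "0 \<le> fn ((T ^^ n) f) x"
proof (induction n arbitrary: x)
  case (Suc n)
  then show ?case
    by (simp add: fn_T kop_apply k_nonneg)
qed (use assms in simp)

section \<open>The transport function and its two marginals\<close>

context hankel_measure
begin

lemma transport_nonneg:
  "0 \<le> hbeta (x - \<xi>) * (kop (hankel_kernel h) ^^ j) (\<lambda>x. hbeta (x - \<xi>)) x"
proof -
  have "0 \<le> fn ((T ^^ j) (W \<xi>)) x"
    by (rule fn_T_pow_nonneg) (simp add: fn_W hbeta_pos less_imp_le)
  then show ?thesis
    using kop_pow[of j "W \<xi>"] hbeta_pos[of "x - \<xi>"] by (simp add: fn_W)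
qed

text \<open>Moving T^j from W \<xi> to the row turns the second factor into the value at \<xi> of
  the transform of T^j T_x; integrating this against \<open>hbeta\<close> over \<Sigma> applies T
  once more. The exponent \<open>Suc j\<close> on the left thus becomes j between two rows.\<close>

lemma transport_\<xi>:
  "(\<integral>\<^sup>+ \<xi>. ennreal (hbeta (x - \<xi>) * (kop (hankel_kernel h) ^^ Suc j) (\<lambda>x. hbeta (x - \<xi>)) x) \<partial>\<Sigma>)
    = ennreal (momV (hankel_kernel h) 0 j x)"
proof -
  define f where "f = (T ^^ j) (V x)"
  have "(kop (hankel_kernel h) ^^ Suc j) (\<lambda>x. hbeta (x - \<xi>)) x = ip f (W \<xi>)" for \<xi>
  proof -
    have "(kop (hankel_kernel h) ^^ Suc j) (\<lambda>x. hbeta (x - \<xi>)) x = fn (T ((T ^^ j) (W \<xi>))) x"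
      using kop_pow[of "Suc j" "W \<xi>"] by (simp add: fn_W)
    also have "\<dots> = ip (V x) ((T ^^ j) (W \<xi>))" by (rule fn_T_eq_ip)
    also have "\<dots> = ip f (W \<xi>)" by (simp only: f_def Tn_sym)
    finally show ?thesis .
  qed
  then have eq: "(\<lambda>\<xi>. hbeta (x - \<xi>) * (kop (hankel_kernel h) ^^ Suc j) (\<lambda>x. hbeta (x - \<xi>)) x) = (\<lambda>\<xi>. hbeta (x - \<xi>) * ip f (W \<xi>))"
    by simp
  have "(\<integral>\<^sup>+ \<xi>. ennreal (hbeta (x - \<xi>) * ip f (W \<xi>)) \<partial>\<Sigma>) = ennreal (fn (T f) x)"
    using W_repr(1)[of x f] transport_nonneg[of x _ "Suc j"] unfolding fun_cong[OF eq]
    by (subst nn_integral_eq_integral) (auto simp: has_bochner_integral_iff)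
  also have "fn (T f) x = ip f (V x)" by (rule ip_V[symmetric])
  also have "\<dots> = momV (hankel_kernel h) 0 j x"
    by (simp only: momV_eq mom_def f_def funpow_0)
  finally show ?thesis unfolding fun_cong[OF eq] .
qed

lemma transport_x:
  "(\<integral>\<^sup>+ x. ennreal (hbeta (x - \<xi>) * (kop (hankel_kernel h) ^^ j) (\<lambda>x. hbeta (x - \<xi>)) x) \<partial>lborel)
    = ennreal (momW (hankel_kernel h) 0 j \<xi>)"
proof -
  have eq: "(\<lambda>x. hbeta (x - \<xi>) * (kop (hankel_kernel h) ^^ j) (\<lambda>x. hbeta (x - \<xi>)) x) = (\<lambda>x. fn (W \<xi>) x * fn ((T ^^ j) (W \<xi>)) x)"
    using kop_pow[of j "W \<xi>"] by (simp add: fn_W)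
  have "(\<integral>\<^sup>+ x. ennreal (fn (W \<xi>) x * fn ((T ^^ j) (W \<xi>)) x) \<partial>lborel) = ennreal (LINT x|lborel. fn (W \<xi>) x * fn ((T ^^ j) (W \<xi>)) x)"
    using transport_nonneg[of _ \<xi> j] unfolding fun_cong[OF eq]
    by (intro nn_integral_eq_integral ip_integrable) auto
  also have "(LINT x|lborel. fn (W \<xi>) x * fn ((T ^^ j) (W \<xi>)) x) = ip (W \<xi>) ((T ^^ j) (W \<xi>))"
    by (simp add: ip_def l2_inner_def)
  also have "\<dots> = momW (hankel_kernel h) 0 j \<xi>"
    by (simp only: momW_eq mom_def Tn_sym funpow_0)
  finally show ?thesis unfolding fun_cong[OF eq] .
qed

lemma momV_nonneg: "0 \<le> momV (hankel_kernel h) n j x"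
  by (simp only: momV_eq mom_nonneg)

lemma momW_nonneg: "0 \<le> momW (hankel_kernel h) n j \<xi>"
  by (simp only: momW_eq mom_nonneg)

lemma momV_bound: "momV (hankel_kernel h) n j x \<le> 1 / 4"
  unfolding momV_eq by (rule order_trans[OF mom_le V_norm])

lemma suminf_momW_1:
  assumes "\<xi> \<in> measure_support \<Sigma>"
  shows "(\<Sum>n. ennreal (real (Suc n) * momW (hankel_kernel h) n 1 \<xi>)) = (\<Sum>n. ennreal (momW (hankel_kernel h) n 0 \<xi>))"
  unfolding momW_eq by (rule suminf_mom_1[OF W_null[OF assms]])

lemma suminf_momW_0:
  assumes "\<xi> \<in> measure_support \<Sigma>"
  shows "(\<Sum>n. ennreal (momW (hankel_kernel h) n 0 \<xi>)) = inverse (emeasure \<Sigma> {\<xi>})"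
  unfolding momW_eq by (rule suminf_mom_W[OF assms])

end

section \<open>Averages over a cell and the transport of moments\<close>

context stationary_hankel
begin

text \<open>The random measure is a parameter so that the same rules for sums, suprema and multiples
  serve both Lebesgue measure and \<Sigma>.\<close>

definition avg :: "('a \<Rightarrow> real measure) \<Rightarrow> ('a \<Rightarrow> real \<Rightarrow> ennreal) \<Rightarrow> ennreal" where
  "avg N f = (\<integral>\<^sup>+ \<omega>. (\<integral>\<^sup>+ x\<in>{0..<\<tau>}. f \<omega> x \<partial>N \<omega>) \<partial>M)"

abbreviation "expV \<equiv> avg (\<lambda>_. lborel)"
abbreviation "expW \<equiv> avg \<Sigma>"

text \<open>Measurable dependence is expressed through integrals because the measures need not be
  finite, which excludes \<open>subprob_algebra\<close>.\<close>

definition borel_kernel :: "('a \<Rightarrow> real measure) \<Rightarrow> bool" where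
  "borel_kernel N \<longleftrightarrow> (\<forall>\<omega>. sets (N \<omega>) = sets borel) \<and>
    (\<forall>f. (\<lambda>(\<omega>, x). f \<omega> x) \<in> borel_measurable (M \<Otimes>\<^sub>M borel) \<longrightarrow>
      (\<lambda>\<omega>. \<integral>\<^sup>+ x. f \<omega> x \<partial>N \<omega>) \<in> borel_measurable M)"

lemma borel_kernel_lborel: "borel_kernel (\<lambda>_. lborel)"
  unfolding borel_kernel_def by (auto intro!: lborel.borel_measurable_nn_integral)

lemma borel_kernel_\<Sigma>: "borel_kernel \<Sigma>"
  unfolding borel_kernel_def using nn_integral_\<Sigma>_measurable[of "\<lambda>\<omega>. \<omega>" M] sets_\<Sigma> by simp

lemma section_measurable:
  assumes "(\<lambda>(\<omega>, x). f \<omega> x) \<in> borel_measurable (M \<Otimes>\<^sub>M borel)" "\<omega> \<in> space M"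
  shows "f \<omega> \<in> borel_measurable borel"
  using measurable_Pair2[OF assms] by simp

lemma cell_integral_measurable:
  assumes N: "borel_kernel N" and f: "(\<lambda>(\<omega>, x). f \<omega> x) \<in> borel_measurable (M \<Otimes>\<^sub>M borel)"
    and [measurable]: "A \<in> sets borel"
  shows "(\<lambda>\<omega>. \<integral>\<^sup>+ x\<in>A. f \<omega> x \<partial>N \<omega>) \<in> borel_measurable M"
proof -
  note f[measurable]
  have "(\<lambda>(\<omega>, x). f \<omega> x * indicator A x) \<in> borel_measurable (M \<Otimes>\<^sub>M borel)"
    by (simp add: case_prod_unfold) measurable
  then show ?thesis using N unfolding borel_kernel_def by blast
qed

context
  fixes N :: "'a \<Rightarrow> real measure"
  assumes N: "borel_kernel N"
begin

lemma sets_N: "sets (N \<omega>) = sets borel"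
  using N by (simp add: borel_kernel_def)

lemma inner_measurable:
  assumes "(\<lambda>(\<omega>, x). f \<omega> x) \<in> borel_measurable (M \<Otimes>\<^sub>M borel)"
  shows "(\<lambda>\<omega>. \<integral>\<^sup>+ x\<in>{0..<\<tau>}. f \<omega> x \<partial>N \<omega>) \<in> borel_measurable M"
  by (rule cell_integral_measurable[OF N assms]) simp

lemma avg_cong:
  assumes "\<And>\<omega>. \<omega> \<in> space M \<Longrightarrow> (\<integral>\<^sup>+ x\<in>{0..<\<tau>}. f \<omega> x \<partial>N \<omega>) = g \<omega>"
  shows "avg N f = (\<integral>\<^sup>+ \<omega>. g \<omega> \<partial>M)"
  unfolding avg_def by (rule nn_integral_cong) (rule assms)

lemma avg_suminf:
  assumes f: "\<And>n. (\<lambda>(\<omega>, x). f n \<omega> x) \<in> borel_measurable (M \<Otimes>\<^sub>M borel)"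
  shows "avg N (\<lambda>\<omega> x. \<Sum>n. f n \<omega> x) = (\<Sum>n :: nat. avg N (f n))"
proof -
  have "avg N (\<lambda>\<omega> x. \<Sum>n. f n \<omega> x) = (\<integral>\<^sup>+ \<omega>. (\<Sum>n. \<integral>\<^sup>+ x\<in>{0..<\<tau>}. f n \<omega> x \<partial>N \<omega>) \<partial>M)"
  proof (rule avg_cong)
    fix \<omega> assume "\<omega> \<in> space M"
    note sets_N[measurable_cong] section_measurable[OF f this, measurable]
    show "(\<integral>\<^sup>+ x\<in>{0..<\<tau>}. (\<Sum>n. f n \<omega> x) \<partial>N \<omega>) = (\<Sum>n. \<integral>\<^sup>+ x\<in>{0..<\<tau>}. f n \<omega> x \<partial>N \<omega>)"
      by (subst nn_integral_suminf[symmetric]) (simp_all only: ennreal_suminf_multc, measurable)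
  qed
  also have "\<dots> = (\<Sum>n. avg N (f n))"
    unfolding avg_def by (rule nn_integral_suminf[OF inner_measurable[OF f]])
  finally show ?thesis .
qed

lemma avg_SUP:
  assumes f: "\<And>m. (\<lambda>(\<omega>, x). f m \<omega> x) \<in> borel_measurable (M \<Otimes>\<^sub>M borel)"
    and mono: "\<And>m \<omega> x. f m \<omega> x \<le> f (Suc m) \<omega> x"
  shows "avg N (\<lambda>\<omega> x. SUP m :: nat. f m \<omega> x) = (SUP m. avg N (f m))"
proof -
  have mono': "f m \<omega> x * indicator {0..<\<tau>} x \<le> f (Suc m) \<omega> x * indicator {0..<\<tau>} x" for m \<omega> x
    by (intro mult_right_mono mono) simp
  have "avg N (\<lambda>\<omega> x. SUP m. f m \<omega> x) = (\<integral>\<^sup>+ \<omega>. (SUP m. \<integral>\<^sup>+ x\<in>{0..<\<tau>}. f m \<omega> x \<partial>N \<omega>) \<partial>M)"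
  proof (rule avg_cong)
    fix \<omega> assume "\<omega> \<in> space M"
    note sets_N[measurable_cong] section_measurable[OF f this, measurable]
    show "(\<integral>\<^sup>+ x\<in>{0..<\<tau>}. (SUP m. f m \<omega> x) \<partial>N \<omega>) = (SUP m. \<integral>\<^sup>+ x\<in>{0..<\<tau>}. f m \<omega> x \<partial>N \<omega>)"
      unfolding SUP_mult_right_ennreal
      by (intro nn_integral_monotone_convergence_SUP incseq_SucI le_funI mono') measurable
  qed
  also have "\<dots> = (SUP m. avg N (f m))"
    unfolding avg_def
    by (intro nn_integral_monotone_convergence_SUP incseq_SucI le_funI nn_integral_mono mono' inner_measurable[OF f])
  finally show ?thesis .
qed

lemma avg_cmult:
  assumes f: "(\<lambda>(\<omega>, x). f \<omega> x) \<in> borel_measurable (M \<Otimes>\<^sub>M borel)"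
  shows "avg N (\<lambda>\<omega> x. c * f \<omega> x) = c * avg N f"
proof -
  have "avg N (\<lambda>\<omega> x. c * f \<omega> x) = (\<integral>\<^sup>+ \<omega>. c * (\<integral>\<^sup>+ x\<in>{0..<\<tau>}. f \<omega> x \<partial>N \<omega>) \<partial>M)"
  proof (rule avg_cong)
    fix \<omega> assume "\<omega> \<in> space M"
    note sets_N[measurable_cong] section_measurable[OF f this, measurable]
    show "(\<integral>\<^sup>+ x\<in>{0..<\<tau>}. (c * f \<omega> x) \<partial>N \<omega>) = c * (\<integral>\<^sup>+ x\<in>{0..<\<tau>}. f \<omega> x \<partial>N \<omega>)"
      unfolding mult.assoc by (rule nn_integral_cmult) measurable
  qed
  also have "\<dots> = c * avg N f"
    unfolding avg_def by (rule nn_integral_cmult[OF inner_measurable[OF f]])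
  finally show ?thesis .
qed

lemma avg_add:
  assumes f: "(\<lambda>(\<omega>, x). f \<omega> x) \<in> borel_measurable (M \<Otimes>\<^sub>M borel)" and g: "(\<lambda>(\<omega>, x). g \<omega> x) \<in> borel_measurable (M \<Otimes>\<^sub>M borel)"
  shows "avg N (\<lambda>\<omega> x. f \<omega> x + g \<omega> x) = avg N f + avg N g"
proof -
  have "avg N (\<lambda>\<omega> x. f \<omega> x + g \<omega> x) = (\<integral>\<^sup>+ \<omega>. (\<integral>\<^sup>+ x\<in>{0..<\<tau>}. f \<omega> x \<partial>N \<omega>) + (\<integral>\<^sup>+ x\<in>{0..<\<tau>}. g \<omega> x \<partial>N \<omega>) \<partial>M)"
  proof (rule avg_cong)
    fix \<omega> assume \<omega>: "\<omega> \<in> space M"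
    note sets_N[measurable_cong] section_measurable[OF f \<omega>, measurable] section_measurable[OF g \<omega>, measurable]
    show "(\<integral>\<^sup>+ x\<in>{0..<\<tau>}. (f \<omega> x + g \<omega> x) \<partial>N \<omega>) = (\<integral>\<^sup>+ x\<in>{0..<\<tau>}. f \<omega> x \<partial>N \<omega>) + (\<integral>\<^sup>+ x\<in>{0..<\<tau>}. g \<omega> x \<partial>N \<omega>)"
      unfolding distrib_right by (rule nn_integral_add) measurable
  qed
  also have "\<dots> = avg N f + avg N g"
    unfolding avg_def by (rule nn_integral_add[OF inner_measurable[OF f] inner_measurable[OF g]])
  finally show ?thesis .
qed

lemma avg_mono_AE:
  assumes "AE \<omega> in M. \<forall>x. f \<omega> x \<le> g \<omega> x"
  shows "avg N f \<le> avg N g"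
  unfolding avg_def
  by (rule nn_integral_mono_AE, use assms in eventually_elim) (intro nn_integral_mono mult_right_mono, auto)

end

lemma ennreal_momV_measurable: "(\<lambda>(\<omega>, x). ennreal (momV (K \<omega>) n j x)) \<in> borel_measurable (M \<Otimes>\<^sub>M borel)"
  using momV_measurable[of n j] by (simp add: case_prod_unfold)

lemma ennreal_momW_measurable: "(\<lambda>(\<omega>, x). ennreal (momW (K \<omega>) n j x)) \<in> borel_measurable (M \<Otimes>\<^sub>M borel)"
  using momW_measurable[of n j] by (simp add: case_prod_unfold)

text \<open>The mass sent from x to \<xi> is \<beta>(x - \<xi>) times the value at x of T^(j+1)
  \<beta>_\<xi>. Its marginals are \<open>transport_\<xi>\<close> and \<open>transport_x\<close>,
  whose exponents differ by one; positivity of the kernel entries makes it a genuine mass.\<close>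

lemma transport_base:
  "expV (\<lambda>\<omega> x. ennreal (momV (K \<omega>) 0 j x)) = expW (\<lambda>\<omega> \<xi>. ennreal (momW (K \<omega>) 0 (Suc j) \<xi>))"
proof -
  define Q where "Q \<omega> x \<xi> = ennreal (hbeta (x - \<xi>) * (kop (K \<omega>) ^^ Suc j) (\<lambda>x. hbeta (x - \<xi>)) x)" for \<omega> x \<xi>
  have "(\<lambda>w. (kop (K (fst (fst w))) ^^ Suc j) (\<lambda>x. hbeta (x - snd w)) (snd (fst w))) \<in> borel_measurable ((M \<Otimes>\<^sub>M borel) \<Otimes>\<^sub>M borel)"
    by (rule kop_pow_measurable'[of "\<lambda>w. fst (fst w)" _ "\<lambda>w x. hbeta (x - snd w)"]) measurable
  then have Q_meas: "(\<lambda>((\<omega>, x), \<xi>). Q \<omega> x \<xi>) \<in> borel_measurable ((M \<Otimes>\<^sub>M borel) \<Otimes>\<^sub>M borel)"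
    unfolding Q_def case_prod_unfold by measurable
  have Q_shift: "AE \<omega> in M. \<forall>x \<xi>. Q (Sh k \<omega>) x \<xi> = Q \<omega> (x + \<tau> * k) (\<xi> + \<tau> * k)" for k
    using K_shift[of k]
  proof eventually_elim
    case (elim \<omega>)
    show ?case
    proof (intro allI)
      fix x \<xi>
      have "(kop (K (Sh k \<omega>)) ^^ Suc j) (\<lambda>y. hbeta (y - \<xi>)) = (\<lambda>x. (kop (K \<omega>) ^^ Suc j) (\<lambda>y. hbeta (y - (\<xi> + \<tau> * k))) (x + \<tau> * k))"
        using kop_pow_shift[of "K (Sh k \<omega>)" "K \<omega>" "\<tau> * k" "Suc j" "\<lambda>y. hbeta (y - (\<xi> + \<tau> * k))"] elim by simp
      then show "Q (Sh k \<omega>) x \<xi> = Q \<omega> (x + \<tau> * k) (\<xi> + \<tau> * k)"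
        unfolding Q_def by simp
    qed
  qed
  show ?thesis
    using mass_transport[of Q, OF Q_meas Q_shift]
    unfolding Q_def avg_def
    by (simp only: hankel_measure.transport_\<xi>[OF hankel] hankel_measure.transport_x[OF hankel])
qed

lemma expV_finite: "expV (\<lambda>\<omega> x. ennreal (momV (K \<omega>) n j x)) < \<infinity>"
proof -
  have "expV (\<lambda>\<omega> x. ennreal (momV (K \<omega>) n j x)) \<le> (\<integral>\<^sup>+ \<omega>. ennreal (1 / 4) * ennreal \<tau> \<partial>M)"
    unfolding avg_def
  proof (rule nn_integral_mono)
    fix \<omega>
    have "(\<integral>\<^sup>+ x\<in>{0..<\<tau>}. ennreal (momV (K \<omega>) n j x) \<partial>lborel) \<le> (\<integral>\<^sup>+ x\<in>{0..<\<tau>}. ennreal (1 / 4) \<partial>lborel)"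
      by (intro nn_integral_mono mult_right_mono ennreal_leI hankel_measure.momV_bound[OF hankel]) simp
    also have "\<dots> = ennreal (1 / 4) * ennreal \<tau>"
      using \<tau> by (simp add: nn_integral_cmult_indicator)
    finally show "(\<integral>\<^sup>+ x\<in>{0..<\<tau>}. ennreal (momV (K \<omega>) n j x) \<partial>lborel) \<le> ennreal (1 / 4) * ennreal \<tau>" .
  qed
  also have "\<dots> < \<infinity>" by (simp add: emeasure_space_1 ennreal_mult_less_top)
  finally show ?thesis .
qed

text \<open>Both sides satisfy the same recursion in n. It involves a subtraction, legitimate for
  \<open>ennreal\<close> because the averages over Lebesgue measure are finite.\<close>

lemma transport:
  "expV (\<lambda>\<omega> x. ennreal (momV (K \<omega>) n j x)) = expW (\<lambda>\<omega> \<xi>. ennreal (momW (K \<omega>) n (Suc j) \<xi>))"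
proof (induction n arbitrary: j)
  case 0
  show ?case by (rule transport_base)
next
  case (Suc n)
  let ?V = "\<lambda>n j. expV (\<lambda>\<omega> x. ennreal (momV (K \<omega>) n j x))"
  let ?W = "\<lambda>n j. expW (\<lambda>\<omega> \<xi>. ennreal (momW (K \<omega>) n (Suc j) \<xi>))"
  have "?V n (Suc j) + ?V (Suc n) j = ?V n j"
  proof -
    have "ennreal (momV (K \<omega>) n j x) = ennreal (momV (K \<omega>) n (Suc j) x) + ennreal (momV (K \<omega>) (Suc n) j x)" for \<omega> x
      by (subst ennreal_plus[symmetric]) (auto intro: hankel_measure.momV_nonneg[OF hankel] hankel_measure.momV_nonneg[OF hankel, of _ "Suc n", simplified])
    then show ?thesis
      by (simp only: avg_add[OF borel_kernel_lborel ennreal_momV_measurable ennreal_momV_measurable, symmetric])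
  qed
  moreover have "?W n (Suc j) + ?W (Suc n) j = ?W n j"
  proof -
    have "ennreal (momW (K \<omega>) n (Suc j) x) = ennreal (momW (K \<omega>) n (Suc (Suc j)) x) + ennreal (momW (K \<omega>) (Suc n) (Suc j) x)" for \<omega> x
      by (subst ennreal_plus[symmetric]) (auto intro: hankel_measure.momW_nonneg[OF hankel] hankel_measure.momW_nonneg[OF hankel, of _ "Suc n", simplified])
    then show ?thesis
      by (simp only: avg_add[OF borel_kernel_\<Sigma> ennreal_momW_measurable ennreal_momW_measurable, symmetric])
  qed
  ultimately have "?V n (Suc j) + ?V (Suc n) j = ?V n (Suc j) + ?W (Suc n) j"
    unfolding Suc.IH by simp
  moreover have "?V n (Suc j) \<noteq> \<infinity>" using expV_finite[of n "Suc j"] by simp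
  ultimately show ?case by (simp only: ennreal_add_left_cancel simp_thms)
qed

definition G :: "'a \<Rightarrow> real \<Rightarrow> ennreal" where
  "G \<omega> \<xi> = (\<Sum>n. ennreal (momW (K \<omega>) n 0 \<xi>))"

lemma G_measurable: "(\<lambda>(\<omega>, \<xi>). G \<omega> \<xi>) \<in> borel_measurable (M \<Otimes>\<^sub>M borel)"
proof -
  have "(\<lambda>p. \<Sum>n. ennreal (momW (K (fst p)) n 0 (snd p))) \<in> borel_measurable (M \<Otimes>\<^sub>M borel)"
    using ennreal_momW_measurable by (intro borel_measurable_suminf_order) (simp add: case_prod_unfold)
  then show ?thesis by (simp add: G_def case_prod_unfold)
qed

text \<open>Transport raises the exponent of T from 0 to 1. The resulting series agrees with G only
  on the support of \<Sigma> \<omega>, which is enough since the support carries the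
  measure.\<close>

lemma transport_series:
  "expV (\<lambda>\<omega> x. \<Sum>n. ennreal (real (Suc n) * momV (K \<omega>) n 0 x)) = expW G"
proof -
  have split: "ennreal (real (Suc n) * y) = ennreal (real (Suc n)) * ennreal y" if "0 \<le> y" for n y
    using that by (intro ennreal_mult) auto
  have meas: "(\<lambda>(\<omega>, x). ennreal (real (Suc n) * momV (K \<omega>) n j x)) \<in> borel_measurable (M \<Otimes>\<^sub>M borel)"
    "(\<lambda>(\<omega>, x). ennreal (real (Suc n) * momW (K \<omega>) n j x)) \<in> borel_measurable (M \<Otimes>\<^sub>M borel)" for n j
    using momV_measurable[of n j] momW_measurable[of n j] by (simp_all add: case_prod_unfold del: of_nat_Suc)
  have "expV (\<lambda>\<omega> x. \<Sum>n. ennreal (real (Suc n) * momV (K \<omega>) n 0 x))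
      = (\<Sum>n. expV (\<lambda>\<omega> x. ennreal (real (Suc n) * momV (K \<omega>) n 0 x)))"
    by (rule avg_suminf[OF borel_kernel_lborel meas(1)])
  also have "\<dots> = (\<Sum>n. expW (\<lambda>\<omega> \<xi>. ennreal (real (Suc n) * momW (K \<omega>) n 1 \<xi>)))"
    by (simp only: split hankel_measure.momV_nonneg[OF hankel] hankel_measure.momW_nonneg[OF hankel]
        avg_cmult[OF borel_kernel_lborel ennreal_momV_measurable] avg_cmult[OF borel_kernel_\<Sigma> ennreal_momW_measurable] transport One_nat_def)
  also have "\<dots> = expW (\<lambda>\<omega> \<xi>. \<Sum>n. ennreal (real (Suc n) * momW (K \<omega>) n 1 \<xi>))"
    by (rule avg_suminf[OF borel_kernel_\<Sigma> meas(2), symmetric])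
  also have "\<dots> = expW G"
    unfolding avg_def
  proof (rule nn_integral_cong)
    fix \<omega>
    show "(\<integral>\<^sup>+ \<xi>\<in>{0..<\<tau>}. (\<Sum>n. ennreal (real (Suc n) * momW (K \<omega>) n 1 \<xi>)) \<partial>\<Sigma> \<omega>) = (\<integral>\<^sup>+ \<xi>\<in>{0..<\<tau>}. G \<omega> \<xi> \<partial>\<Sigma> \<omega>)"
      by (rule nn_integral_cong_AE, use AE_measure_support[OF sets_\<Sigma>] in eventually_elim)
        (simp only: G_def hankel_measure.suminf_momW_1[OF hankel])
  qed
  finally show ?thesis .
qed

lemma G_support: "\<xi> \<in> measure_support (\<Sigma> \<omega>) \<Longrightarrow> G \<omega> \<xi> = inverse (emeasure (\<Sigma> \<omega>) {\<xi>})"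
  unfolding G_def by (rule hankel_measure.suminf_momW_0[OF hankel])

text \<open>By stationarity the mean over any cell is that over the first, so one finite mean makes
  the integrals over all cells finite almost surely.\<close>

lemma cell_integral_G: "(\<integral>\<^sup>+ \<omega>. (\<integral>\<^sup>+ \<xi>\<in>cell k. G \<omega> \<xi> \<partial>\<Sigma> \<omega>) \<partial>M) = expW G"
proof -
  have meas: "(\<lambda>\<omega>. \<integral>\<^sup>+ \<xi>\<in>cell k. G \<omega> \<xi> \<partial>\<Sigma> \<omega>) \<in> borel_measurable M" for k
    by (rule cell_integral_measurable[OF borel_kernel_\<Sigma> G_measurable]) simp
  have "AE \<omega> in M. (\<integral>\<^sup>+ \<xi>\<in>cell 0. G (Sh k \<omega>) \<xi> \<partial>\<Sigma> (Sh k \<omega>)) = (\<integral>\<^sup>+ \<xi>\<in>cell k. G \<omega> \<xi> \<partial>\<Sigma> \<omega>)"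
    using K_shift[of k] \<Sigma>_shift[of k] AE_space
  proof eventually_elim
    case (elim \<omega>)
    have [measurable]: "G \<omega> \<in> borel_measurable borel" using section_measurable[OF G_measurable elim(3)] by simp
    have "G (Sh k \<omega>) \<xi> = G \<omega> (\<xi> + \<tau> * k)" for \<xi>
      using momW_shift[of "K (Sh k \<omega>)" "K \<omega>" "\<tau> * k"] elim(1) by (simp add: G_def)
    moreover have "indicator (cell 0) \<xi> = (indicator (cell k) (\<xi> + \<tau> * k) :: ennreal)" for \<xi>
      using indicator_cell_shift[of 0 \<xi> k] by simp
    ultimately have "(\<integral>\<^sup>+ \<xi>\<in>cell 0. G (Sh k \<omega>) \<xi> \<partial>\<Sigma> (Sh k \<omega>))
      = (\<integral>\<^sup>+ \<xi>. G \<omega> (\<xi> + \<tau> * k) * indicator (cell k) (\<xi> + \<tau> * k) \<partial>distr (\<Sigma> \<omega>) borel (\<lambda>\<xi>. \<xi> - \<tau> * k))"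
      by (simp only: elim(2))
    also have "\<dots> = (\<integral>\<^sup>+ \<xi>\<in>cell k. G \<omega> \<xi> \<partial>\<Sigma> \<omega>)"
      by (subst nn_integral_distr) auto
    finally show ?case .
  qed
  then have "(\<integral>\<^sup>+ \<omega>. (\<integral>\<^sup>+ \<xi>\<in>cell k. G \<omega> \<xi> \<partial>\<Sigma> \<omega>) \<partial>M) = (\<integral>\<^sup>+ \<omega>. (\<integral>\<^sup>+ \<xi>\<in>cell 0. G (Sh k \<omega>) \<xi> \<partial>\<Sigma> (Sh k \<omega>)) \<partial>M)"
    by (intro nn_integral_cong_AE) auto
  also have "\<dots> = (\<integral>\<^sup>+ \<omega>. (\<integral>\<^sup>+ \<xi>\<in>cell 0. G \<omega> \<xi> \<partial>\<Sigma> \<omega>) \<partial>M)"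
    by (rule expectation_shift[OF meas])
  finally show ?thesis by (simp add: avg_def)
qed

text \<open>One inequality is pointwise and settles the case of an infinite mean. If the mean is
  finite, the integrals over the countably many cells are almost surely finite together, and the two
  integrands agree. Only monotonicity and almost sure equality are used for the cardinality, whose
  measurability has not been established.\<close>

lemma expW_G: "expW G = (\<integral>\<^sup>+ \<omega>. ecard (measure_support (\<Sigma> \<omega>) \<inter> {0..<\<tau>}) \<partial>M)"
proof (rule antisym)
  have G_section: "G \<omega> \<in> borel_measurable borel" if "\<omega> \<in> space M" for \<omega>
    using section_measurable[OF G_measurable that] by simp
  show le: "expW G \<le> (\<integral>\<^sup>+ \<omega>. ecard (measure_support (\<Sigma> \<omega>) \<inter> {0..<\<tau>}) \<partial>M)"
    unfolding avg_def
    by (intro nn_integral_mono nn_integral_le_ecard sets_\<Sigma> hankel_measure.emeasure_Icc_finite[OF hankel] G_section G_support)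
  show "(\<integral>\<^sup>+ \<omega>. ecard (measure_support (\<Sigma> \<omega>) \<inter> {0..<\<tau>}) \<partial>M) \<le> expW G"
  proof (cases "expW G = \<infinity>")
    case False
    have "AE \<omega> in M. \<forall>k. (\<integral>\<^sup>+ \<xi>\<in>cell k. G \<omega> \<xi> \<partial>\<Sigma> \<omega>) \<noteq> \<infinity>"
      unfolding AE_all_countable
    proof
      fix k
      show "AE \<omega> in M. (\<integral>\<^sup>+ \<xi>\<in>cell k. G \<omega> \<xi> \<partial>\<Sigma> \<omega>) \<noteq> \<infinity>"
        using False cell_integral_G[of k]
        by (intro nn_integral_noteq_infinite cell_integral_measurable[OF borel_kernel_\<Sigma> G_measurable]) auto
    qed
    then have "AE \<omega> in M. ecard (measure_support (\<Sigma> \<omega>) \<inter> {0..<\<tau>}) = (\<integral>\<^sup>+ \<xi>\<in>{0..<\<tau>}. G \<omega> \<xi> \<partial>\<Sigma> \<omega>)"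
      using AE_space
    proof eventually_elim
      case (elim \<omega>)
      show ?case
        by (rule nn_integral_eq_ecard[symmetric, OF sets_\<Sigma> hankel_measure.emeasure_Icc_finite[OF hankel] G_section[OF elim(2)] G_support \<tau>])
          (use elim(1) in \<open>auto simp: less_top\<close>)
    qed
    then show ?thesis unfolding avg_def by (subst nn_integral_cong_AE) auto
  qed simp
qed

theorem expV_eq_density:
  "expV (\<lambda>\<omega> x. \<Sum>n. ennreal (real (Suc n) * momV (K \<omega>) n 0 x)) = (\<integral>\<^sup>+ \<omega>. ecard (measure_support (\<Sigma> \<omega>) \<inter> {0..<\<tau>}) \<partial>M)"
  by (simp only: transport_series expW_G)

end

text \<open>The polynomials depend on \<kappa> and \<epsilon> but not on the kernel. The diagonal of
  the spectral kernel is therefore one and the same limit for all \<omega>, which yields its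
  measurability and its covariance.\<close>

lemma ex_spectral_polynomials:
  assumes "0 < \<kappa>" "0 < \<epsilon>"
  shows "\<exists>a d. \<forall>k K x. scaled_kernel k K \<kappa> \<longrightarrow>
    (\<lambda>n. \<Sum>i\<le>d n. a n i * momV k 0 i x) \<longlonglongrightarrow> spec_kernel K {\<epsilon>..} x x"
proof -
  obtain a d D where ad: "\<And>n s. s \<in> {0..1} \<Longrightarrow> \<bar>\<Sum>i\<le>d n. a n i * s ^ i\<bar> \<le> D"
    "\<And>s. s \<in> {0..1} \<Longrightarrow> (\<lambda>n. \<Sum>i\<le>d n. a n i * s ^ i) \<longlonglongrightarrow> inv_sq (\<kappa> * \<epsilon>) s"
    using polynomial_sequence_inv_sq[of "\<kappa> * \<epsilon>"] assms by (auto simp: Ball_def)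
  have "(\<lambda>n. \<Sum>i\<le>d n. a n i * momV k 0 i x) \<longlonglongrightarrow> spec_kernel K {\<epsilon>..} x x"
    if "scaled_kernel k K \<kappa>" for k K x
  proof -
    interpret scaled_kernel k K \<kappa> by fact
    have "momV k 0 i x = ip ((T ^^ i) (V x)) (V x)" for i
      unfolding momV_eq by (simp only: mom_def funpow_0)
    then show ?thesis using spec_kernel_tendsto[OF assms(2) ad] by simp
  qed
  then show ?thesis by blast
qed

lemma hankel_measure_zero: "hankel_measure (\<lambda>_. 0) (null_measure borel)"
  by standard (auto simp: hankel_kernel_def kop_def l2_inner_def)

lemma l2_inner_kop_self:
  "l2_inner (kop K f) f = (LINT y|lborel. LINT z|lborel. K y z * f y * f z)"
proof -
  have "(LINT z|lborel. K y z * f z) * f y = (LINT z|lborel. K y z * f y * f z)" for y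
  proof -
    have "(\<lambda>z. K y z * f y * f z) = (\<lambda>z. K y z * f z * f y)" by (simp add: ac_simps)
    then show ?thesis by simp
  qed
  then show ?thesis by (simp add: l2_inner_def kop_def)
qed

lemma tent_shift: "tent x n y = tent (x + c) n (y + c)"
  by (simp add: tent_def)

text \<open>The factor \<open>\<kappa>\<close> makes the operators contractions.\<close>

locale normalised_hankel = prob_space M for M :: "'a measure" +
  fixes Gr :: "real set" and T :: "real \<Rightarrow> 'a \<Rightarrow> 'a" and \<tau> :: real
    and h :: "'a \<Rightarrow> real \<Rightarrow> real" and \<Sigma> :: "'a \<Rightarrow> real measure" and \<kappa> :: real and \<Omega> :: "'a set"
  assumes \<tau>: "0 < \<tau>"
    and Gr: "Gr = UNIV \<or> Gr = range real_of_int"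
    and T_measurable: "a \<in> Gr \<Longrightarrow> T a \<in> measurable M M"
    and T_distr: "a \<in> Gr \<Longrightarrow> distr M M (T a) = M"
    and weak: "sq_int f \<Longrightarrow> sq_int g \<Longrightarrow>
      (\<lambda>\<omega>. l2_inner (kop (hankel_kernel (h \<omega>)) f) g) \<in> borel_measurable M"
    and cov: "a \<in> Gr \<Longrightarrow> \<omega> \<in> space M \<Longrightarrow> sq_int f \<Longrightarrow>
      AE x in lborel. kop (hankel_kernel (h (T a \<omega>))) (\<lambda>\<xi>. f (\<xi> + \<tau> * a)) x = kop (hankel_kernel (h \<omega>)) f (x + \<tau> * a)"
    and \<Omega>: "\<Omega> \<in> sets M" "AE \<omega> in M. \<omega> \<in> \<Omega>"
    and \<kappa>: "0 < \<kappa>"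
    and good: "\<omega> \<in> \<Omega> \<Longrightarrow> hankel_measure (\<lambda>t. \<kappa> * h \<omega> t) (density (\<Sigma> \<omega>) (\<lambda>_. ennreal \<kappa>))"
begin

abbreviation H :: "'a \<Rightarrow> real \<Rightarrow> real \<Rightarrow> real" where
  "H \<omega> \<equiv> hankel_kernel (h \<omega>)"

text \<open>Off the good set \<open>\<Omega>\<close> the data are replaced by the zero operator, so that every \<open>\<omega>\<close> is good.\<close>

definition h' :: "'a \<Rightarrow> real \<Rightarrow> real" where
  "h' \<omega> = (if \<omega> \<in> \<Omega> then (\<lambda>t. \<kappa> * h \<omega> t) else (\<lambda>_. 0))"

definition \<Sigma>' :: "'a \<Rightarrow> real measure" where
  "\<Sigma>' \<omega> = (if \<omega> \<in> \<Omega> then density (\<Sigma> \<omega>) (\<lambda>_. ennreal \<kappa>) else null_measure borel)"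

lemma hankel': "hankel_measure (h' \<omega>) (\<Sigma>' \<omega>)"
  using good hankel_measure_zero by (simp add: h'_def \<Sigma>'_def)

lemma kernel_scale: "\<omega> \<in> \<Omega> \<Longrightarrow> hankel_kernel (h' \<omega>) x y = \<kappa> * H \<omega> x y"
  by (simp add: h'_def hankel_kernel_def)

lemma scaled: "\<omega> \<in> \<Omega> \<Longrightarrow> scaled_kernel (hankel_kernel (h' \<omega>)) (H \<omega>) \<kappa>"
  by (intro scaled_kernel.intro scaled_kernel_axioms.intro kernel_scale \<kappa>
      hankel_measure.contraction_kernel_hankel[OF hankel'] hankel_measure.kernel_isCont[OF hankel'])

text \<open>The hypotheses on the family concern matrix elements and almost everywhere identities;
  continuity of the kernel lets bumps extract pointwise values from them.\<close>

lemma H_diag_tendsto: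
  assumes "\<omega> \<in> \<Omega>"
  shows "(\<lambda>n. l2_inner (kop (H \<omega>) (tent x n)) (tent x n) / (LINT y|lborel. tent x n y)\<^sup>2) \<longlonglongrightarrow> H \<omega> x x"
proof -
  have "continuous_on UNIV (\<lambda>p. (1 / \<kappa>) * (case p of (x, y) \<Rightarrow> hankel_kernel (h' \<omega>) x y))"
    by (intro continuous_intros hankel_measure.kernel_continuous[OF hankel'])
  then have "continuous_on UNIV (\<lambda>(x, y). H \<omega> x y)"
    using \<kappa> by (simp add: case_prod_unfold kernel_scale[OF assms])
  from tent_average_tendsto[OF this] show ?thesis by (simp only: l2_inner_kop_self)
qed

text \<open>Every t > 0 is exp x + exp x for x = ln (t / 2), so the diagonal of the kernel already
  determines h.\<close>

lemma H_diag: "0 < t \<Longrightarrow> H \<omega> (ln (t / 2)) (ln (t / 2)) = t / 2 * h \<omega> t"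
  by (simp add: hankel_kernel_def)

lemma h'_measurable:
  assumes t: "0 < t"
  shows "(\<lambda>\<omega>. h' \<omega> t) \<in> borel_measurable M"
proof (rule borel_measurable_LIMSEQ_real)
  define x where "x = ln (t / 2)"
  let ?u = "\<lambda>n \<omega>. if \<omega> \<in> \<Omega> then \<kappa> * (2 / t) * (l2_inner (kop (H \<omega>) (tent x n)) (tent x n) / (LINT y|lborel. tent x n y)\<^sup>2) else 0"
  show "?u n \<in> borel_measurable M" for n
    using weak[OF tent_sq_int[of x n] tent_sq_int[of x n]] \<Omega>(1)
    by (intro measurable_If_set borel_measurable_times borel_measurable_divide) (auto simp: sets.Int_space_eq2)
  show "(\<lambda>n. ?u n \<omega>) \<longlonglongrightarrow> h' \<omega> t" for \<omega>
  proof (cases "\<omega> \<in> \<Omega>")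
    case True
    have "(\<lambda>n. \<kappa> * (2 / t) * (l2_inner (kop (H \<omega>) (tent x n)) (tent x n) / (LINT y|lborel. tent x n y)\<^sup>2))
        \<longlonglongrightarrow> \<kappa> * (2 / t) * H \<omega> x x"
      by (intro tendsto_mult_left H_diag_tendsto True)
    moreover have "\<kappa> * (2 / t) * H \<omega> x x = h' \<omega> t"
      using t True by (simp add: x_def H_diag h'_def)
    ultimately show ?thesis using True by simp
  qed (simp add: h'_def)
qed

lemma T_\<Omega>:
  assumes "a \<in> Gr"
  shows "AE \<omega> in M. T a \<omega> \<in> \<Omega>"
proof -
  have "AE \<omega> in distr M M (T a). \<omega> \<in> \<Omega>"
    unfolding T_distr[OF assms] by (rule \<Omega>(2))
  then show ?thesis by (rule AE_distrD[OF T_measurable[OF assms]])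
qed

lemma kop_H_measurable:
  assumes "\<omega> \<in> \<Omega>" "f \<in> borel_measurable borel"
  shows "kop (H \<omega>) f \<in> borel_measurable borel"
proof -
  interpret scaled_kernel "hankel_kernel (h' \<omega>)" "H \<omega>" \<kappa> by (rule scaled[OF assms(1)])
  have [measurable]: "kop (hankel_kernel (h' \<omega>)) f \<in> borel_measurable borel"
    by (rule kop_measurable[OF assms(2)])
  show ?thesis unfolding kop_K by measurable
qed

text \<open>The covariance of the operators is tested on bumps around x + c, with c = \<tau> a. This
  shifts the diagonal of the kernel by c and hence rescales h by exp c, for every t rather than
  almost every t.\<close>

lemma h'_shift:
  assumes a: "a \<in> Gr"
  shows "AE \<omega> in M. \<omega> \<in> \<Omega> \<and> T a \<omega> \<in> \<Omega> \<and> (\<forall>t>0. h' (T a \<omega>) t = exp (\<tau> * a) * h' \<omega> (exp (\<tau> * a) * t))"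
  using \<Omega>(2) T_\<Omega>[OF a] AE_space
proof eventually_elim
  case (elim \<omega>)
  define c where "c = \<tau> * a"
  have diag: "H (T a \<omega>) x x = H \<omega> (x + c) (x + c)" for x
  proof -
    have "l2_inner (kop (H (T a \<omega>)) (tent x n)) (tent x n) = l2_inner (kop (H \<omega>) (tent (x + c) n)) (tent (x + c) n)" for n
    proof -
      note [measurable] = kop_H_measurable[OF elim(1)] kop_H_measurable[OF elim(2)]
      let ?f = "tent (x + c) n"
      have tent: "tent x n = (\<lambda>\<xi>. ?f (\<xi> + c))" by (rule ext, rule tent_shift)
      have "AE y in lborel. kop (H (T a \<omega>)) (tent x n) y = kop (H \<omega>) ?f (y + c)"
        using cov[OF a elim(3) tent_sq_int[of "x + c" n]] unfolding tent c_def .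
      then have "l2_inner (kop (H (T a \<omega>)) (tent x n)) (tent x n) = (LINT y|lborel. kop (H \<omega>) ?f (y + c) * ?f (y + c))"
        unfolding l2_inner_def
        by (intro integral_cong_AE) (auto elim!: eventually_mono simp: tent)
      also have "\<dots> = l2_inner (kop (H \<omega>) ?f) ?f"
        unfolding l2_inner_def by (rule lborel_integral_shift)
      finally show ?thesis .
    qed
    moreover have "(LINT y|lborel. tent x n y) = (LINT y|lborel. tent (x + c) n y)" for n
      unfolding tent_shift[of x n _ c] by (rule lborel_integral_shift)
    ultimately show ?thesis
      using LIMSEQ_unique[OF H_diag_tendsto[OF elim(2), of x]] H_diag_tendsto[OF elim(1), of "x + c"] by simp
  qed
  have "h' (T a \<omega>) t = exp c * h' \<omega> (exp c * t)" if t: "0 < t" for t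
  proof -
    have "ln (t / 2) + c = ln (exp c * t / 2)"
      using t by (simp add: ln_mult ln_div)
    then have "t / 2 * h (T a \<omega>) t = exp c * t / 2 * h \<omega> (exp c * t)"
      using diag[of "ln (t / 2)"] H_diag[OF t] H_diag[of "exp c * t" \<omega>] t by simp
    then show ?thesis using t elim by (simp add: h'_def)
  qed
  then show ?case using elim by (simp add: c_def)
qed

lemma int_in_Gr: "real_of_int k \<in> Gr"
  using Gr by auto

sublocale S: stationary_hankel M "\<lambda>k. T (real_of_int k)" \<tau> h' \<Sigma>'
proof (intro stationary_hankel.intro stationary_hankel_axioms.intro prob_space_axioms \<tau> hankel' h'_measurable
    T_measurable T_distr int_in_Gr)
  show "AE \<omega> in M. \<forall>t>0. h' (T (real_of_int k) \<omega>) t = exp (\<tau> * k) * h' \<omega> (exp (\<tau> * k) * t)" for k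
    using h'_shift[OF int_in_Gr[of k]] by eventually_elim blast
qed

text \<open>Off \<Omega> nothing is known about the choice made in \<open>spec_kernel\<close>; the
  value 0 there allows joint measurability to be proved.\<close>

definition proj_diag :: "real \<Rightarrow> 'a \<Rightarrow> real \<Rightarrow> ennreal" where
  "proj_diag \<epsilon> \<omega> x = (if \<omega> \<in> \<Omega> then ennreal (spec_kernel (H \<omega>) {\<epsilon>..} x x) else 0)"

lemma proj_diag_measurable:
  assumes "0 < \<epsilon>"
  shows "(\<lambda>(\<omega>, x). proj_diag \<epsilon> \<omega> x) \<in> borel_measurable (M \<Otimes>\<^sub>M borel)"
proof -
  obtain a d where ad: "\<And>\<omega> x. \<omega> \<in> \<Omega> \<Longrightarrow> (\<lambda>n. \<Sum>i\<le>d n. a n i * momV (hankel_kernel (h' \<omega>)) 0 i x) \<longlonglongrightarrow> spec_kernel (H \<omega>) {\<epsilon>..} x x"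
  proof -
    obtain a d where "\<forall>k K x. scaled_kernel k K \<kappa> \<longrightarrow>
        (\<lambda>n. \<Sum>i\<le>d n. a n i * momV k 0 i x) \<longlonglongrightarrow> spec_kernel K {\<epsilon>..} x x"
      using ex_spectral_polynomials[OF \<kappa> assms] by blast
    then have "\<And>\<omega> x. \<omega> \<in> \<Omega> \<Longrightarrow> (\<lambda>n. \<Sum>i\<le>d n. a n i * momV (hankel_kernel (h' \<omega>)) 0 i x) \<longlonglongrightarrow> spec_kernel (H \<omega>) {\<epsilon>..} x x"
      using scaled by blast
    then show ?thesis by (rule that)
  qed
  have [measurable]: "(\<lambda>p. momV (hankel_kernel (h' (fst p))) 0 i (snd p)) \<in> borel_measurable (M \<Otimes>\<^sub>M borel)" for i
    using S.momV_measurable[of 0 i] by (simp add: case_prod_unfold)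
  note [measurable] = \<Omega>(1)
  have "(\<lambda>p. if fst p \<in> \<Omega> then spec_kernel (H (fst p)) {\<epsilon>..} (snd p) (snd p) else 0) \<in> borel_measurable (M \<Otimes>\<^sub>M borel)"
  proof (rule borel_measurable_LIMSEQ_real[where u="\<lambda>n p. if fst p \<in> \<Omega> then \<Sum>i\<le>d n. a n i * momV (hankel_kernel (h' (fst p))) 0 i (snd p) else 0"])
    show "(\<lambda>n. if fst p \<in> \<Omega> then \<Sum>i\<le>d n. a n i * momV (hankel_kernel (h' (fst p))) 0 i (snd p) else 0)
      \<longlonglongrightarrow> (if fst p \<in> \<Omega> then spec_kernel (H (fst p)) {\<epsilon>..} (snd p) (snd p) else 0)" for p
      using ad[of "fst p" "snd p"] by (cases "fst p \<in> \<Omega>") (simp_all del: momV.simps)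
    show "(\<lambda>p. if fst p \<in> \<Omega> then \<Sum>i\<le>d n. a n i * momV (hankel_kernel (h' (fst p))) 0 i (snd p) else 0)
      \<in> borel_measurable (M \<Otimes>\<^sub>M borel)" for n
      by measurable
  qed
  then have "(\<lambda>p. ennreal (if fst p \<in> \<Omega> then spec_kernel (H (fst p)) {\<epsilon>..} (snd p) (snd p) else 0)) \<in> borel_measurable (M \<Otimes>\<^sub>M borel)"
    by (rule measurable_compose[OF _ measurable_ennreal])
  also have "(\<lambda>p. ennreal (if fst p \<in> \<Omega> then spec_kernel (H (fst p)) {\<epsilon>..} (snd p) (snd p) else 0)) = (\<lambda>(\<omega>, x). proj_diag \<epsilon> \<omega> x)"
    by (auto simp: proj_diag_def)
  finally show ?thesis .
qed

lemma proj_diag_shift: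
  assumes "a \<in> Gr" "0 < \<epsilon>"
  shows "AE \<omega> in M. proj_diag \<epsilon> (T a \<omega>) x = proj_diag \<epsilon> \<omega> (x + \<tau> * a)"
  using h'_shift[OF assms(1)]
proof eventually_elim
  case (elim \<omega>)
  obtain b d where lim: "\<And>\<omega> x. \<omega> \<in> \<Omega> \<Longrightarrow> (\<lambda>n. \<Sum>i\<le>d n. b n i * momV (hankel_kernel (h' \<omega>)) 0 i x) \<longlonglongrightarrow> spec_kernel (H \<omega>) {\<epsilon>..} x x"
  proof -
    obtain b d where "\<forall>k K x. scaled_kernel k K \<kappa> \<longrightarrow>
        (\<lambda>n. \<Sum>i\<le>d n. b n i * momV k 0 i x) \<longlonglongrightarrow> spec_kernel K {\<epsilon>..} x x"
      using ex_spectral_polynomials[OF \<kappa> assms(2)] by blast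
    then have "\<And>\<omega> x. \<omega> \<in> \<Omega> \<Longrightarrow> (\<lambda>n. \<Sum>i\<le>d n. b n i * momV (hankel_kernel (h' \<omega>)) 0 i x) \<longlonglongrightarrow> spec_kernel (H \<omega>) {\<epsilon>..} x x"
      using scaled by blast
    then show ?thesis by (rule that)
  qed
  have "hankel_kernel (h' (T a \<omega>)) x y = hankel_kernel (h' \<omega>) (x + \<tau> * a) (y + \<tau> * a)" for x y
    using elim by (intro hankel_kernel_shift) blast
  then have eq: "momV (hankel_kernel (h' (T a \<omega>))) 0 i x = momV (hankel_kernel (h' \<omega>)) 0 i (x + \<tau> * a)" for i
    by (rule momV_shift)
  have "spec_kernel (H (T a \<omega>)) {\<epsilon>..} x x = spec_kernel (H \<omega>) {\<epsilon>..} (x + \<tau> * a) (x + \<tau> * a)"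
    using elim LIMSEQ_unique[OF lim[of "T a \<omega>" x, unfolded eq] lim[of \<omega> "x + \<tau> * a"]] by blast
  then show ?case using elim by (simp add: proj_diag_def)
qed

lemma proj_diag_eq: "AE \<omega> in M. \<forall>x. ennreal (spec_kernel (H \<omega>) {\<epsilon>..} x x) = proj_diag \<epsilon> \<omega> x"
  using \<Omega>(2) by eventually_elim (simp add: proj_diag_def)

text \<open>In the continuous case \<open>ids\<close> evaluates at 0 alone; shifting by x / \<tau>
  shows that the mean is the same at every x, hence equal to its average over a cell. In the
  discrete case the closed and the half-open cell differ by a null set.\<close>

lemma ids_eq:
  assumes \<epsilon>: "0 < \<epsilon>"
  shows "ids M \<tau> Gr H {\<epsilon>..} = ennreal (1 / \<tau>) * S.expV (proj_diag \<epsilon>)"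
proof (cases "Gr = UNIV")
  case True
  interpret P: pair_sigma_finite M lborel
    by (intro pair_sigma_finite.intro sigma_finite_measure_axioms lborel.sigma_finite_measure_axioms)
  define c where "c = (\<integral>\<^sup>+ \<omega>. proj_diag \<epsilon> \<omega> 0 \<partial>M)"
  have pd_meas: "(\<lambda>\<omega>. proj_diag \<epsilon> \<omega> x) \<in> borel_measurable M" for x
    using measurable_compose[OF measurable_Pair2'[of x borel] proj_diag_measurable[OF \<epsilon>]]
    by simp
  have const: "(\<integral>\<^sup>+ \<omega>. proj_diag \<epsilon> \<omega> x \<partial>M) = c" for x
  proof -
    have mem: "x / \<tau> \<in> Gr" using True by simp
    have "c = (\<integral>\<^sup>+ \<omega>. proj_diag \<epsilon> (T (x / \<tau>) \<omega>) 0 \<partial>M)"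
      unfolding c_def
      using nn_integral_distr[OF T_measurable[OF mem] , of "\<lambda>\<omega>. proj_diag \<epsilon> \<omega> 0"] pd_meas by (simp add: T_distr[OF mem])
    also have "\<dots> = (\<integral>\<^sup>+ \<omega>. proj_diag \<epsilon> \<omega> x \<partial>M)"
      using proj_diag_shift[OF mem \<epsilon>, of 0] \<tau> by (intro nn_integral_cong_AE) simp
    finally show ?thesis ..
  qed
  have "S.expV (proj_diag \<epsilon>) = (\<integral>\<^sup>+ x. (\<integral>\<^sup>+ \<omega>. proj_diag \<epsilon> \<omega> x * indicator {0..<\<tau>} x \<partial>M) \<partial>lborel)"
    unfolding S.avg_def
  proof (rule P.Fubini'[symmetric])
    note proj_diag_measurable[OF \<epsilon>, measurable]
    show "(\<lambda>(\<omega>, x). proj_diag \<epsilon> \<omega> x * indicator {0..<\<tau>} x) \<in> borel_measurable (M \<Otimes>\<^sub>M lborel)"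
      by (simp add: case_prod_unfold) measurable
  qed
  also have "\<dots> = (\<integral>\<^sup>+ x. c * indicator {0..<\<tau>} x \<partial>lborel)"
    by (simp only: nn_integral_multc[OF pd_meas] const)
  also have "\<dots> = c * ennreal \<tau>"
    using \<tau> by (simp add: nn_integral_cmult_indicator)
  finally have "ennreal (1 / \<tau>) * S.expV (proj_diag \<epsilon>) = c * (ennreal (1 / \<tau>) * ennreal \<tau>)"
    by (simp add: ac_simps)
  also have "ennreal (1 / \<tau>) * ennreal \<tau> = 1"
    using \<tau> by (simp add: ennreal_mult[symmetric])
  finally have "ennreal (1 / \<tau>) * S.expV (proj_diag \<epsilon>) = c" by simp
  moreover have "ids M \<tau> Gr H {\<epsilon>..} = c"
    unfolding ids_def c_def using True proj_diag_eq[of \<epsilon>]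
    by (simp, intro nn_integral_cong_AE) (auto elim: eventually_mono)
  ultimately show ?thesis by simp
next
  case False
  have "ids M \<tau> Gr H {\<epsilon>..} = (\<integral>\<^sup>+ \<omega>. ennreal (1 / \<tau>) * (\<integral>\<^sup>+ x\<in>{0..<\<tau>}. proj_diag \<epsilon> \<omega> x \<partial>lborel) \<partial>M)"
    unfolding ids_def if_not_P[OF False]
  proof (rule nn_integral_cong_AE, use proj_diag_eq[of \<epsilon>] in eventually_elim)
    case (elim \<omega>)
    have "(\<integral>\<^sup>+ x\<in>{0..\<tau>}. ennreal (spec_kernel (H \<omega>) {\<epsilon>..} x x) \<partial>lborel) = (\<integral>\<^sup>+ x\<in>{0..<\<tau>}. proj_diag \<epsilon> \<omega> x \<partial>lborel)"
    proof (rule nn_integral_cong_AE)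
      have "AE x in lborel. x \<noteq> \<tau>" by (rule AE_lborel_singleton)
      then show "AE x in lborel. ennreal (spec_kernel (H \<omega>) {\<epsilon>..} x x) * indicator {0..\<tau>} x = proj_diag \<epsilon> \<omega> x * indicator {0..<\<tau>} x"
        by eventually_elim (use elim in \<open>auto simp: indicator_def\<close>)
    qed
    then show ?case by simp
  qed
  then show ?thesis
    unfolding S.avg_def by (simp only: nn_integral_cmult[OF S.inner_measurable[OF S.borel_kernel_lborel proj_diag_measurable[OF \<epsilon>]]])
qed

lemma proj_diag_antimono: "0 < \<epsilon> \<Longrightarrow> \<epsilon> \<le> \<epsilon>' \<Longrightarrow> proj_diag \<epsilon>' \<omega> x \<le> proj_diag \<epsilon> \<omega> x"
  using scaled_kernel.spec_kernel_antimono[OF scaled, of \<omega> \<epsilon> \<epsilon>' x] by (simp add: proj_diag_def)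

lemma SUP_proj_diag:
  assumes "\<omega> \<in> \<Omega>"
  shows "(SUP m. proj_diag (1 / real (Suc m)) \<omega> x) = (\<Sum>n. ennreal (real (Suc n) * momV (hankel_kernel (h' \<omega>)) n 0 x))"
proof -
  interpret scaled_kernel "hankel_kernel (h' \<omega>)" "H \<omega>" \<kappa> by (rule scaled[OF assms])
  have "proj_diag (1 / real (Suc m)) \<omega> x = ennreal (spec_kernel (H \<omega>) {1 / real (Suc m)..} x x)" for m
    using assms by (simp only: proj_diag_def if_True)
  then show ?thesis by (simp only: momV_eq SUP_spec_kernel)
qed

lemma support_scale: "\<omega> \<in> \<Omega> \<Longrightarrow> measure_support (\<Sigma>' \<omega>) = measure_support (\<Sigma> \<omega>)"
proof -
  assume \<omega>: "\<omega> \<in> \<Omega>"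
  have "sets (\<Sigma> \<omega>) = sets borel"
    using hankel_measure.sets_\<Sigma>[OF good[OF \<omega>]] by simp
  then have "emeasure (\<Sigma>' \<omega>) (ball x e) = ennreal \<kappa> * emeasure (\<Sigma> \<omega>) (ball x e)" for x e
    using \<omega> by (simp add: \<Sigma>'_def emeasure_density_const)
  then show ?thesis
    using \<kappa> by (simp add: measure_support_def ennreal_zero_less_mult_iff)
qed

theorem ids_pos_eq_supp_density: "ids_pos M \<tau> Gr H = supp_density M \<tau> \<Sigma>"
proof -
  let ?e = "\<lambda>m. 1 / real (Suc m)"
  have "ids_pos M \<tau> Gr H = (SUP \<epsilon>\<in>{0<..}. ennreal (1 / \<tau>) * S.expV (proj_diag \<epsilon>))"
    unfolding ids_pos_def by (intro SUP_cong refl ids_eq) simp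
  \<comment> \<open>Monotone convergence handles increasing sequences, so the supremum over all real
    thresholds is passed to the cofinal sequence 1 / (m + 1).\<close>
  also have "\<dots> = (SUP m. ennreal (1 / \<tau>) * S.expV (proj_diag (?e m)))"
  proof (rule antisym)
    show "(SUP \<epsilon>\<in>{0<..}. ennreal (1 / \<tau>) * S.expV (proj_diag \<epsilon>)) \<le> (SUP m. ennreal (1 / \<tau>) * S.expV (proj_diag (?e m)))"
    proof (rule SUP_least)
      fix \<epsilon> :: real assume "\<epsilon> \<in> {0<..}"
      then obtain m where m: "?e m < \<epsilon>" using reals_Archimedean[of \<epsilon>] by (auto simp: inverse_eq_divide)
      have "S.expV (proj_diag \<epsilon>) \<le> S.expV (proj_diag (?e m))"
        using m by (intro S.avg_mono_AE[OF S.borel_kernel_lborel] AE_I2 allI proj_diag_antimono) auto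
      then have "ennreal (1 / \<tau>) * S.expV (proj_diag \<epsilon>) \<le> ennreal (1 / \<tau>) * S.expV (proj_diag (?e m))"
        by (intro mult_left_mono) auto
      also have "\<dots> \<le> (SUP m. ennreal (1 / \<tau>) * S.expV (proj_diag (?e m)))"
        by (rule SUP_upper) simp
      finally show "ennreal (1 / \<tau>) * S.expV (proj_diag \<epsilon>) \<le> (SUP m. ennreal (1 / \<tau>) * S.expV (proj_diag (?e m)))" .
    qed
    show "(SUP m. ennreal (1 / \<tau>) * S.expV (proj_diag (?e m))) \<le> (SUP \<epsilon>\<in>{0<..}. ennreal (1 / \<tau>) * S.expV (proj_diag \<epsilon>))"
      by (rule SUP_least, rule SUP_upper) simp
  qed
  also have "\<dots> = ennreal (1 / \<tau>) * S.expV (\<lambda>\<omega> x. SUP m. proj_diag (?e m) \<omega> x)"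
  proof -
    have "S.expV (\<lambda>\<omega> x. SUP m. proj_diag (?e m) \<omega> x) = (SUP m. S.expV (proj_diag (?e m)))"
      by (intro S.avg_SUP[OF S.borel_kernel_lborel] proj_diag_measurable proj_diag_antimono) (auto simp: frac_le)
    then show ?thesis by (simp only: SUP_mult_left_ennreal)
  qed
  also have "S.expV (\<lambda>\<omega> x. SUP m. proj_diag (?e m) \<omega> x) = S.expV (\<lambda>\<omega> x. \<Sum>n. ennreal (real (Suc n) * momV (S.K \<omega>) n 0 x))"
  proof (rule antisym)
    show "S.expV (\<lambda>\<omega> x. SUP m. proj_diag (?e m) \<omega> x) \<le> S.expV (\<lambda>\<omega> x. \<Sum>n. ennreal (real (Suc n) * momV (S.K \<omega>) n 0 x))"
      by (rule S.avg_mono_AE[OF S.borel_kernel_lborel], use \<Omega>(2) in eventually_elim) (simp only: SUP_proj_diag order_refl simp_thms)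
    show "S.expV (\<lambda>\<omega> x. \<Sum>n. ennreal (real (Suc n) * momV (S.K \<omega>) n 0 x)) \<le> S.expV (\<lambda>\<omega> x. SUP m. proj_diag (?e m) \<omega> x)"
      by (rule S.avg_mono_AE[OF S.borel_kernel_lborel], use \<Omega>(2) in eventually_elim) (simp only: SUP_proj_diag order_refl simp_thms)
  qed
  also have "\<dots> = (\<integral>\<^sup>+ \<omega>. ecard (measure_support (\<Sigma>' \<omega>) \<inter> {0..<\<tau>}) \<partial>M)"
    by (rule S.expV_eq_density)
  also have "\<dots> = (\<integral>\<^sup>+ \<omega>. ecard (measure_support (\<Sigma> \<omega>) \<inter> {0..<\<tau>}) \<partial>M)"
    by (rule nn_integral_cong_AE, use \<Omega>(2) in eventually_elim) (simp only: support_scale)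
  finally show ?thesis unfolding supp_density_def .
qed

end

theorem theorem7p3:
  fixes M :: "'a measure" and G :: "real set" and T :: "real \<Rightarrow> 'a \<Rightarrow> 'a"
    and \<tau> :: real and h :: "'a \<Rightarrow> real \<Rightarrow> real" and \<Sigma> :: "'a \<Rightarrow> real measure"
  assumes erg: "ergodic_hankel M G T \<tau> h"
    and psd: "AE \<omega> in M. \<forall>f. sq_int f \<longrightarrow> l2_inner (kop (hankel_kernel (h \<omega>)) f) f \<ge> 0"
    and Sigma: "AE \<omega> in M. sets (\<Sigma> \<omega>) = sets borel \<and>
        (\<forall>t>0. has_bochner_integral (\<Sigma> \<omega>) (\<lambda>\<xi>. exp (- t * exp (- \<xi>)) * exp (- \<xi>)) (h \<omega> t))"
  shows "ids_pos M \<tau> G (\<lambda>\<omega>. hankel_kernel (h \<omega>)) = supp_density M \<tau> \<Sigma>"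
proof -
  have e: "0 < \<tau>" "G = UNIV \<or> G = range real_of_int"
    "\<forall>a\<in>G. T a \<in> measurable M M \<and> distr M M (T a) = M"
    "\<forall>f g. sq_int f \<and> sq_int g \<longrightarrow>
        (\<lambda>\<omega>. l2_inner (kop (hankel_kernel (h \<omega>)) f) g) \<in> borel_measurable M"
    "\<forall>a\<in>G. \<forall>\<omega>\<in>space M. \<forall>f. sq_int f \<longrightarrow>
        (AE x in lborel. kop (hankel_kernel (h (T a \<omega>))) (\<lambda>\<xi>. f (\<xi> + \<tau> * a)) x
                         = kop (hankel_kernel (h \<omega>)) f (x + \<tau> * a))"
    using erg unfolding ergodic_hankel_def by - (elim conjE, assumption)+
  have "\<exists>C. AE \<omega> in M. \<forall>t>0. \<bar>h \<omega> t\<bar> \<le> C / t"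
    using erg unfolding ergodic_hankel_def by (elim conjE)
  then obtain C where "AE \<omega> in M. \<forall>t>0. \<bar>h \<omega> t\<bar> \<le> C / t" ..
  with psd Sigma have "AE \<omega> in M. (\<forall>t>0. \<bar>h \<omega> t\<bar> \<le> C / t) \<and>
      (\<forall>f. sq_int f \<longrightarrow> l2_inner (kop (hankel_kernel (h \<omega>)) f) f \<ge> 0) \<and>
      sets (\<Sigma> \<omega>) = sets borel \<and>
      (\<forall>t>0. has_bochner_integral (\<Sigma> \<omega>) (\<lambda>\<xi>. exp (- t * exp (- \<xi>)) * exp (- \<xi>)) (h \<omega> t))"
    by eventually_elim blast
  \<comment> \<open>The set where all the properties hold need not be measurable; the complement of
    a measurable null set is used as the good set.\<close>
  then obtain N where N: "N \<in> sets M" "emeasure M N = 0" and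
    props: "\<And>\<omega>. \<omega> \<in> space M - N \<Longrightarrow> (\<forall>t>0. \<bar>h \<omega> t\<bar> \<le> C / t) \<and>
      (\<forall>f. sq_int f \<longrightarrow> l2_inner (kop (hankel_kernel (h \<omega>)) f) f \<ge> 0) \<and>
      sets (\<Sigma> \<omega>) = sets borel \<and>
      (\<forall>t>0. has_bochner_integral (\<Sigma> \<omega>) (\<lambda>\<xi>. exp (- t * exp (- \<xi>)) * exp (- \<xi>)) (h \<omega> t))"
    by (rule AE_E) blast
  \<comment> \<open>C may be 0 or negative, so it is replaced by a positive bound; then \<kappa> = 1
    / (4 D) turns the bound D / t into 1 / (4 t).\<close>
  define D where "D = \<bar>C\<bar> + 1"
  define \<kappa> where "\<kappa> = 1 / (4 * D)"
  have D: "0 < D" "C \<le> D" by (auto simp: D_def)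
  then have \<kappa>: "0 < \<kappa>" by (simp add: \<kappa>_def)
  interpret prob_space M using erg by (simp add: ergodic_hankel_def)
  interpret normalised_hankel M G T \<tau> h \<Sigma> \<kappa> "space M - N"
  proof (intro normalised_hankel.intro normalised_hankel_axioms.intro)
    show "prob_space M" by (rule prob_space_axioms)
    show "AE \<omega> in M. \<omega> \<in> space M - N"
    proof -
      have "N \<in> null_sets M" using N by (simp add: null_sets_def)
      from AE_not_in[OF this] AE_space show ?thesis by eventually_elim simp
    qed
    show "hankel_measure (\<lambda>t. \<kappa> * h \<omega> t) (density (\<Sigma> \<omega>) (\<lambda>_. ennreal \<kappa>))" if \<omega>: "\<omega> \<in> space M - N" for \<omega>
    proof
      note p = props[OF \<omega>]
      show "sets (density (\<Sigma> \<omega>) (\<lambda>_. ennreal \<kappa>)) = sets borel" using p by simp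
      fix t :: real assume t: "0 < t"
      show "has_bochner_integral (density (\<Sigma> \<omega>) (\<lambda>_. ennreal \<kappa>)) (\<lambda>\<xi>. exp (- t * exp (- \<xi>)) * exp (- \<xi>)) (\<kappa> * h \<omega> t)"
      proof (rule has_bochner_integral_density)
        have *: "has_bochner_integral (\<Sigma> \<omega>) (\<lambda>\<xi>. exp (- t * exp (- \<xi>)) * exp (- \<xi>)) (h \<omega> t)"
          using p t by blast
        then show "(\<lambda>\<xi>. exp (- t * exp (- \<xi>)) * exp (- \<xi>)) \<in> borel_measurable (\<Sigma> \<omega>)"
          by (rule borel_measurable_has_bochner_integral)
        show "has_bochner_integral (\<Sigma> \<omega>) (\<lambda>\<xi>. \<kappa> *\<^sub>R (exp (- t * exp (- \<xi>)) * exp (- \<xi>))) (\<kappa> * h \<omega> t)"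
          using has_bochner_integral_mult_right[OF *, of \<kappa>] by simp
      qed (use \<kappa> in auto)
      have "\<kappa> * \<bar>h \<omega> t\<bar> \<le> \<kappa> * (D / t)"
      proof (rule mult_left_mono)
        have "C / t \<le> D / t" using t D by (intro divide_right_mono) auto
        then show "\<bar>h \<omega> t\<bar> \<le> D / t" using p t order_trans by blast
      qed (use \<kappa> in simp)
      also have "\<dots> = 1 / (4 * t)" using D by (simp add: \<kappa>_def)
      finally show "\<bar>\<kappa> * h \<omega> t\<bar> \<le> 1 / (4 * t)" using \<kappa> by (simp add: abs_mult)
    next
      fix f assume "sq_int f"
      then have "0 \<le> l2_inner (kop (hankel_kernel (h \<omega>)) f) f" using props[OF \<omega>] by blast
      moreover have "l2_inner (kop (hankel_kernel (\<lambda>t. \<kappa> * h \<omega> t)) f) f = \<kappa> * l2_inner (kop (hankel_kernel (h \<omega>)) f) f"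
        by (simp add: l2_inner_def kop_def hankel_kernel_def mult.left_commute[of _ \<kappa>] mult.assoc)
      ultimately show "0 \<le> l2_inner (kop (hankel_kernel (\<lambda>t. \<kappa> * h \<omega> t)) f) f" using \<kappa> by simp
    qed
  next
    show "space M - N \<in> sets M" using N(1) by simp
    show "0 < \<kappa>" by (rule \<kappa>)
    show "0 < \<tau>" "G = UNIV \<or> G = range real_of_int" by (fact e)+
    show "T a \<in> measurable M M" "distr M M (T a) = M" if "a \<in> G" for a
      using bspec[OF e(3) that] by simp_all
    show "(\<lambda>\<omega>. l2_inner (kop (hankel_kernel (h \<omega>)) f) g) \<in> borel_measurable M" if "sq_int f" "sq_int g" for f g
      using e(4) that by simp
    show "AE x in lborel. kop (hankel_kernel (h (T a \<omega>))) (\<lambda>\<xi>. f (\<xi> + \<tau> * a)) x = kop (hankel_kernel (h \<omega>)) f (x + \<tau> * a)"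
      if "a \<in> G" "\<omega> \<in> space M" "sq_int f" for a \<omega> f
      using bspec[OF bspec[OF e(5) that(1)] that(2)] that(3) by blast
  qed
  show ?thesis by (rule ids_pos_eq_supp_density)
qed

end
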